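(* Let $\pi\colon E\to I$ be a fibred site satisfying (i)--(iii) of the context, and equip $E$ with the co-evanescent topology. A presheaf $F=\{i\mapsto F_i\}$ on $E$ is a sheaf if and only if the following two conditions hold: (i) for every $i\in \mathrm{Ob}(I)$, $F_i$ is a sheaf on $E_i$; (ii) for every covering family $(f_n\colon i_n\to i)_{n\in\Sigma}$ of $I$, if for $(m,n)\in\Sigma^2$ one sets $i_{mn}=i_m\times_i i_n$ and denotes by $f_{mn}\colon i_{mn}\to i$ the canonical morphism, the sequence of morphisms of sheaves on $E_i$ $$F_i\longrightarrow \prod_{n\in\Sigma}(f_n)_*(F_{i_n})\rightrightarrows \prod_{(m,n)\in\Sigma^2}(f_{mn})_*(F_{i_{mn}})$$ is exact (i.e. an equalizer).
   Context: Fix a universe $\mathbb U$ containing an element of infinite cardinality; presheaves and sheaves are of $\mathbb U$-sets. Let $I$ be a $\mathbb U$-site and $\pi\colon E\to I$ a cleaved and normalized fibred category over the category underlying $I$, such that: (i) fibre products are representable in $I$; (ii) for every $i\in\mathrm{Ob}(I)$, the fibre category $E_i$ is equipped with a topology making it a $\mathbb U$-site, and finite limits are representable in $E_i$; (iii) for every morphism $f\colon i\to j$ of $I$, the inverse image functor $f^+\colon E_j\to E_i$ is continuous and left exact. Let $\widetilde E_i$ be the topos of sheaves on $E_i$. For $f\colon i\to j$ in $I$ and a presheaf $G$ on $E_i$, put $f_*(G)=G\circ f^+$, a presheaf on $E_j$ (a sheaf if $G$ is). The co-evanescent topology on $E$ is the topology generated by the families $(V_n\to V)_{n\in\Sigma}$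 of the following two types: (v) (vertical) there is $i\in \mathrm{Ob}(I)$ such that $(V_n\to V)_{n\in\Sigma}$ is a covering family of $E_i$; (c) (cartesian) there is a covering family $(f_n\colon i_n\to i)_{n\in\Sigma}$ of $I$, with $i=\pi(V)$, such that $V_n$ is isomorphic to $f_n^+(V)$ for all $n\in\Sigma$ (with $V_n\to V$ the canonical morphism). A presheaf $F$ on $E$ is identified with the family $\{i\mapsto F_i\}$, where $F_i=F|_{E_i}$ is a presheaf on $E_i$, together with the transition morphisms $F_j\to f_*(F_i)$ for $f\colon i\to j$ in $I$, obtained by applying $F$ to the canonical cartesian morphisms $f^+(V)\to V$ ($V\in\mathrm{Ob}(E_j)$). *)

theory Defs
  imports Main "HOL-Library.FuncSet" "HOL-Library.Equipollence"
begin

section \<open>Universes\<close>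

text \<open>
  The type \<open>'u\<close> is the universe itself: an element of \<open>'u\<close> is a \<open>\<U>\<close>-set, \<open>elts x\<close> is its
  set of members, and transitivity of the universe is built into the type of \<open>elts\<close>.  The
  assumptions are the usual axioms: pairs, power sets, unions of families of members of the universe
  indexed by a member of the universe, and existence of an infinite member.
\<close>

locale universe =
  fixes elts :: "'u \<Rightarrow> 'u set"
  assumes elts_inj: "inj elts"
    and pair: "\<exists>z. elts z = {x, y}"
    and power: "\<exists>p. elts ` elts p = Pow (elts x)"
    and family_union: "\<exists>y. elts y = (\<Union>w\<in>elts x. elts (f w))"
    and infinite_member: "\<exists>x. infinite (elts x)"

definition U_set :: "('u \<Rightarrow> 'u set) \<Rightarrow> 'u set \<Rightarrow> bool" where
  "U_set elts A \<longleftrightarrow> A \<in> range elts"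

definition U_small :: "('u \<Rightarrow> 'u set) \<Rightarrow> 'a set \<Rightarrow> bool" where
  "U_small elts A \<longleftrightarrow> (\<exists>x. A \<approx> elts x)"


section \<open>Categories, functors and limits\<close>

record ('o, 'm) cat =
  Ob :: "'o set"
  Mor :: "'m set"
  Dom :: "'m \<Rightarrow> 'o"
  Cod :: "'m \<Rightarrow> 'o"
  Ide :: "'o \<Rightarrow> 'm"
  Comp :: "'m \<Rightarrow> 'm \<Rightarrow> 'm"  (infixr "\<cdot>\<index>" 75)

definition hom :: "('o, 'm) cat \<Rightarrow> 'o \<Rightarrow> 'o \<Rightarrow> 'm set" where
  "hom C X Y = {u \<in> Mor C. Dom C u = X \<and> Cod C u = Y}"

locale category =
  fixes C :: "('o, 'm) cat"
  assumes dom_ob: "u \<in> Mor C \<Longrightarrow> Dom C u \<in> Ob C"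
    and cod_ob: "u \<in> Mor C \<Longrightarrow> Cod C u \<in> Ob C"
    and ide_hom: "X \<in> Ob C \<Longrightarrow> Ide C X \<in> hom C X X"
    and comp_hom: "u \<in> hom C X Y \<Longrightarrow> v \<in> hom C Y Z \<Longrightarrow> v \<cdot>\<^bsub>C\<^esub> u \<in> hom C X Z"
    and comp_ide: "u \<in> hom C X Y \<Longrightarrow> u \<cdot>\<^bsub>C\<^esub> Ide C X = u"
    and ide_comp: "u \<in> hom C X Y \<Longrightarrow> Ide C Y \<cdot>\<^bsub>C\<^esub> u = u"
    and comp_assoc: "u \<in> hom C X Y \<Longrightarrow> v \<in> hom C Y Z \<Longrightarrow> w \<in> hom C Z T \<Longrightarrow>
          (w \<cdot>\<^bsub>C\<^esub> v) \<cdot>\<^bsub>C\<^esub> u = w \<cdot>\<^bsub>C\<^esub> (v \<cdot>\<^bsub>C\<^esub> u)"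

definition iso_in :: "('o, 'm) cat \<Rightarrow> 'o \<Rightarrow> 'o \<Rightarrow> 'm \<Rightarrow> bool" where
  "iso_in C X Y u \<longleftrightarrow> u \<in> hom C X Y \<and>
     (\<exists>v \<in> hom C Y X. v \<cdot>\<^bsub>C\<^esub> u = Ide C X \<and> u \<cdot>\<^bsub>C\<^esub> v = Ide C Y)"

record ('o1, 'm1, 'o2, 'm2) ftr =
  fob :: "'o1 \<Rightarrow> 'o2"
  fmor :: "'m1 \<Rightarrow> 'm2"

locale is_functor = source: category C + target: category D
  for C :: "('o1, 'm1) cat" and D :: "('o2, 'm2) cat" +
  fixes T :: "('o1, 'm1, 'o2, 'm2) ftr"
  assumes fob_ob: "X \<in> Ob C \<Longrightarrow> fob T X \<in> Ob D"
    and fmor_hom: "u \<in> hom C X Y \<Longrightarrow> fmor T u \<in> hom D (fob T X) (fob T Y)"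
    and fmor_ide: "X \<in> Ob C \<Longrightarrow> fmor T (Ide C X) = Ide D (fob T X)"
    and fmor_comp: "u \<in> hom C X Y \<Longrightarrow> v \<in> hom C Y Z \<Longrightarrow>
          fmor T (v \<cdot>\<^bsub>C\<^esub> u) = fmor T v \<cdot>\<^bsub>D\<^esub> fmor T u"

definition ftr_comp ::
  "('o2, 'm2, 'o3, 'm3) ftr \<Rightarrow> ('o1, 'm1, 'o2, 'm2) ftr \<Rightarrow> ('o1, 'm1, 'o3, 'm3) ftr" where
  "ftr_comp T S = \<lparr>fob = fob T \<circ> fob S, fmor = fmor T \<circ> fmor S\<rparr>"

definition cone ::
  "('jo, 'jm) cat \<Rightarrow> ('o, 'm) cat \<Rightarrow> ('jo, 'jm, 'o, 'm) ftr \<Rightarrow> 'o \<Rightarrow> ('jo \<Rightarrow> 'm) \<Rightarrow> bool" where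
  "cone A C D L l \<longleftrightarrow> L \<in> Ob C \<and> (\<forall>a\<in>Ob A. l a \<in> hom C L (fob D a)) \<and>
     (\<forall>h\<in>Mor A. fmor D h \<cdot>\<^bsub>C\<^esub> l (Dom A h) = l (Cod A h))"

definition limit_cone ::
  "('jo, 'jm) cat \<Rightarrow> ('o, 'm) cat \<Rightarrow> ('jo, 'jm, 'o, 'm) ftr \<Rightarrow> 'o \<Rightarrow> ('jo \<Rightarrow> 'm) \<Rightarrow> bool" where
  "limit_cone A C D L l \<longleftrightarrow> cone A C D L l \<and>
     (\<forall>M m. cone A C D M m \<longrightarrow> (\<exists>!u. u \<in> hom C M L \<and> (\<forall>a\<in>Ob A. l a \<cdot>\<^bsub>C\<^esub> u = m a)))"

text \<open>Every finite category is isomorphic to one whose objects and morphisms are natural numbers.\<close>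

definition has_finite_limits :: "('o, 'm) cat \<Rightarrow> bool" where
  "has_finite_limits C \<longleftrightarrow> (\<forall>(A :: (nat, nat) cat) D.
     finite (Ob A) \<and> finite (Mor A) \<and> is_functor A C D \<longrightarrow> (\<exists>L l. limit_cone A C D L l))"

definition left_exact ::
  "('o1, 'm1) cat \<Rightarrow> ('o2, 'm2) cat \<Rightarrow> ('o1, 'm1, 'o2, 'm2) ftr \<Rightarrow> bool" where
  "left_exact C C' T \<longleftrightarrow> is_functor C C' T \<and> (\<forall>(A :: (nat, nat) cat) D L l.
     finite (Ob A) \<and> finite (Mor A) \<and> is_functor A C D \<and> limit_cone A C D L l \<longrightarrow>
       limit_cone A C' (ftr_comp T D) (fob T L) (\<lambda>a. fmor T (l a)))"

definition is_fibre_product :: "('o, 'm) cat \<Rightarrow> 'm \<Rightarrow> 'm \<Rightarrow> 'm \<Rightarrow> 'm \<Rightarrow> bool" where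
  "is_fibre_product C f g p q \<longleftrightarrow>
     {f, g, p, q} \<subseteq> Mor C \<and> Cod C f = Cod C g \<and> Dom C p = Dom C q \<and>
     Cod C p = Dom C f \<and> Cod C q = Dom C g \<and> f \<cdot>\<^bsub>C\<^esub> p = g \<cdot>\<^bsub>C\<^esub> q \<and>
     (\<forall>T. \<forall>a \<in> hom C T (Dom C f). \<forall>b \<in> hom C T (Dom C g). f \<cdot>\<^bsub>C\<^esub> a = g \<cdot>\<^bsub>C\<^esub> b \<longrightarrow>
        (\<exists>!u. u \<in> hom C T (Dom C p) \<and> p \<cdot>\<^bsub>C\<^esub> u = a \<and> q \<cdot>\<^bsub>C\<^esub> u = b))"

definition has_fibre_products :: "('o, 'm) cat \<Rightarrow> bool" where
  "has_fibre_products C \<longleftrightarrow> (\<forall>f\<in>Mor C. \<forall>g\<in>Mor C. Cod C f = Cod C g \<longrightarrow>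
     (\<exists>p q. is_fibre_product C f g p q))"


section \<open>Topologies\<close>

text \<open>A sieve on an object is represented by a set of morphisms with that codomain.\<close>

definition sieve :: "('o, 'm) cat \<Rightarrow> 'o \<Rightarrow> 'm set \<Rightarrow> bool" where
  "sieve C X R \<longleftrightarrow> R \<subseteq> {u \<in> Mor C. Cod C u = X} \<and>
     (\<forall>u\<in>R. \<forall>v\<in>Mor C. Cod C v = Dom C u \<longrightarrow> u \<cdot>\<^bsub>C\<^esub> v \<in> R)"

definition sieve_pullback :: "('o, 'm) cat \<Rightarrow> 'm \<Rightarrow> 'm set \<Rightarrow> 'm set" where
  "sieve_pullback C g R = {v \<in> Mor C. Cod C v = Dom C g \<and> g \<cdot>\<^bsub>C\<^esub> v \<in> R}"

locale topology = category C for C :: "('o, 'm) cat" +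
  fixes J :: "'o \<Rightarrow> 'm set set"
  assumes covering_sieve: "X \<in> Ob C \<Longrightarrow> R \<in> J X \<Longrightarrow> sieve C X R"
    and base_change: "X \<in> Ob C \<Longrightarrow> R \<in> J X \<Longrightarrow> g \<in> Mor C \<Longrightarrow> Cod C g = X \<Longrightarrow>
          sieve_pullback C g R \<in> J (Dom C g)"
    and local_character: "X \<in> Ob C \<Longrightarrow> R \<in> J X \<Longrightarrow> sieve C X S \<Longrightarrow>
          (\<And>g. g \<in> R \<Longrightarrow> sieve_pullback C g S \<in> J (Dom C g)) \<Longrightarrow> S \<in> J X"
    and maximal_sieve: "X \<in> Ob C \<Longrightarrow> {u \<in> Mor C. Cod C u = X} \<in> J X"

definition generated_sieve :: "('o, 'm) cat \<Rightarrow> 'n set \<Rightarrow> ('n \<Rightarrow> 'm) \<Rightarrow> 'm set" where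
  "generated_sieve C N \<phi> = {\<phi> n \<cdot>\<^bsub>C\<^esub> v | n v. n \<in> N \<and> v \<in> Mor C \<and> Cod C v = Dom C (\<phi> n)}"

definition covering_family ::
  "('o, 'm) cat \<Rightarrow> ('o \<Rightarrow> 'm set set) \<Rightarrow> 'o \<Rightarrow> 'n set \<Rightarrow> ('n \<Rightarrow> 'm) \<Rightarrow> bool" where
  "covering_family C J X N \<phi> \<longleftrightarrow> X \<in> Ob C \<and> (\<forall>n\<in>N. \<phi> n \<in> Mor C \<and> Cod C (\<phi> n) = X) \<and>
     generated_sieve C N \<phi> \<in> J X"

text \<open>The coarsest topology for which the given families, written as triples consisting of target,
  index set and morphisms, are covering.\<close>

definition generated_topology ::
  "('o, 'm) cat \<Rightarrow> ('o \<times> 'n set \<times> ('n \<Rightarrow> 'm)) set \<Rightarrow> 'o \<Rightarrow> 'm set set" where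
  "generated_topology C Fam X =
     {R. \<forall>J. topology C J \<and> (\<forall>(Y, N, \<phi>) \<in> Fam. covering_family C J Y N \<phi>) \<longrightarrow> R \<in> J X}"

text \<open>A category with small hom-sets, with a topology that has a small topologically generating set
  of objects.\<close>

definition U_site :: "('u \<Rightarrow> 'u set) \<Rightarrow> ('o, 'm) cat \<Rightarrow> ('o \<Rightarrow> 'm set set) \<Rightarrow> bool" where
  "U_site elts C J \<longleftrightarrow> topology C J \<and> (\<forall>X\<in>Ob C. \<forall>Y\<in>Ob C. U_small elts (hom C X Y)) \<and>
     (\<exists>G\<subseteq>Ob C. U_small elts G \<and>
        (\<forall>X\<in>Ob C. \<exists>S. Dom C ` S \<subseteq> G \<and> covering_family C J X S (\<lambda>u. u)))"


section \<open>Presheaves and sheaves of sets\<close>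

record ('o, 'm, 'v) psh =
  val :: "'o \<Rightarrow> 'v set"
  act :: "'m \<Rightarrow> 'v \<Rightarrow> 'v"

locale presheaf = category C for C :: "('o, 'm) cat" +
  fixes F :: "('o, 'm, 'v) psh"
  assumes act_val: "u \<in> Mor C \<Longrightarrow> s \<in> val F (Cod C u) \<Longrightarrow> act F u s \<in> val F (Dom C u)"
    and act_ide: "X \<in> Ob C \<Longrightarrow> s \<in> val F X \<Longrightarrow> act F (Ide C X) s = s"
    and act_comp: "u \<in> hom C X Y \<Longrightarrow> v \<in> hom C Y Z \<Longrightarrow> s \<in> val F Z \<Longrightarrow>
          act F (v \<cdot>\<^bsub>C\<^esub> u) s = act F u (act F v s)"

definition U_presheaf ::
  "('u \<Rightarrow> 'u set) \<Rightarrow> ('o, 'm) cat \<Rightarrow> ('o, 'm, 'u) psh \<Rightarrow> bool" where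
  "U_presheaf elts C F \<longleftrightarrow> presheaf C F \<and> (\<forall>X\<in>Ob C. U_set elts (val F X))"

text \<open>Matching families on a sieve \<open>R\<close> are the morphisms from \<open>R\<close>, regarded as a subpresheaf of a
  representable one, to \<open>F\<close>; a sheaf is thus a presheaf such that
  \<open>Hom(X, F) \<rightarrow> Hom(R, F)\<close> is bijective for every covering sieve \<open>R\<close> of \<open>X\<close>.\<close>

definition matching_family ::
  "('o, 'm) cat \<Rightarrow> ('o, 'm, 'v) psh \<Rightarrow> 'm set \<Rightarrow> ('m \<Rightarrow> 'v) \<Rightarrow> bool" where
  "matching_family C F R x \<longleftrightarrow> (\<forall>u\<in>R. x u \<in> val F (Dom C u) \<and>
     (\<forall>v\<in>Mor C. Cod C v = Dom C u \<longrightarrow> x (u \<cdot>\<^bsub>C\<^esub> v) = act F v (x u)))"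

definition sheaf ::
  "('o, 'm) cat \<Rightarrow> ('o \<Rightarrow> 'm set set) \<Rightarrow> ('o, 'm, 'v) psh \<Rightarrow> bool" where
  "sheaf C J F \<longleftrightarrow> presheaf C F \<and> (\<forall>X\<in>Ob C. \<forall>R\<in>J X. \<forall>x. matching_family C F R x \<longrightarrow>
     (\<exists>!s. s \<in> val F X \<and> (\<forall>u\<in>R. act F u s = x u)))"

definition U_sheaf ::
  "('u \<Rightarrow> 'u set) \<Rightarrow> ('o, 'm) cat \<Rightarrow> ('o \<Rightarrow> 'm set set) \<Rightarrow> ('o, 'm, 'u) psh \<Rightarrow> bool" where
  "U_sheaf elts C J F \<longleftrightarrow> U_presheaf elts C F \<and> sheaf C J F"

definition psh_comp ::
  "('o2, 'm2, 'v) psh \<Rightarrow> ('o1, 'm1, 'o2, 'm2) ftr \<Rightarrow> ('o1, 'm1, 'v) psh" where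
  "psh_comp F T = \<lparr>val = val F \<circ> fob T, act = act F \<circ> fmor T\<rparr>"

definition continuous_functor ::
  "('u \<Rightarrow> 'u set) \<Rightarrow> ('o1, 'm1) cat \<Rightarrow> ('o1 \<Rightarrow> 'm1 set set) \<Rightarrow>
   ('o2, 'm2) cat \<Rightarrow> ('o2 \<Rightarrow> 'm2 set set) \<Rightarrow> ('o1, 'm1, 'o2, 'm2) ftr \<Rightarrow> bool" where
  "continuous_functor elts C J C' J' T \<longleftrightarrow> is_functor C C' T \<and>
     (\<forall>G. U_sheaf elts C' J' G \<longrightarrow> U_sheaf elts C J (psh_comp G T))"

definition prod_psh ::
  "'n set \<Rightarrow> ('n \<Rightarrow> ('o, 'm, 'v) psh) \<Rightarrow> ('o, 'm, 'n \<Rightarrow> 'v) psh" where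
  "prod_psh N G = \<lparr>val = \<lambda>X. \<Pi>\<^sub>E n\<in>N. val (G n) X, act = \<lambda>u t. \<lambda>n\<in>N. act (G n) u (t n)\<rparr>"

definition psh_morphism ::
  "('o, 'm) cat \<Rightarrow> ('o, 'm, 'v) psh \<Rightarrow> ('o, 'm, 'w) psh \<Rightarrow> ('o \<Rightarrow> 'v \<Rightarrow> 'w) \<Rightarrow> bool" where
  "psh_morphism C A B a \<longleftrightarrow> (\<forall>X\<in>Ob C. a X \<in> val A X \<rightarrow> val B X) \<and>
     (\<forall>u\<in>Mor C. \<forall>s\<in>val A (Cod C u). a (Dom C u) (act A u s) = act B u (a (Cod C u) s))"

text \<open>Exactness of \<open>A \<rightarrow> B \<rightrightarrows> D\<close>.  Limits of sheaves of sets are computed objectwise;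
  \<open>exact_iff_equalizer\<close> below shows that this is the equalizer property in
  the category of sheaves.\<close>

definition exact_sequence ::
  "('o, 'm) cat \<Rightarrow> ('o, 'm, 'v) psh \<Rightarrow> ('o, 'm, 'w) psh \<Rightarrow> ('o, 'm, 'z) psh \<Rightarrow>
   ('o \<Rightarrow> 'v \<Rightarrow> 'w) \<Rightarrow> ('o \<Rightarrow> 'w \<Rightarrow> 'z) \<Rightarrow> ('o \<Rightarrow> 'w \<Rightarrow> 'z) \<Rightarrow> bool" where
  "exact_sequence C A B D a b c \<longleftrightarrow>
     psh_morphism C A B a \<and> psh_morphism C B D b \<and> psh_morphism C B D c \<and>
     (\<forall>X\<in>Ob C. bij_betw (a X) (val A X) {t \<in> val B X. b X t = c X t})"

definition equalizing ::
  "('o, 'm) cat \<Rightarrow> ('o, 'm, 't) psh \<Rightarrow> ('o, 'm, 'w) psh \<Rightarrow> ('o, 'm, 'z) psh \<Rightarrow>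
   ('o \<Rightarrow> 'w \<Rightarrow> 'z) \<Rightarrow> ('o \<Rightarrow> 'w \<Rightarrow> 'z) \<Rightarrow> ('o \<Rightarrow> 't \<Rightarrow> 'w) \<Rightarrow> bool" where
  "equalizing C T B D b c h \<longleftrightarrow> psh_morphism C T B h \<and>
     (\<forall>X\<in>Ob C. \<forall>s\<in>val T X. b X (h X s) = c X (h X s))"

definition factors_uniquely ::
  "('o, 'm) cat \<Rightarrow> ('o, 'm, 't) psh \<Rightarrow> ('o, 'm, 'v) psh \<Rightarrow>
   ('o \<Rightarrow> 'v \<Rightarrow> 'w) \<Rightarrow> ('o \<Rightarrow> 't \<Rightarrow> 'w) \<Rightarrow> bool" where
  "factors_uniquely C T A a h \<longleftrightarrow>
     (\<exists>g. psh_morphism C T A g \<and> (\<forall>X\<in>Ob C. \<forall>s\<in>val T X. a X (g X s) = h X s) \<and>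
        (\<forall>g'. psh_morphism C T A g' \<and> (\<forall>X\<in>Ob C. \<forall>s\<in>val T X. a X (g' X s) = h X s) \<longrightarrow>
           (\<forall>X\<in>Ob C. \<forall>s\<in>val T X. g' X s = g X s)))"

lemma exact_imp_factors_uniquely:
  assumes C: "category C" and T: "presheaf C T" and A: "presheaf C A"
    and ex: "exact_sequence C A B D a b c" and eq: "equalizing C T B D b c h"
  shows "factors_uniquely C T A a h"
proof -
  interpret category C by fact
  interpret T: presheaf C T by fact
  interpret A: presheaf C A by fact
  define g where "g X = the_inv_into (val A X) (a X) \<circ> h X" for X
  have a: "psh_morphism C A B a" and h: "psh_morphism C T B h"
    using ex eq by (auto simp: exact_sequence_def equalizing_def)
  have bij: "bij_betw (a X) (val A X) {t \<in> val B X. b X t = c X t}" if "X \<in> Ob C" for X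
    using ex that by (auto simp: exact_sequence_def)
  have hX: "h X s \<in> {t \<in> val B X. b X t = c X t}" if "X \<in> Ob C" "s \<in> val T X" for X s
    using that eq by (auto simp: equalizing_def psh_morphism_def)
  have g_val: "g X s \<in> val A X" and ag: "a X (g X s) = h X s"
    if "X \<in> Ob C" "s \<in> val T X" for X s
  proof -
    have i: "inj_on (a X) (val A X)" and m: "h X s \<in> a X ` val A X"
      using hX[OF that] bij[OF that(1)] by (simp_all add: bij_betw_def)
    show "g X s \<in> val A X" using the_inv_into_into[OF i m order.refl] by (simp add: g_def)
    show "a X (g X s) = h X s" using f_the_inv_into_f[OF i m] by (simp add: g_def)
  qed
  have inj: "x = y" if "X \<in> Ob C" "x \<in> val A X" "y \<in> val A X" "a X x = a X y" for X x y
    using bij[OF that(1)] that by (auto simp: bij_betw_def inj_on_def)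
  have "psh_morphism C T A g"
    unfolding psh_morphism_def
  proof (intro conjI ballI)
    show "g X \<in> val T X \<rightarrow> val A X" if "X \<in> Ob C" for X using g_val that by auto
    show "g (Dom C u) (act T u s) = act A u (g (Cod C u) s)"
      if u: "u \<in> Mor C" and s: "s \<in> val T (Cod C u)" for u s
    proof (rule inj)
      show "Dom C u \<in> Ob C" using u by (rule dom_ob)
      show "g (Dom C u) (act T u s) \<in> val A (Dom C u)"
        using u s dom_ob T.act_val g_val by blast
      show "act A u (g (Cod C u) s) \<in> val A (Dom C u)"
        using u s cod_ob A.act_val g_val by blast
      have "a (Dom C u) (g (Dom C u) (act T u s)) = h (Dom C u) (act T u s)"
        using u s dom_ob T.act_val ag by blast
      also have "\<dots> = act B u (h (Cod C u) s)" using h u s by (auto simp: psh_morphism_def)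
      also have "\<dots> = act B u (a (Cod C u) (g (Cod C u) s))" using u s cod_ob ag by metis
      also have "\<dots> = a (Dom C u) (act A u (g (Cod C u) s))"
        using a u s cod_ob g_val by (auto simp: psh_morphism_def)
      finally show "a (Dom C u) (g (Dom C u) (act T u s)) =
        a (Dom C u) (act A u (g (Cod C u) s))" .
    qed
  qed
  moreover have "g' X s = g X s"
    if "psh_morphism C T A g'" "\<forall>X\<in>Ob C. \<forall>s\<in>val T X. a X (g' X s) = h X s"
      "X \<in> Ob C" "s \<in> val T X" for g' X s
  proof (rule inj)
    show "g' X s \<in> val A X" using that by (auto simp: psh_morphism_def)
    show "g X s \<in> val A X" by (rule g_val) fact+
    show "a X (g' X s) = a X (g X s)" using that ag by simp
  qed fact
  ultimately show ?thesis
    unfolding factors_uniquely_def using ag by blast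
qed

text \<open>The objectwise equalizer of \<open>B \<rightrightarrows> D\<close> takes its values in the same type as \<open>B\<close>, so it
  suffices to test the universal property against sheaves valued in the types of \<open>A\<close> and \<open>B\<close>; the
  preceding lemma gives it for tests of any type.\<close>

theorem exact_iff_equalizer:
  fixes A :: "('o, 'm, 'v) psh" and B :: "('o, 'm, 'w) psh"
  assumes top: "topology C J" and A: "sheaf C J A" and B: "sheaf C J B" and D: "sheaf C J D"
    and a: "psh_morphism C A B a" and b: "psh_morphism C B D b" and c: "psh_morphism C B D c"
  shows "exact_sequence C A B D a b c \<longleftrightarrow>
    equalizing C A B D b c a \<and>
    (\<forall>(T :: ('o, 'm, 'v) psh) h. sheaf C J T \<and> equalizing C T B D b c h \<longrightarrow>
       factors_uniquely C T A a h) \<and>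
    (\<forall>(T :: ('o, 'm, 'w) psh) h. sheaf C J T \<and> equalizing C T B D b c h \<longrightarrow>
       factors_uniquely C T A a h)"
    (is "?ex \<longleftrightarrow> ?eq \<and> ?univA \<and> ?univ")
proof
  interpret topology C J by fact
  assume ?ex
  then have ?eq using a by (auto simp: equalizing_def exact_sequence_def bij_betw_def)
  moreover have ?univA ?univ
    using exact_imp_factors_uniquely[OF category_axioms _ _ \<open>?ex\<close>] A by (auto simp: sheaf_def)
  ultimately show "?eq \<and> ?univA \<and> ?univ" by blast
next
  interpret topology C J by fact
  interpret B: presheaf C B using B by (simp add: sheaf_def)
  interpret A: presheaf C A using A by (simp add: sheaf_def)
  assume "?eq \<and> ?univA \<and> ?univ"
  then have ?eq ?univA ?univ by blast+
  define K where "K = \<lparr>val = \<lambda>X. {t \<in> val B X. b X t = c X t}, act = act B\<rparr>"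
  have K_simps: "val K X = {t \<in> val B X. b X t = c X t}" "act K = act B" for X
    by (auto simp: K_def)
  have nat: "f (Dom C u) (act B u s) = act D u (f (Cod C u) s)"
    if "psh_morphism C B D f" "u \<in> Mor C" "s \<in> val B (Cod C u)" for f u s
    using that by (auto simp: psh_morphism_def)
  have K_psh: "presheaf C K"
  proof unfold_locales
    show "act K u s \<in> val K (Dom C u)" if "u \<in> Mor C" "s \<in> val K (Cod C u)" for u s
      using that B.act_val nat[OF b] nat[OF c] by (auto simp: K_simps)
  qed (auto simp: K_simps B.act_ide B.act_comp)
  have K_sheaf: "sheaf C J K"
    unfolding sheaf_def
  proof (intro conjI ballI allI impI K_psh)
    fix X R x assume X: "X \<in> Ob C" and R: "R \<in> J X" and x: "matching_family C K R x"
    have "matching_family C B R x" using x by (auto simp: matching_family_def K_simps)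
    then have ex1: "\<exists>!s. s \<in> val B X \<and> (\<forall>u\<in>R. act B u s = x u)"
      using B X R unfolding sheaf_def by blast
    from ex1 obtain s where s: "s \<in> val B X" "\<forall>u\<in>R. act B u s = x u" by (elim ex1E conjE)
    have RC: "u \<in> Mor C" "Cod C u = X" if "u \<in> R" for u
      using covering_sieve[OF X R] that by (auto simp: sieve_def)
    have D_val: "b X s \<in> val D X" "c X s \<in> val D X"
      using b c X s by (auto simp: psh_morphism_def)
    have bc: "act D u (b X s) = act D u (c X s)" if "u \<in> R" for u
    proof -
      have "act D u (b X s) = b (Dom C u) (x u)" using nat[OF b, of u s] RC[OF that] s that by auto
      also have "\<dots> = c (Dom C u) (x u)" using x that by (auto simp: matching_family_def K_simps)
      also have "\<dots> = act D u (c X s)" using nat[OF c, of u s] RC[OF that] s that by auto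
      finally show ?thesis .
    qed
    interpret D: presheaf C D using D by (simp add: sheaf_def)
    have "matching_family C D R (\<lambda>u. act D u (b X s))"
      unfolding matching_family_def
    proof (intro ballI conjI impI)
      show "act D u (b X s) \<in> val D (Dom C u)" if "u \<in> R" for u
        using D.act_val D_val RC that by auto
      show "act D (u \<cdot>\<^bsub>C\<^esub> v) (b X s) = act D v (act D u (b X s))"
        if "u \<in> R" "v \<in> Mor C" "Cod C v = Dom C u" for u v
        using D.act_comp[of v "Dom C v" "Dom C u" u X] D_val RC that by (auto simp: hom_def)
    qed
    then have "\<exists>!r. r \<in> val D X \<and> (\<forall>u\<in>R. act D u r = act D u (b X s))"
      using D X R unfolding sheaf_def by blast
    then have bcs: "b X s = c X s"
      by (rule ex1E) (use D_val bc in \<open>simp, metis\<close>)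
    show "\<exists>!s. s \<in> val K X \<and> (\<forall>u\<in>R. act K u s = x u)"
    proof (rule ex_ex1I)
      show "\<exists>s. s \<in> val K X \<and> (\<forall>u\<in>R. act K u s = x u)" using s bcs by (auto simp: K_simps)
      show "r = r'" if "r \<in> val K X \<and> (\<forall>u\<in>R. act K u r = x u)"
          "r' \<in> val K X \<and> (\<forall>u\<in>R. act K u r' = x u)" for r r'
        using ex1 that unfolding K_simps by blast
    qed
  qed
  have "equalizing C K B D b c (\<lambda>X t. t)"
    by (auto simp: equalizing_def psh_morphism_def K_simps)
  with \<open>?univ\<close> K_sheaf have "factors_uniquely C K A a (\<lambda>X t. t)" by blast
  then obtain g where g: "psh_morphism C K A g"
    and ag: "\<And>X t. X \<in> Ob C \<Longrightarrow> t \<in> val K X \<Longrightarrow> a X (g X t) = t"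
    unfolding factors_uniquely_def by blast
  have a_K: "a X s \<in> val K X" if "X \<in> Ob C" "s \<in> val A X" for X s
    using \<open>?eq\<close> that by (auto simp: equalizing_def psh_morphism_def K_simps)
  have g_val: "g X t \<in> val A X" if "X \<in> Ob C" "t \<in> val K X" for X t
    using g that by (auto simp: psh_morphism_def)
  have "equalizing C A B D b c a" by fact
  with \<open>?univA\<close> A have "factors_uniquely C A A a a" by blast
  then obtain r where
    r: "\<And>r'. psh_morphism C A A r' \<Longrightarrow> \<forall>X\<in>Ob C. \<forall>s\<in>val A X. a X (r' X s) = a X s \<Longrightarrow>
          \<forall>X\<in>Ob C. \<forall>s\<in>val A X. r' X s = r X s"
    unfolding factors_uniquely_def by blast
  have "psh_morphism C A A (\<lambda>X s. g X (a X s))"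
    unfolding psh_morphism_def
  proof (intro conjI ballI)
    show "(\<lambda>s. g X (a X s)) \<in> val A X \<rightarrow> val A X" if "X \<in> Ob C" for X
      using that a_K g_val by auto
    show "g (Dom C u) (a (Dom C u) (act A u s)) = act A u (g (Cod C u) (a (Cod C u) s))"
      if u: "u \<in> Mor C" and s: "s \<in> val A (Cod C u)" for u s
    proof -
      have "a (Dom C u) (act A u s) = act K u (a (Cod C u) s)"
        using a u s by (auto simp: psh_morphism_def K_simps)
      moreover have "a (Cod C u) s \<in> val K (Cod C u)" using a_K u s cod_ob by blast
      ultimately show ?thesis using g u unfolding psh_morphism_def by auto
    qed
  qed
  moreover have "\<forall>X\<in>Ob C. \<forall>s\<in>val A X. a X (g X (a X s)) = a X s" using ag a_K by blast
  ultimately have 1: "\<forall>X\<in>Ob C. \<forall>s\<in>val A X. g X (a X s) = r X s" by (rule r)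
  have "psh_morphism C A A (\<lambda>X s. s)" by (auto simp: psh_morphism_def)
  then have 2: "\<forall>X\<in>Ob C. \<forall>s\<in>val A X. s = r X s" by (rule r) simp
  have "bij_betw (a X) (val A X) {t \<in> val B X. b X t = c X t}" if X: "X \<in> Ob C" for X
    by (rule bij_betw_byWitness[of _ "g X"])
      (use X 1 2 ag a_K g_val in \<open>auto simp: K_simps\<close>)
  then show ?ex using a b c by (auto simp: exact_sequence_def)
qed


section \<open>Fibred categories\<close>

definition fibre ::
  "('eo, 'em) cat \<Rightarrow> ('io, 'im) cat \<Rightarrow> ('eo, 'em, 'io, 'im) ftr \<Rightarrow> 'io \<Rightarrow> ('eo, 'em) cat" where
  "fibre E I \<pi> i = \<lparr>Ob = {V \<in> Ob E. fob \<pi> V = i}, Mor = {u \<in> Mor E. fmor \<pi> u = Ide I i},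
     Dom = Dom E, Cod = Cod E, Ide = Ide E, Comp = Comp E\<rparr>"

text \<open>Cartesian morphisms and fibred categories in the sense of SGA 1, VI: the universal property
  concerns only morphisms over the same morphism of the base, and the composite of two
  cartesian morphisms is required to be cartesian.\<close>

definition cartesian ::
  "('eo, 'em) cat \<Rightarrow> ('io, 'im) cat \<Rightarrow> ('eo, 'em, 'io, 'im) ftr \<Rightarrow> 'em \<Rightarrow> bool" where
  "cartesian E I \<pi> u \<longleftrightarrow> u \<in> Mor E \<and>
     (\<forall>w\<in>Mor E. Cod E w = Cod E u \<and> fmor \<pi> w = fmor \<pi> u \<longrightarrow>
        (\<exists>!v. v \<in> hom (fibre E I \<pi> (fob \<pi> (Dom E u))) (Dom E w) (Dom E u) \<and> u \<cdot>\<^bsub>E\<^esub> v = w))"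

text \<open>\<open>\<kappa> f V\<close> is the chosen cartesian morphism from the inverse image of \<open>V\<close> by \<open>f\<close> to \<open>V\<close>.\<close>

locale cleaved_normalized_fibred_category = is_functor E I \<pi>
  for E :: "('eo, 'em) cat" and I :: "('io, 'im) cat" and \<pi> :: "('eo, 'em, 'io, 'im) ftr" +
  fixes \<kappa> :: "'im \<Rightarrow> 'eo \<Rightarrow> 'em"
  assumes cleavage: "f \<in> Mor I \<Longrightarrow> V \<in> Ob E \<Longrightarrow> fob \<pi> V = Cod I f \<Longrightarrow>
          cartesian E I \<pi> (\<kappa> f V) \<and> Cod E (\<kappa> f V) = V \<and> fmor \<pi> (\<kappa> f V) = f"
    and cartesian_comp: "cartesian E I \<pi> u \<Longrightarrow> cartesian E I \<pi> v \<Longrightarrow> Cod E v = Dom E u \<Longrightarrow>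
          cartesian E I \<pi> (u \<cdot>\<^bsub>E\<^esub> v)"
    and normalized: "V \<in> Ob E \<Longrightarrow> \<kappa> (Ide I (fob \<pi> V)) V = Ide E V"

text \<open>The functor \<open>f\<^sup>+\<close> from the fibre over \<open>Cod I f\<close> to the fibre over \<open>Dom I f\<close>.\<close>

definition inverse_image ::
  "('eo, 'em) cat \<Rightarrow> ('io, 'im) cat \<Rightarrow> ('eo, 'em, 'io, 'im) ftr \<Rightarrow> ('im \<Rightarrow> 'eo \<Rightarrow> 'em) \<Rightarrow>
   'im \<Rightarrow> ('eo, 'em, 'eo, 'em) ftr" where
  "inverse_image E I \<pi> \<kappa> f = \<lparr>
     fob = \<lambda>V. Dom E (\<kappa> f V),
     fmor = \<lambda>u. THE w.
       w \<in> hom (fibre E I \<pi> (Dom I f)) (Dom E (\<kappa> f (Dom E u))) (Dom E (\<kappa> f (Cod E u))) \<and>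
       \<kappa> f (Cod E u) \<cdot>\<^bsub>E\<^esub> w = u \<cdot>\<^bsub>E\<^esub> \<kappa> f (Dom E u)\<rparr>"

text \<open>The canonical isomorphism from \<open>(f p)\<^sup>+(V)\<close> to \<open>p\<^sup>+(f\<^sup>+(V))\<close>.\<close>

definition comp_iso ::
  "('eo, 'em) cat \<Rightarrow> ('io, 'im) cat \<Rightarrow> ('eo, 'em, 'io, 'im) ftr \<Rightarrow> ('im \<Rightarrow> 'eo \<Rightarrow> 'em) \<Rightarrow>
   'im \<Rightarrow> 'im \<Rightarrow> 'eo \<Rightarrow> 'em" where
  "comp_iso E I \<pi> \<kappa> f p V = (let W = Dom E (\<kappa> f V) in
     THE w. w \<in> hom (fibre E I \<pi> (Dom I p)) (Dom E (\<kappa> (f \<cdot>\<^bsub>I\<^esub> p) V)) (Dom E (\<kappa> p W)) \<and>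
       \<kappa> f V \<cdot>\<^bsub>E\<^esub> \<kappa> p W \<cdot>\<^bsub>E\<^esub> w = \<kappa> (f \<cdot>\<^bsub>I\<^esub> p) V)"


section \<open>Fibred sites and the co-evanescent topology\<close>

locale fibred_site =
  universe elts + cleaved_normalized_fibred_category E I \<pi> \<kappa>
  for elts :: "'u \<Rightarrow> 'u set"
    and I :: "('io, 'im) cat" and JI :: "'io \<Rightarrow> 'im set set"
    and E :: "('eo, 'em) cat" and \<pi> :: "('eo, 'em, 'io, 'im) ftr"
    and \<kappa> :: "'im \<Rightarrow> 'eo \<Rightarrow> 'em" and JE :: "'io \<Rightarrow> 'eo \<Rightarrow> 'em set set" +
  assumes base_site: "U_site elts I JI"
    and base_fibre_products: "has_fibre_products I"
    and fibre_site: "i \<in> Ob I \<Longrightarrow> U_site elts (fibre E I \<pi> i) (JE i)"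
    and fibre_limits: "i \<in> Ob I \<Longrightarrow> has_finite_limits (fibre E I \<pi> i)"
    and inverse_image_continuous: "f \<in> Mor I \<Longrightarrow>
          continuous_functor elts (fibre E I \<pi> (Cod I f)) (JE (Cod I f))
            (fibre E I \<pi> (Dom I f)) (JE (Dom I f)) (inverse_image E I \<pi> \<kappa> f)"
    and inverse_image_left_exact: "f \<in> Mor I \<Longrightarrow>
          left_exact (fibre E I \<pi> (Cod I f)) (fibre E I \<pi> (Dom I f)) (inverse_image E I \<pi> \<kappa> f)"

definition vertical_families ::
  "('io, 'im) cat \<Rightarrow> ('eo, 'em) cat \<Rightarrow> ('eo, 'em, 'io, 'im) ftr \<Rightarrow>
   ('io \<Rightarrow> 'eo \<Rightarrow> 'em set set) \<Rightarrow> ('eo \<times> 'n set \<times> ('n \<Rightarrow> 'em)) set" where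
  "vertical_families I E \<pi> JE =
     {(V, N, \<phi>). \<exists>i\<in>Ob I. covering_family (fibre E I \<pi> i) (JE i) V N \<phi>}"

definition cartesian_families ::
  "('io, 'im) cat \<Rightarrow> ('io \<Rightarrow> 'im set set) \<Rightarrow> ('eo, 'em) cat \<Rightarrow> ('eo, 'em, 'io, 'im) ftr \<Rightarrow>
   ('im \<Rightarrow> 'eo \<Rightarrow> 'em) \<Rightarrow> ('eo \<times> 'n set \<times> ('n \<Rightarrow> 'em)) set" where
  "cartesian_families I JI E \<pi> \<kappa> =
     {(V, N, \<phi>). V \<in> Ob E \<and> (\<exists>f W \<theta>. covering_family I JI (fob \<pi> V) N f \<and>
        (\<forall>n\<in>N. iso_in (fibre E I \<pi> (Dom I (f n))) (W n) (Dom E (\<kappa> (f n) V)) (\<theta> n) \<and>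
                \<phi> n = \<kappa> (f n) V \<cdot>\<^bsub>E\<^esub> \<theta> n))}"

text \<open>Whether a family is covering depends only on the set of its members, and in a cartesian family
  \<open>f n\<close> is determined by \<open>\<phi> n\<close>; so it is enough to use families indexed by sets of
  morphisms of \<open>E\<close>.\<close>

definition coevanescent_topology ::
  "('io, 'im) cat \<Rightarrow> ('io \<Rightarrow> 'im set set) \<Rightarrow> ('eo, 'em) cat \<Rightarrow> ('eo, 'em, 'io, 'im) ftr \<Rightarrow>
   ('im \<Rightarrow> 'eo \<Rightarrow> 'em) \<Rightarrow> ('io \<Rightarrow> 'eo \<Rightarrow> 'em set set) \<Rightarrow> 'eo \<Rightarrow> 'em set set" where
  "coevanescent_topology I JI E \<pi> \<kappa> JE = generated_topology E
     ((vertical_families I E \<pi> JE \<union> cartesian_families I JI E \<pi> \<kappa>)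
        :: ('eo \<times> 'em set \<times> ('em \<Rightarrow> 'em)) set)"


section \<open>The sequence attached to a covering family of the base\<close>

text \<open>The restriction \<open>F\<^sub>i\<close> of \<open>F\<close> to the fibre over \<open>i\<close>.\<close>

definition fibre_psh ::
  "('io, 'im) cat \<Rightarrow> ('eo, 'em) cat \<Rightarrow> ('eo, 'em, 'io, 'im) ftr \<Rightarrow>
   ('eo, 'em, 'v) psh \<Rightarrow> 'io \<Rightarrow> ('eo, 'em, 'v) psh" where
  "fibre_psh I E \<pi> F i = \<lparr>val = restrict (val F) (Ob (fibre E I \<pi> i)),
     act = restrict (act F) (Mor (fibre E I \<pi> i))\<rparr>"

definition direct_image ::
  "('io, 'im) cat \<Rightarrow> ('eo, 'em) cat \<Rightarrow> ('eo, 'em, 'io, 'im) ftr \<Rightarrow> ('im \<Rightarrow> 'eo \<Rightarrow> 'em) \<Rightarrow>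
   'im \<Rightarrow> ('eo, 'em, 'v) psh \<Rightarrow> ('eo, 'em, 'v) psh" where
  "direct_image I E \<pi> \<kappa> f G = psh_comp G (inverse_image E I \<pi> \<kappa> f)"

text \<open>The component at \<open>V\<close> of the transition morphism \<open>F\<^sub>j \<rightarrow> f\<^sub>*(F\<^sub>i)\<close>.\<close>

definition transition ::
  "('im \<Rightarrow> 'eo \<Rightarrow> 'em) \<Rightarrow> ('eo, 'em, 'v) psh \<Rightarrow> 'im \<Rightarrow> 'eo \<Rightarrow> 'v \<Rightarrow> 'v" where
  "transition \<kappa> F f V = act F (\<kappa> f V)"

text \<open>The component at \<open>V\<close> of \<open>f\<^sub>*(F\<^sub>j) \<rightarrow> f\<^sub>*(p\<^sub>*(F\<^sub>k)) \<cong> (f p)\<^sub>*(F\<^sub>k)\<close>, for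
  \<open>p : k \<rightarrow> j\<close> and \<open>f : j \<rightarrow> i\<close>.\<close>

definition direct_image_transition ::
  "('io, 'im) cat \<Rightarrow> ('eo, 'em) cat \<Rightarrow> ('eo, 'em, 'io, 'im) ftr \<Rightarrow> ('im \<Rightarrow> 'eo \<Rightarrow> 'em) \<Rightarrow>
   ('eo, 'em, 'v) psh \<Rightarrow> 'im \<Rightarrow> 'im \<Rightarrow> 'eo \<Rightarrow> 'v \<Rightarrow> 'v" where
  "direct_image_transition I E \<pi> \<kappa> F f p V s =
     act F (comp_iso E I \<pi> \<kappa> f p V) (transition \<kappa> F p (fob (inverse_image E I \<pi> \<kappa> f) V) s)"

text \<open>\<open>pr1 f g\<close> and \<open>pr2 f g\<close> are the projections of a chosen fibre product of \<open>f\<close> and \<open>g\<close>.  The two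
  parallel morphisms are induced by the first and by the second projections; the
  morphism \<open>f\<^sub>m\<^sub>n\<close> is \<open>f m \<cdot> pr1 (f m) (f n) = f n \<cdot> pr2 (f m) (f n)\<close>.
  The index set \<open>N\<close> is an arbitrary subset of an arbitrary type \<open>'n\<close>.  A statement that assumes
  exactness for all covering families needs \<open>'n\<close> to be large enough to index every set of morphisms
  of \<open>I\<close>, which is expressed by \<open>Mor I \<lesssim> (UNIV :: 'n set)\<close>.\<close>

definition covering_sequence_exact ::
  "('io, 'im) cat \<Rightarrow> ('eo, 'em) cat \<Rightarrow> ('eo, 'em, 'io, 'im) ftr \<Rightarrow> ('im \<Rightarrow> 'eo \<Rightarrow> 'em) \<Rightarrow>
   ('im \<Rightarrow> 'im \<Rightarrow> 'im) \<Rightarrow> ('im \<Rightarrow> 'im \<Rightarrow> 'im) \<Rightarrow> ('eo, 'em, 'v) psh \<Rightarrow>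
   'io \<Rightarrow> 'n set \<Rightarrow> ('n \<Rightarrow> 'im) \<Rightarrow> bool" where
  "covering_sequence_exact I E \<pi> \<kappa> pr1 pr2 F i N f \<longleftrightarrow>
     (let p = (\<lambda>m n. pr1 (f m) (f n)); q = (\<lambda>m n. pr2 (f m) (f n)); ff = (\<lambda>m n. f m \<cdot>\<^bsub>I\<^esub> p m n)
      in exact_sequence (fibre E I \<pi> i)
        (fibre_psh I E \<pi> F i)
        (prod_psh N (\<lambda>n. direct_image I E \<pi> \<kappa> (f n) (fibre_psh I E \<pi> F (Dom I (f n)))))
        (prod_psh (N \<times> N)
          (\<lambda>(m, n). direct_image I E \<pi> \<kappa> (ff m n) (fibre_psh I E \<pi> F (Dom I (ff m n)))))
        (\<lambda>V s. \<lambda>n\<in>N. transition \<kappa> F (f n) V s)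
        (\<lambda>V t. \<lambda>(m, n)\<in>N \<times> N. direct_image_transition I E \<pi> \<kappa> F (f m) (p m n) V (t m))
        (\<lambda>V t. \<lambda>(m, n)\<in>N \<times> N. direct_image_transition I E \<pi> \<kappa> F (f n) (q m n) V (t n)))"

end

theory Submission
  imports Defs
begin

text \<open>
  The sieves all of whose pullbacks satisfy the sheaf condition for \<open>F\<close> form a topology, the finest
  one for which \<open>F\<close> is a sheaf (\<open>topology_sheaf_topology\<close>).  Hence \<open>F\<close> is a sheaf for the co-evanescent
  topology if and only if the sieves generated by the vertical and the cartesian families, and all
  their pullbacks, satisfy the sheaf condition.

  A cartesian family over a covering sieve \<open>R\<close> of the base generates the sieve of all morphisms to
  \<open>V\<close> whose projection lies in \<open>R\<close>, because the morphisms of the cleavage are cartesian.  The class of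
  these sieves is stable under pullback, and a matching family on such a sieve is a family of sections
  over the \<open>f\<^sub>n\<^sup>+(V)\<close> that agree over the \<open>f\<^sub>m\<^sub>n\<^sup>+(V)\<close>.  So the sheaf condition for the
  cartesian sieves is the exactness of the sequences (\<open>effective_cartesian_sieve_iff\<close>,
  \<open>covering_sequence_exact_iff\<close>).

  For the vertical families, let \<open>R\<close> be a covering sieve of \<open>V\<close> in a fibre category.  If the
  restrictions of \<open>F\<close> to the fibres are sheaves, then \<open>F\<close> satisfies the sheaf condition for the sieve
  of \<open>E\<close> generated by \<open>R\<close>.  Each pullback of this sieve contains another one of the same kind
  (\<open>vertical_base_change\<close>), as the functors \<open>f\<^sup>+\<close> send covering sieves to covering families.  The latter
  follows from continuity alone, tested on the sheaf of closed sieves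
  (\<open>continuous_functor_covering\<close>); the generating set of a site keeps this sheaf within the universe.
  For the converse, a matching family on \<open>R\<close> has to be extended to the sieve generated in \<open>E\<close>.
  This is where left exactness enters: the functors \<open>f\<^sup>+\<close> preserve fibre products, so that two
  factorizations through members of \<open>R\<close> both factor through a fibre product taken in the fibre
  (\<open>fibre_product_factor\<close>).
\<close>

section \<open>Sieves\<close>

lemma mem_sieve_pullback:
  "v \<in> sieve_pullback C g R \<longleftrightarrow> v \<in> Mor C \<and> Cod C v = Dom C g \<and> g \<cdot>\<^bsub>C\<^esub> v \<in> R"
  by (simp add: sieve_pullback_def)

lemma generated_sieve_section:
  assumes "\<And>u. u \<in> R \<Longrightarrow> \<phi> (h u) = u"
  shows "generated_sieve C (h ` R) \<phi> = generated_sieve C R (\<lambda>u. u)"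
proof -
  have "(\<exists>n v. w = \<phi> n \<cdot>\<^bsub>C\<^esub> v \<and> n \<in> h ` R \<and> v \<in> Mor C \<and> Cod C v = Dom C (\<phi> n)) \<longleftrightarrow>
    (\<exists>u v. w = u \<cdot>\<^bsub>C\<^esub> v \<and> u \<in> R \<and> v \<in> Mor C \<and> Cod C v = Dom C u)" for w
    using assms by (metis (no_types, lifting) imageE imageI)
  then show ?thesis by (simp add: generated_sieve_def)
qed

context category
begin

lemma comp_Mor [simp]:
  assumes "u \<in> Mor C" "v \<in> Mor C" "Cod C v = Dom C u"
  shows "u \<cdot>\<^bsub>C\<^esub> v \<in> Mor C" "Dom C (u \<cdot>\<^bsub>C\<^esub> v) = Dom C v" "Cod C (u \<cdot>\<^bsub>C\<^esub> v) = Cod C u"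
  using comp_hom[of v "Dom C v" "Dom C u" u "Cod C u"] assms by (auto simp: hom_def)

lemma ide_Mor [simp]:
  assumes "X \<in> Ob C"
  shows "Ide C X \<in> Mor C" "Dom C (Ide C X) = X" "Cod C (Ide C X) = X"
  using ide_hom[OF assms] by (auto simp: hom_def)

lemma comp_Ide [simp]:
  "u \<in> Mor C \<Longrightarrow> u \<cdot>\<^bsub>C\<^esub> Ide C (Dom C u) = u" "u \<in> Mor C \<Longrightarrow> Ide C (Cod C u) \<cdot>\<^bsub>C\<^esub> u = u"
  using comp_ide[of u] ide_comp[of u] by (auto simp: hom_def)

lemma comp_assoc_Mor:
  assumes "u \<in> Mor C" "v \<in> Mor C" "w \<in> Mor C" "Cod C u = Dom C v" "Cod C v = Dom C w"
  shows "(w \<cdot>\<^bsub>C\<^esub> v) \<cdot>\<^bsub>C\<^esub> u = w \<cdot>\<^bsub>C\<^esub> (v \<cdot>\<^bsub>C\<^esub> u)"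
  using comp_assoc[of u "Dom C u" "Dom C v" v "Dom C w" w "Cod C w"] assms by (auto simp: hom_def)

lemma sieve_sieve_pullback:
  assumes "sieve C X R" "g \<in> Mor C" "Cod C g = X"
  shows "sieve C (Dom C g) (sieve_pullback C g R)"
  using assms by (auto simp: sieve_def sieve_pullback_def comp_assoc_Mor[symmetric])

lemma sieve_pullback_comp:
  assumes "g \<in> Mor C" "h \<in> Mor C" "Cod C h = Dom C g"
  shows "sieve_pullback C h (sieve_pullback C g R) = sieve_pullback C (g \<cdot>\<^bsub>C\<^esub> h) R"
  using assms by (auto simp: sieve_pullback_def comp_assoc_Mor)

lemma sieve_pullback_Ide:
  assumes "X \<in> Ob C" "sieve C X R"
  shows "sieve_pullback C (Ide C X) R = R"
proof -
  have "Ide C X \<cdot>\<^bsub>C\<^esub> v = v" if "v \<in> Mor C" "Cod C v = X" for v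
    using that comp_Ide(2) by auto
  then show ?thesis using assms by (auto simp: sieve_def sieve_pullback_def)
qed

lemma sieve_pullback_member:
  assumes "sieve C X R" "u \<in> R"
  shows "sieve_pullback C u R = {v \<in> Mor C. Cod C v = Dom C u}"
  using assms by (auto simp: sieve_def sieve_pullback_def)

lemma sieve_generated_sieve:
  assumes "\<And>n. n \<in> N \<Longrightarrow> \<phi> n \<in> Mor C \<and> Cod C (\<phi> n) = X"
  shows "sieve C X (generated_sieve C N \<phi>)"
  unfolding sieve_def
proof (intro conjI ballI impI subsetI)
  show "u \<in> {u \<in> Mor C. Cod C u = X}" if "u \<in> generated_sieve C N \<phi>" for u
    using that assms by (auto simp: generated_sieve_def)
  fix u v assume u: "u \<in> generated_sieve C N \<phi>" and v: "v \<in> Mor C" "Cod C v = Dom C u"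
  then obtain n w where w: "u = \<phi> n \<cdot>\<^bsub>C\<^esub> w" "n \<in> N" "w \<in> Mor C" "Cod C w = Dom C (\<phi> n)"
    by (auto simp: generated_sieve_def)
  with v assms have "u \<cdot>\<^bsub>C\<^esub> v = \<phi> n \<cdot>\<^bsub>C\<^esub> (w \<cdot>\<^bsub>C\<^esub> v)" "Cod C v = Dom C w"
    by (auto simp: comp_assoc_Mor)
  with w v show "u \<cdot>\<^bsub>C\<^esub> v \<in> generated_sieve C N \<phi>"
    unfolding generated_sieve_def by fastforce
qed

lemma generated_sieve_member:
  assumes "n \<in> N" "\<phi> n \<in> Mor C"
  shows "\<phi> n \<in> generated_sieve C N \<phi>"
  using assms dom_ob by (force simp: generated_sieve_def intro!: exI[of _ n] exI[of _ "Ide C (Dom C (\<phi> n))"])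

lemma generated_sieve_subset:
  assumes "sieve C X R" "\<And>n. n \<in> N \<Longrightarrow> \<phi> n \<in> R"
  shows "generated_sieve C N \<phi> \<subseteq> R"
  using assms by (auto simp: generated_sieve_def sieve_def)

lemma generated_sieve_self:
  assumes "sieve C X R"
  shows "generated_sieve C R (\<lambda>u. u) = R"
  using assms generated_sieve_subset[OF assms, of R "\<lambda>u. u"] generated_sieve_member[of _ R "\<lambda>u. u"]
  by (auto simp: sieve_def)

end

context presheaf
begin

lemma act_comp_Mor:
  assumes "u \<in> Mor C" "v \<in> Mor C" "Cod C v = Dom C u" "s \<in> val F (Cod C u)"
  shows "act F (u \<cdot>\<^bsub>C\<^esub> v) s = act F v (act F u s)"
  using act_comp[of v "Dom C v" "Dom C u" u "Cod C u" s] assms by (auto simp: hom_def)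

end

context topology
begin

lemma superset_covering:
  assumes X: "X \<in> Ob C" and R: "R \<in> J X" and S: "sieve C X S" and RS: "R \<subseteq> S"
  shows "S \<in> J X"
proof (rule local_character[OF X R S])
  fix g assume g: "g \<in> R"
  then have "g \<in> Mor C" using covering_sieve[OF X R] by (auto simp: sieve_def)
  then show "sieve_pullback C g S \<in> J (Dom C g)"
    using sieve_pullback_member[OF S] maximal_sieve[OF dom_ob] g RS by auto
qed

end

section \<open>The finest topology for which a presheaf is a sheaf\<close>

text \<open>The condition that \<open>Hom(X, F) \<rightarrow> Hom(R, F)\<close> is bijective, for one sieve \<open>R\<close> on \<open>X\<close>.\<close>

definition effective :: "('o, 'm) cat \<Rightarrow> ('o, 'm, 'v) psh \<Rightarrow> 'o \<Rightarrow> 'm set \<Rightarrow> bool" where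
  "effective C F X R \<longleftrightarrow> (\<forall>x. matching_family C F R x \<longrightarrow>
     (\<exists>!s. s \<in> val F X \<and> (\<forall>u\<in>R. act F u s = x u)))"

text \<open>The sieves all of whose pullbacks are effective for \<open>F\<close>.  They form a topology, and it is the
  finest one for which \<open>F\<close> is a sheaf.\<close>

definition sheaf_topology :: "('o, 'm) cat \<Rightarrow> ('o, 'm, 'v) psh \<Rightarrow> 'o \<Rightarrow> 'm set set" where
  "sheaf_topology C F X = {R. sieve C X R \<and>
     (\<forall>g\<in>Mor C. Cod C g = X \<longrightarrow> effective C F (Dom C g) (sieve_pullback C g R))}"

lemma effective_separated:
  assumes "presheaf C F" and "sieve C X R" and "effective C F X R"
    and "s \<in> val F X" "s' \<in> val F X" "\<And>u. u \<in> R \<Longrightarrow> act F u s = act F u s'"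
  shows "s = s'"
proof -
  interpret presheaf C F by fact
  have "matching_family C F R (\<lambda>u. act F u s)"
    using assms(2,4) act_val act_comp_Mor by (auto simp: matching_family_def sieve_def)
  with assms(3) have "\<exists>!t. t \<in> val F X \<and> (\<forall>u\<in>R. act F u t = act F u s)"
    by (auto simp: effective_def)
  with assms(4-6) show ?thesis by metis
qed

lemma effective_obtain:
  assumes "effective C F X R" "matching_family C F R x"
  obtains s where "s \<in> val F X" "\<And>u. u \<in> R \<Longrightarrow> act F u s = x u"
  using assms unfolding effective_def by blast

lemma effectiveI:
  assumes "\<And>x. matching_family C F R x \<Longrightarrow> \<exists>s\<in>val F X. \<forall>u\<in>R. act F u s = x u"
    and "\<And>s s'. s \<in> val F X \<Longrightarrow> s' \<in> val F X \<Longrightarrow> (\<And>u. u \<in> R \<Longrightarrow> act F u s = act F u s') \<Longrightarrow> s = s'"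
  shows "effective C F X R"
  unfolding effective_def
proof (intro allI impI)
  fix x assume "matching_family C F R x"
  then obtain s where s: "s \<in> val F X" "\<forall>u\<in>R. act F u s = x u" using assms(1) by blast
  show "\<exists>!s. s \<in> val F X \<and> (\<forall>u\<in>R. act F u s = x u)"
    by (rule ex1I[of _ s]) (use s assms(2) in auto)
qed

lemma sheaf_iff_effective:
  "sheaf C J F \<longleftrightarrow> presheaf C F \<and> (\<forall>X\<in>Ob C. \<forall>R\<in>J X. effective C F X R)"
  by (simp add: sheaf_def effective_def)

context presheaf
begin

lemma matching_family_pullback:
  assumes x: "matching_family C F S x" and S: "sieve C X S" and g: "g \<in> Mor C"
  shows "matching_family C F (sieve_pullback C g S) (\<lambda>v. x (g \<cdot>\<^bsub>C\<^esub> v))"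
  using x g by (auto simp: matching_family_def sieve_pullback_def comp_assoc_Mor[symmetric])

lemma sheaf_topology_effective:
  assumes X: "X \<in> Ob C" and R: "R \<in> sheaf_topology C F X"
  shows "effective C F X R"
proof -
  have "effective C F (Dom C (Ide C X)) (sieve_pullback C (Ide C X) R)"
    using R ide_Mor[OF X] unfolding sheaf_topology_def by blast
  moreover have "sieve C X R" using R by (simp add: sheaf_topology_def)
  ultimately show ?thesis using X by (simp add: sieve_pullback_Ide)
qed

lemma sheaf_topology_pullback:
  assumes R: "R \<in> sheaf_topology C F X" and g: "g \<in> Mor C" "Cod C g = X"
  shows "sieve_pullback C g R \<in> sheaf_topology C F (Dom C g)"
  unfolding sheaf_topology_def
proof (intro CollectI conjI ballI impI)
  show "sieve C (Dom C g) (sieve_pullback C g R)"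
    using assms sieve_sieve_pullback by (auto simp: sheaf_topology_def)
  fix h assume h: "h \<in> Mor C" "Cod C h = Dom C g"
  then have "effective C F (Dom C (g \<cdot>\<^bsub>C\<^esub> h)) (sieve_pullback C (g \<cdot>\<^bsub>C\<^esub> h) R)"
    using assms comp_Mor[of g h] unfolding sheaf_topology_def by blast
  with g h show "effective C F (Dom C h) (sieve_pullback C h (sieve_pullback C g R))"
    by (simp add: sieve_pullback_comp)
qed

text \<open>The step of the local character axiom before base change: sections are first glued along
  the pullbacks of \<open>S\<close>, then along \<open>R\<close>.\<close>

lemma effective_local:
  assumes X: "X \<in> Ob C" and R: "R \<in> sheaf_topology C F X" and S: "sieve C X S"
    and loc: "\<And>g. g \<in> R \<Longrightarrow> sieve_pullback C g S \<in> sheaf_topology C F (Dom C g)"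
  shows "effective C F X S"
proof (rule effectiveI)
  have RM: "g \<in> Mor C" "Cod C g = X" if "g \<in> R" for g
    using R that by (auto simp: sheaf_topology_def sieve_def)
  have SM: "g \<in> Mor C" "Cod C g = X" if "g \<in> S" for g
    using S that by (auto simp: sieve_def)
  have Rs: "sieve C X R" using R by (simp add: sheaf_topology_def)
  note sep = effective_separated[OF presheaf_axioms]
  have sepR: "s = s'" if "s \<in> val F X" "s' \<in> val F X" "\<And>u. u \<in> R \<Longrightarrow> act F u s = act F u s'" for s s'
    by (rule sep[OF Rs sheaf_topology_effective[OF X R]]) (use that in auto)
  have effg: "effective C F (Dom C g) (sieve_pullback C g S)" if "g \<in> R" for g
    using sheaf_topology_effective[OF dom_ob loc] RM that by blast
  have sepg: "s = s'" if "g \<in> R" "s \<in> val F (Dom C g)" "s' \<in> val F (Dom C g)"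
    "\<And>u. u \<in> sieve_pullback C g S \<Longrightarrow> act F u s = act F u s'" for g s s'
    by (rule sep[OF sieve_sieve_pullback[OF S] effg]) (use that RM in auto)
  show "s = s'" if s: "s \<in> val F X" "s' \<in> val F X" and eq: "\<And>u. u \<in> S \<Longrightarrow> act F u s = act F u s'" for s s'
  proof (rule sepR[OF s])
    fix g assume g: "g \<in> R"
    show "act F g s = act F g s'"
    proof (rule sepg[OF g])
      show "act F u (act F g s) = act F u (act F g s')" if "u \<in> sieve_pullback C g S" for u
        using that eq[of "g \<cdot>\<^bsub>C\<^esub> u"] RM[OF g] s by (auto simp: sieve_pullback_def act_comp_Mor)
    qed (use RM[OF g] s act_val in auto)
  qed
  fix x assume x: "matching_family C F S x"
  have "\<exists>y. y \<in> val F (Dom C g) \<and> (\<forall>v\<in>sieve_pullback C g S. act F v y = x (g \<cdot>\<^bsub>C\<^esub> v))" if "g \<in> R" for g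
    using effg[OF that] matching_family_pullback[OF x S RM(1)[OF that]] unfolding effective_def by blast
  then obtain y where y: "\<And>g. g \<in> R \<Longrightarrow> y g \<in> val F (Dom C g)"
    and yx: "\<And>g v. g \<in> R \<Longrightarrow> v \<in> sieve_pullback C g S \<Longrightarrow> act F v (y g) = x (g \<cdot>\<^bsub>C\<^esub> v)" by metis
  have "matching_family C F R y"
    unfolding matching_family_def
  proof (intro ballI conjI impI y)
    fix g v assume g: "g \<in> R" and v: "v \<in> Mor C" "Cod C v = Dom C g"
    have gv: "g \<cdot>\<^bsub>C\<^esub> v \<in> R" using Rs g v by (auto simp: sieve_def)
    show "y (g \<cdot>\<^bsub>C\<^esub> v) = act F v (y g)"
    proof (rule sepg[OF gv])
      fix w assume w: "w \<in> sieve_pullback C (g \<cdot>\<^bsub>C\<^esub> v) S"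
      then have "v \<cdot>\<^bsub>C\<^esub> w \<in> sieve_pullback C g S"
        using v RM[OF g] by (auto simp: sieve_pullback_def comp_assoc_Mor)
      from yx[OF g this] yx[OF gv w] show "act F w (y (g \<cdot>\<^bsub>C\<^esub> v)) = act F w (act F v (y g))"
        using v w RM[OF g] y[OF g]
        by (auto simp: sieve_pullback_def comp_assoc_Mor act_comp_Mor)
    qed (use y[OF gv] y[OF g] act_val[of v "y g"] v RM[OF g] in auto)
  qed
  \<comment> \<open>The section glued along \<open>R\<close> restricts to \<open>x u\<close> for every \<open>u\<close> in \<open>S\<close>, and not just for those in
    \<open>R\<close>: compare the two along the pullback of \<open>R\<close> by \<open>u\<close>.\<close>
  then obtain s where s: "s \<in> val F X" and sy: "\<And>u. u \<in> R \<Longrightarrow> act F u s = y u"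
    using effective_obtain[OF sheaf_topology_effective[OF X R]] by blast
  have "act F u s = x u" if u: "u \<in> S" for u
  proof (rule sep[OF _ sheaf_topology_effective[OF _ sheaf_topology_pullback[OF R]]])
    show "u \<in> Mor C" "Cod C u = X" "Dom C u \<in> Ob C" using SM[OF u] dom_ob by auto
    then show "sieve C (Dom C u) (sieve_pullback C u R)" using sieve_sieve_pullback[OF Rs] by auto
    show "act F u s \<in> val F (Dom C u)" "x u \<in> val F (Dom C u)"
      using act_val SM[OF u] s x u by (auto simp: matching_family_def)
    fix v assume "v \<in> sieve_pullback C u R"
    then have v: "v \<in> Mor C" "Cod C v = Dom C u" "u \<cdot>\<^bsub>C\<^esub> v \<in> R" by (auto simp: sieve_pullback_def)
    have uv: "u \<cdot>\<^bsub>C\<^esub> v \<in> S" using S u v by (auto simp: sieve_def)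
    then have "Ide C (Dom C v) \<in> sieve_pullback C (u \<cdot>\<^bsub>C\<^esub> v) S"
      using v SM[OF u] dom_ob comp_Ide(1)[of "u \<cdot>\<^bsub>C\<^esub> v"] by (auto simp: sieve_pullback_def)
    from yx[OF v(3) this] have "y (u \<cdot>\<^bsub>C\<^esub> v) = x (u \<cdot>\<^bsub>C\<^esub> v)"
      using y[OF v(3)] v SM[OF u] dom_ob comp_Ide(1)[of "u \<cdot>\<^bsub>C\<^esub> v"] by (auto simp: act_ide)
    then show "act F v (act F u s) = act F v (x u)"
      using sy[OF v(3)] v SM[OF u] s x u by (auto simp: act_comp_Mor matching_family_def)
  qed
  with s show "\<exists>s\<in>val F X. \<forall>u\<in>S. act F u s = x u" by blast
qed

theorem topology_sheaf_topology: "topology C (sheaf_topology C F)"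
proof unfold_locales
  show "sieve C X R" if "R \<in> sheaf_topology C F X" for X R
    using that by (simp add: sheaf_topology_def)
  show "sieve_pullback C g R \<in> sheaf_topology C F (Dom C g)"
    if "R \<in> sheaf_topology C F X" "g \<in> Mor C" "Cod C g = X" for X R g
    using that by (rule sheaf_topology_pullback)
  show "S \<in> sheaf_topology C F X"
    if X: "X \<in> Ob C" and R: "R \<in> sheaf_topology C F X" and S: "sieve C X S"
      and loc: "\<And>g. g \<in> R \<Longrightarrow> sieve_pullback C g S \<in> sheaf_topology C F (Dom C g)" for X R S
    unfolding sheaf_topology_def
  proof (intro CollectI conjI S ballI impI)
    fix g assume g: "g \<in> Mor C" "Cod C g = X"
    show "effective C F (Dom C g) (sieve_pullback C g S)"
    proof (rule effective_local[OF _ sheaf_topology_pullback[OF R g] sieve_sieve_pullback[OF S g]])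
      fix h assume h: "h \<in> sieve_pullback C g R"
      then have "sieve_pullback C (g \<cdot>\<^bsub>C\<^esub> h) S \<in> sheaf_topology C F (Dom C (g \<cdot>\<^bsub>C\<^esub> h))"
        using loc by (simp add: sieve_pullback_def)
      moreover have "h \<in> Mor C" "Cod C h = Dom C g" using h by (auto simp: sieve_pullback_def)
      ultimately show "sieve_pullback C h (sieve_pullback C g S) \<in> sheaf_topology C F (Dom C h)"
        using g by (simp add: sieve_pullback_comp)
    qed (use g dom_ob in auto)
  qed
  show "{u \<in> Mor C. Cod C u = X} \<in> sheaf_topology C F X" if "X \<in> Ob C" for X
    unfolding sheaf_topology_def
  proof (intro CollectI conjI ballI impI)
    show "sieve C X {u \<in> Mor C. Cod C u = X}" by (auto simp: sieve_def)
    fix g assume g: "g \<in> Mor C" "Cod C g = X"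
    let ?R = "sieve_pullback C g {u \<in> Mor C. Cod C u = X}"
    have R: "?R = {v \<in> Mor C. Cod C v = Dom C g}" using g by (auto simp: sieve_pullback_def)
    have i: "Ide C (Dom C g) \<in> ?R" using dom_ob g unfolding R by auto
    show "effective C F (Dom C g) ?R"
    proof (rule effectiveI)
      fix x assume x: "matching_family C F ?R x"
      let ?s = "x (Ide C (Dom C g))"
      have "?s \<in> val F (Dom C g)" using x i g dom_ob by (force simp: matching_family_def)
      moreover have "act F u ?s = x u" if "u \<in> ?R" for u
      proof -
        have u: "u \<in> Mor C" "Cod C u = Dom C g" using that R by auto
        have "\<forall>v\<in>Mor C. Cod C v = Dom C (Ide C (Dom C g)) \<longrightarrow> x (Ide C (Dom C g) \<cdot>\<^bsub>C\<^esub> v) = act F v ?s"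
          using x i unfolding matching_family_def by blast
        moreover have "Dom C (Ide C (Dom C g)) = Dom C g" using dom_ob[OF g(1)] by simp
        moreover have "Ide C (Dom C g) \<cdot>\<^bsub>C\<^esub> u = u" using comp_Ide(2)[OF u(1)] u(2) by simp
        ultimately show ?thesis using u by metis
      qed
      ultimately show "\<exists>s\<in>val F (Dom C g). \<forall>u\<in>?R. act F u s = x u" by blast
    next
      fix s s' assume "s \<in> val F (Dom C g)" "s' \<in> val F (Dom C g)"
        and "\<And>u. u \<in> ?R \<Longrightarrow> act F u s = act F u s'"
      then show "s = s'" using i act_ide[OF dom_ob[OF g(1)]] by force
    qed
  qed
qed

text \<open>To be a sheaf for a generated topology it suffices that the generating families are covering
  for the finest topology for which the presheaf is a sheaf; no stability of the
  families under base change is assumed.\<close>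

theorem sheaf_generated_topologyI:
  assumes "\<And>Y N \<phi>. (Y, N, \<phi>) \<in> Fam \<Longrightarrow> covering_family C (sheaf_topology C F) Y N \<phi>"
  shows "sheaf C (generated_topology C Fam) F"
  unfolding sheaf_iff_effective
proof (intro conjI ballI presheaf_axioms)
  fix X R assume X: "X \<in> Ob C" and "R \<in> generated_topology C Fam X"
  then have "R \<in> sheaf_topology C F X"
    using topology_sheaf_topology assms unfolding generated_topology_def by blast
  then show "effective C F X R" by (rule sheaf_topology_effective[OF X])
qed

end

text \<open>A sieve that contains an effective one is effective, if in addition the pullbacks of the
  smaller sieve by the members of the larger one contain effective sieves; of the latter only the
  uniqueness of gluing matters.\<close>

lemma (in presheaf) effective_superset:
  assumes K: "sieve C X K" "effective C F X K" and S: "sieve C X S" and KS: "K \<subseteq> S"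
    and loc: "\<And>u. u \<in> S \<Longrightarrow> \<exists>L. sieve C (Dom C u) L \<and> effective C F (Dom C u) L \<and>
      L \<subseteq> sieve_pullback C u K"
  shows "effective C F X S"
proof (rule effectiveI)
  show "s = s'" if "s \<in> val F X" "s' \<in> val F X" "\<And>u. u \<in> S \<Longrightarrow> act F u s = act F u s'" for s s'
    by (rule effective_separated[OF presheaf_axioms K]) (use that KS in auto)
  have SM: "u \<in> Mor C" "Cod C u = X" if "u \<in> S" for u using S that by (auto simp: sieve_def)
  fix x assume x: "matching_family C F S x"
  then have xv: "\<And>u. u \<in> S \<Longrightarrow> x u \<in> val F (Dom C u)"
    and xc: "\<And>u v. u \<in> S \<Longrightarrow> v \<in> Mor C \<Longrightarrow> Cod C v = Dom C u \<Longrightarrow> x (u \<cdot>\<^bsub>C\<^esub> v) = act F v (x u)"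
    by (auto simp: matching_family_def)
  have "matching_family C F K x" using xv xc KS by (auto simp: matching_family_def)
  from effective_obtain[OF K(2) this] obtain s
    where s: "s \<in> val F X" "\<And>u. u \<in> K \<Longrightarrow> act F u s = x u" by blast
  have "act F u s = x u" if u: "u \<in> S" for u
  proof -
    obtain L where L: "sieve C (Dom C u) L" "effective C F (Dom C u) L" "L \<subseteq> sieve_pullback C u K"
      using loc[OF u] by blast
    show ?thesis
    proof (rule effective_separated[OF presheaf_axioms L(1,2)])
      show "act F u s \<in> val F (Dom C u)" "x u \<in> val F (Dom C u)"
        using act_val SM[OF u] s xv[OF u] by auto
      fix v assume "v \<in> L"
      then have v: "v \<in> Mor C" "Cod C v = Dom C u" "u \<cdot>\<^bsub>C\<^esub> v \<in> K"
        using L(3) by (auto simp: mem_sieve_pullback)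
      then show "act F v (act F u s) = act F v (x u)"
        using s(1) s(2)[OF v(3)] SM(2)[OF u] xc[OF u v(1,2)] act_comp_Mor[OF SM(1)[OF u] v(1,2), of s] by simp
    qed
  qed
  with s show "\<exists>s\<in>val F X. \<forall>u\<in>S. act F u s = x u" by blast
qed

section \<open>Small sets\<close>

context universe
begin

lemma U_set_iff: "U_set elts A \<longleftrightarrow> (\<exists>x. A = elts x)"
  by (auto simp: U_set_def)

lemma U_set_subset: "A \<subseteq> elts x \<Longrightarrow> U_set elts A"
  using power[of x] unfolding U_set_def by blast

lemma U_set_elts_Un: "\<exists>z. elts z = elts x \<union> elts y"
proof -
  obtain p where "elts p = {x, y}" using pair by blast
  then show ?thesis using family_union[of "\<lambda>z. z" p] by auto
qed

lemma lepoll_elts_U_small: "A \<lesssim> elts x \<Longrightarrow> U_small elts A"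
proof -
  assume "A \<lesssim> elts x"
  then obtain f where f: "inj_on f A" "f ` A \<subseteq> elts x" by (auto simp: lepoll_def)
  from U_set_subset[OF this(2)] obtain y where "f ` A = elts y" by (auto simp: U_set_iff)
  with f have "A \<approx> elts y" unfolding eqpoll_def bij_betw_def by metis
  then show ?thesis by (auto simp: U_small_def)
qed

lemma U_small_Pow: "U_small elts A \<Longrightarrow> U_small elts (Pow A)"
proof -
  assume "U_small elts A"
  then obtain x f where f: "bij_betw f A (elts x)" by (auto simp: U_small_def eqpoll_def)
  obtain p where p: "elts ` elts p = Pow (elts x)" using power by blast
  have "Pow A \<approx> Pow (elts x)" using bij_betw_Pow[OF f] unfolding eqpoll_def by blast
  moreover have "elts p \<approx> Pow (elts x)"
    unfolding eqpoll_def bij_betw_def using p elts_inj by (metis inj_on_subset subset_UNIV)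
  ultimately show ?thesis unfolding U_small_def by (metis eqpoll_sym eqpoll_trans)
qed

text \<open>The sets involved are all of cardinality at most that of one infinite member of the universe,
  so cardinal arithmetic applies.\<close>

lemma U_small_UN:
  assumes "U_small elts A" and "\<And>a. a \<in> A \<Longrightarrow> U_small elts (B a)"
  shows "U_small elts (\<Union>a\<in>A. B a)"
proof -
  obtain x f where f: "bij_betw f A (elts x)" using assms(1) by (auto simp: U_small_def eqpoll_def)
  obtain y where y: "\<And>a. a \<in> A \<Longrightarrow> B a \<approx> elts (y a)" using assms(2) unfolding U_small_def by metis
  obtain z where z: "infinite (elts z)" using infinite_member by blast
  obtain w where w: "elts w = (\<Union>w\<in>elts x. elts (y (inv_into A f w)))"
    using family_union[of "\<lambda>w. y (inv_into A f w)" x] by blast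
  have yw: "elts (y a) \<subseteq> elts w" if "a \<in> A" for a
    using that f w by (metis UN_upper bij_betwE bij_betw_inv_into_left)
  obtain t where "elts t = elts x \<union> elts z" using U_set_elts_Un by blast
  moreover obtain k where "elts k = elts t \<union> elts w" using U_set_elts_Un by blast
  ultimately have k: "elts k = elts x \<union> elts z \<union> elts w" by auto
  have "A \<lesssim> elts k" using f k unfolding lepoll_def by (metis Un_upper1 bij_betw_def le_supI1)
  moreover have "B a \<lesssim> elts k" if "a \<in> A" for a
    using y[OF that] yw[OF that] k lepoll_trans1 subset_imp_lepoll by (metis le_supI2)
  moreover have "infinite (elts k)" using z k by simp
  ultimately have "(\<Union>a\<in>A. B a) \<lesssim> elts k"
    using card_of_UNION_ordLeq_infinite[of "elts k" A B]
    by (simp add: lepoll_def flip: card_of_ordLeq)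
  then show ?thesis by (rule lepoll_elts_U_small)
qed

end

section \<open>Continuous functors preserve covering sieves\<close>

text \<open>A sheaf whose sets of sections are small can be replaced by an isomorphic sheaf of members of
  the universe.\<close>

definition transport_psh ::
  "('o, 'm) cat \<Rightarrow> ('o \<Rightarrow> 'v \<Rightarrow> 'w) \<Rightarrow> ('o, 'm, 'v) psh \<Rightarrow> ('o, 'm, 'w) psh" where
  "transport_psh C e G = \<lparr>val = \<lambda>X. e X ` val G X,
     act = \<lambda>u s. e (Dom C u) (act G u (inv_into (val G (Cod C u)) (e (Cod C u)) s))\<rparr>"

lemma sheaf_transport_psh:
  assumes G: "sheaf C J G" and e: "\<And>X. X \<in> Ob C \<Longrightarrow> inj_on (e X) (val G X)"
    and top: "topology C J"
  shows "sheaf C J (transport_psh C e G)"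
proof -
  interpret topology C J by fact
  interpret G: presheaf C G using G by (simp add: sheaf_def)
  let ?H = "transport_psh C e G"
  let ?i = "\<lambda>X. inv_into (val G X) (e X)"
  have v: "val ?H X = e X ` val G X" for X by (simp add: transport_psh_def)
  have a: "act ?H u (e (Cod C u) s) = e (Dom C u) (act G u s)"
    if "u \<in> Mor C" "s \<in> val G (Cod C u)" for u s
    using that e cod_ob by (simp add: transport_psh_def)
  interpret H: presheaf C ?H
  proof
    show "act ?H u s \<in> val ?H (Dom C u)" if "u \<in> Mor C" "s \<in> val ?H (Cod C u)" for u s
      using that a G.act_val by (auto simp: v)
    show "act ?H (Ide C X) s = s" if "X \<in> Ob C" "s \<in> val ?H X" for X s
      using that a[of "Ide C X"] G.act_ide by (auto simp: v)
    show "act ?H (w \<cdot>\<^bsub>C\<^esub> u) s = act ?H u (act ?H w s)"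
      if "u \<in> hom C X Y" "w \<in> hom C Y Z" and s: "s \<in> val ?H Z" for u w X Y Z s
    proof -
      have u: "u \<in> Mor C" "Dom C u = X" "Cod C u = Y" and w: "w \<in> Mor C" "Dom C w = Y" "Cod C w = Z"
        using that by (auto simp: hom_def)
      obtain r where r: "r \<in> val G Z" "s = e Z r" using s v by auto
      have "act G w r \<in> val G Y" using G.act_val w r by auto
      then show ?thesis
        using a[of "w \<cdot>\<^bsub>C\<^esub> u" r] a[of w r] a[of u "act G w r"] u w r by (simp add: G.act_comp_Mor)
    qed
  qed
  show ?thesis
    unfolding sheaf_iff_effective
  proof (intro conjI ballI H.presheaf_axioms)
    fix X R assume X: "X \<in> Ob C" and R: "R \<in> J X"
    have RM: "u \<in> Mor C" "Cod C u = X" if "u \<in> R" for u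
      using covering_sieve[OF X R] that by (auto simp: sieve_def)
    have eff: "effective C G X R" using G X R by (simp add: sheaf_iff_effective)
    show "effective C ?H X R"
    proof (rule effectiveI)
      show "s = s'" if ss: "s \<in> val ?H X" "s' \<in> val ?H X" "\<And>u. u \<in> R \<Longrightarrow> act ?H u s = act ?H u s'" for s s'
      proof -
        obtain r r' where r: "r \<in> val G X" "s = e X r" "r' \<in> val G X" "s' = e X r'"
          using ss by (auto simp: v)
        have "r = r'"
        proof (rule effective_separated[OF G.presheaf_axioms covering_sieve[OF X R] eff])
          fix u assume u: "u \<in> R"
          have "e (Dom C u) (act G u r) = e (Dom C u) (act G u r')"
            using a[of u r] a[of u r'] RM[OF u] r ss(3)[OF u] by auto
          moreover have "act G u r \<in> val G (Dom C u)" "act G u r' \<in> val G (Dom C u)"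
            using G.act_val RM[OF u] r by auto
          ultimately show "act G u r = act G u r'"
            using e[OF dom_ob[OF RM(1)[OF u]]] by (auto simp: inj_on_def)
        qed (use r in auto)
        then show ?thesis using r by simp
      qed
      fix x assume x: "matching_family C ?H R x"
      define y where "y u = ?i (Dom C u) (x u)" for u
      have y: "y u \<in> val G (Dom C u)" and ey: "e (Dom C u) (y u) = x u" if "u \<in> R" for u
        using x that by (auto simp: matching_family_def v y_def inv_into_into f_inv_into_f)
      have "matching_family C G R y"
        unfolding matching_family_def
      proof (intro ballI conjI impI y)
        fix u w assume u: "u \<in> R" and w: "w \<in> Mor C" "Cod C w = Dom C u"
        have uw: "u \<cdot>\<^bsub>C\<^esub> w \<in> R" using covering_sieve[OF X R] u w by (auto simp: sieve_def)
        have "e (Dom C w) (y (u \<cdot>\<^bsub>C\<^esub> w)) = e (Dom C w) (act G w (y u))"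
          using ey[OF uw] ey[OF u] a[of w "y u"] y[OF u] x u w RM[OF u] by (auto simp: matching_family_def)
        then show "y (u \<cdot>\<^bsub>C\<^esub> w) = act G w (y u)"
          using e[OF dom_ob[OF w(1)]] y[OF uw] G.act_val[of w "y u"] y[OF u] w RM[OF u]
          by (auto simp: inj_on_def)
      qed
      from effective_obtain[OF eff this]
      obtain s where s: "s \<in> val G X" "\<And>u. u \<in> R \<Longrightarrow> act G u s = y u" by blast
      have "act ?H u (e X s) = x u" if "u \<in> R" for u
        using a[of u s] s RM[OF that] that ey[OF that] by auto
      with s show "\<exists>s\<in>val ?H X. \<forall>u\<in>R. act ?H u s = x u" by (auto simp: v)
    qed
  qed
qed

text \<open>A sieve is closed if it contains every morphism along which it pulls back to a covering
  sieve.  Closed sieves form a sheaf: the subobject classifier of the topos of sheaves.\<close>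

definition closed_sieve :: "('o, 'm) cat \<Rightarrow> ('o \<Rightarrow> 'm set set) \<Rightarrow> 'o \<Rightarrow> 'm set \<Rightarrow> bool" where
  "closed_sieve C J X S \<longleftrightarrow> sieve C X S \<and>
     (\<forall>u\<in>Mor C. Cod C u = X \<and> sieve_pullback C u S \<in> J (Dom C u) \<longrightarrow> u \<in> S)"

definition closed_sieve_psh :: "('o, 'm) cat \<Rightarrow> ('o \<Rightarrow> 'm set set) \<Rightarrow> ('o, 'm, 'm set) psh" where
  "closed_sieve_psh C J = \<lparr>val = \<lambda>X. {S. closed_sieve C J X S}, act = sieve_pullback C\<rparr>"

text \<open>The smallest closed sieve that contains a given one.\<close>

definition sieve_closure :: "('o, 'm) cat \<Rightarrow> ('o \<Rightarrow> 'm set set) \<Rightarrow> 'o \<Rightarrow> 'm set \<Rightarrow> 'm set" where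
  "sieve_closure C J X S = {u \<in> Mor C. Cod C u = X \<and> sieve_pullback C u S \<in> J (Dom C u)}"

context topology
begin

lemma closed_sieve_pullback:
  assumes "closed_sieve C J X S" "g \<in> Mor C" "Cod C g = X"
  shows "closed_sieve C J (Dom C g) (sieve_pullback C g S)"
proof -
  have S: "sieve C X S" using assms by (simp add: closed_sieve_def)
  have "u \<in> sieve_pullback C g S"
    if "u \<in> Mor C" "Cod C u = Dom C g" "sieve_pullback C u (sieve_pullback C g S) \<in> J (Dom C u)" for u
  proof -
    have "sieve_pullback C (g \<cdot>\<^bsub>C\<^esub> u) S \<in> J (Dom C (g \<cdot>\<^bsub>C\<^esub> u))"
      using that assms(2) by (simp add: sieve_pullback_comp)
    then have "g \<cdot>\<^bsub>C\<^esub> u \<in> S" using assms comp_Mor[of g u] that by (auto simp: closed_sieve_def)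
    with that show ?thesis by (simp add: sieve_pullback_def)
  qed
  then show ?thesis using sieve_sieve_pullback[OF S assms(2,3)] by (auto simp: closed_sieve_def)
qed

lemma sieve_closure:
  assumes X: "X \<in> Ob C" and S: "sieve C X S"
  shows "closed_sieve C J X (sieve_closure C J X S)" and "S \<subseteq> sieve_closure C J X S"
proof -
  show "S \<subseteq> sieve_closure C J X S"
    using S maximal_sieve[OF dom_ob] sieve_pullback_member[OF S]
    by (auto simp: sieve_closure_def sieve_def)
  have cl: "sieve C X (sieve_closure C J X S)"
    unfolding sieve_def
  proof (intro conjI ballI impI)
    show "sieve_closure C J X S \<subseteq> {u \<in> Mor C. Cod C u = X}" by (auto simp: sieve_closure_def)
    fix u v assume "u \<in> sieve_closure C J X S" and v: "v \<in> Mor C" "Cod C v = Dom C u"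
    then have u: "u \<in> Mor C" "Cod C u = X" "sieve_pullback C u S \<in> J (Dom C u)"
      by (auto simp: sieve_closure_def)
    have "sieve_pullback C v (sieve_pullback C u S) \<in> J (Dom C v)"
      using base_change[OF dom_ob u(3)] u v by blast
    then show "u \<cdot>\<^bsub>C\<^esub> v \<in> sieve_closure C J X S"
      using u v by (simp add: sieve_closure_def sieve_pullback_comp)
  qed
  show "closed_sieve C J X (sieve_closure C J X S)"
    unfolding closed_sieve_def
  proof (intro conjI cl ballI impI)
    fix u assume u: "u \<in> Mor C"
      and "Cod C u = X \<and> sieve_pullback C u (sieve_closure C J X S) \<in> J (Dom C u)"
    then have c: "Cod C u = X" "sieve_pullback C u (sieve_closure C J X S) \<in> J (Dom C u)" by auto
    have "sieve_pullback C u S \<in> J (Dom C u)"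
    proof (rule local_character[OF dom_ob c(2)])
      show "sieve C (Dom C u) (sieve_pullback C u S)" by (rule sieve_sieve_pullback[OF S u c(1)])
      show "sieve_pullback C g (sieve_pullback C u S) \<in> J (Dom C g)"
        if "g \<in> sieve_pullback C u (sieve_closure C J X S)" for g
        using that u by (auto simp: sieve_pullback_comp mem_sieve_pullback sieve_closure_def)
    qed fact
    then show "u \<in> sieve_closure C J X S" using u c by (simp add: sieve_closure_def)
  qed
qed

text \<open>Closed sieves that agree along a covering sieve are equal; by symmetry an inclusion suffices.\<close>

lemma closed_sieve_le:
  assumes X: "X \<in> Ob C" and R: "R \<in> J X"
    and S: "closed_sieve C J X S" and S': "closed_sieve C J X S'"
    and eq: "\<And>u. u \<in> R \<Longrightarrow> sieve_pullback C u S = sieve_pullback C u S'"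
  shows "S \<subseteq> S'"
proof
  fix v assume v: "v \<in> S"
  have Ss: "sieve C X S" "sieve C X S'" using S S' by (auto simp: closed_sieve_def)
  have vM: "v \<in> Mor C" "Cod C v = X" using Ss v by (auto simp: sieve_def)
  have "sieve_pullback C v S' \<in> J (Dom C v)"
  proof (rule local_character[OF dom_ob])
    show "v \<in> Mor C" by fact
    show "sieve_pullback C v R \<in> J (Dom C v)" using base_change[OF X R] vM by blast
    show "sieve C (Dom C v) (sieve_pullback C v S')" using sieve_sieve_pullback Ss vM by blast
    fix w assume w: "w \<in> sieve_pullback C v R"
    then have wM: "w \<in> Mor C" "Cod C w = Dom C v" "v \<cdot>\<^bsub>C\<^esub> w \<in> R" by (auto simp: sieve_pullback_def)
    have "v \<cdot>\<^bsub>C\<^esub> w \<in> S" using Ss v wM by (auto simp: sieve_def)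
    then have "sieve_pullback C (v \<cdot>\<^bsub>C\<^esub> w) S' = {u \<in> Mor C. Cod C u = Dom C w}"
      using eq[OF wM(3)] sieve_pullback_member[OF Ss(1)] wM vM by simp
    then show "sieve_pullback C w (sieve_pullback C v S') \<in> J (Dom C w)"
      using maximal_sieve[OF dom_ob[OF wM(1)]] wM vM by (simp add: sieve_pullback_comp)
  qed
  then show "v \<in> S'" using S' vM by (simp add: closed_sieve_def)
qed

lemma presheaf_closed_sieve_psh: "presheaf C (closed_sieve_psh C J)"
proof unfold_locales
  show "act (closed_sieve_psh C J) u s \<in> val (closed_sieve_psh C J) (Dom C u)"
    if "u \<in> Mor C" "s \<in> val (closed_sieve_psh C J) (Cod C u)" for u s
    using that closed_sieve_pullback by (simp add: closed_sieve_psh_def)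
  show "act (closed_sieve_psh C J) (Ide C X) s = s"
    if "X \<in> Ob C" "s \<in> val (closed_sieve_psh C J) X" for X s
    using that sieve_pullback_Ide by (simp add: closed_sieve_psh_def closed_sieve_def)
  show "act (closed_sieve_psh C J) (v \<cdot>\<^bsub>C\<^esub> u) s = act (closed_sieve_psh C J) u (act (closed_sieve_psh C J) v s)"
    if "u \<in> hom C X Y" "v \<in> hom C Y Z" for u v X Y Z s
    using that by (simp add: closed_sieve_psh_def sieve_pullback_comp hom_def)
qed

theorem sheaf_closed_sieve_psh: "sheaf C J (closed_sieve_psh C J)"
  unfolding sheaf_iff_effective
proof (intro conjI ballI presheaf_closed_sieve_psh)
  let ?O = "closed_sieve_psh C J"
  fix X R assume X: "X \<in> Ob C" and R: "R \<in> J X"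
  note Rs = covering_sieve[OF X R]
  have RM: "u \<in> Mor C" "Cod C u = X" if "u \<in> R" for u
    using Rs that by (auto simp: sieve_def)
  show "effective C ?O X R"
  proof (rule effectiveI)
    show "s = s'" if "s \<in> val ?O X" "s' \<in> val ?O X" "\<And>u. u \<in> R \<Longrightarrow> act ?O u s = act ?O u s'" for s s'
      using that closed_sieve_le[OF X R] by (simp add: closed_sieve_psh_def subset_antisym)
    fix x assume "matching_family C ?O R x"
    then have x: "\<And>u. u \<in> R \<Longrightarrow> closed_sieve C J (Dom C u) (x u)"
      and xm: "\<And>u v. u \<in> R \<Longrightarrow> v \<in> Mor C \<Longrightarrow> Cod C v = Dom C u \<Longrightarrow> x (u \<cdot>\<^bsub>C\<^esub> v) = sieve_pullback C v (x u)"
      by (auto simp: matching_family_def closed_sieve_psh_def)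
    \<comment> \<open>The union of the sieves \<open>u \<cdot> x u\<close>; its closure is the glued section.\<close>
    define S where "S = {w \<in> R. Ide C (Dom C w) \<in> x w}"
    have memS: "u \<cdot>\<^bsub>C\<^esub> v \<in> S \<longleftrightarrow> v \<in> x u" if u: "u \<in> R" and v: "v \<in> Mor C" "Cod C v = Dom C u" for u v
    proof -
      have "u \<cdot>\<^bsub>C\<^esub> v \<in> R" using Rs u v by (auto simp: sieve_def)
      moreover have "Ide C (Dom C v) \<in> sieve_pullback C v (x u) \<longleftrightarrow> v \<in> x u"
        using v dom_ob by (simp add: sieve_pullback_def)
      ultimately show ?thesis using xm[OF u v] RM[OF u] v by (simp add: S_def)
    qed
    have "sieve C X S"
      unfolding sieve_def
    proof (intro conjI ballI impI)
      show "S \<subseteq> {u \<in> Mor C. Cod C u = X}" using RM by (auto simp: S_def)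
      fix u v assume u: "u \<in> S" and v: "v \<in> Mor C" "Cod C v = Dom C u"
      then have uR: "u \<in> R" and i: "Ide C (Dom C u) \<in> x u" by (auto simp: S_def)
      have "Ide C (Dom C u) \<cdot>\<^bsub>C\<^esub> v \<in> x u"
        using x[OF uR] i v RM[OF uR] dom_ob by (simp add: closed_sieve_def sieve_def)
      then have "v \<in> x u" using v comp_Ide(2)[of v] by simp
      then show "u \<cdot>\<^bsub>C\<^esub> v \<in> S" using memS[OF uR v] by simp
    qed
    note cl = sieve_closure[OF X this]
    have "sieve_pullback C u (sieve_closure C J X S) = x u" if u: "u \<in> R" for u
    proof -
      have xs: "sieve C (Dom C u) (x u)" using x[OF u] by (simp add: closed_sieve_def)
      have *: "sieve_pullback C (u \<cdot>\<^bsub>C\<^esub> v) S = sieve_pullback C v (x u)"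
        if v: "v \<in> Mor C" "Cod C v = Dom C u" for v
      proof -
        have "(u \<cdot>\<^bsub>C\<^esub> v) \<cdot>\<^bsub>C\<^esub> w \<in> S \<longleftrightarrow> v \<cdot>\<^bsub>C\<^esub> w \<in> x u" if w: "w \<in> Mor C" "Cod C w = Dom C v" for w
          using memS[OF u, of "v \<cdot>\<^bsub>C\<^esub> w"] v w RM[OF u] by (simp add: comp_assoc_Mor)
        then show ?thesis using v RM[OF u] by (auto simp: mem_sieve_pullback)
      qed
      have "v \<in> sieve_pullback C u (sieve_closure C J X S) \<longleftrightarrow> v \<in> x u"
        if v: "v \<in> Mor C" "Cod C v = Dom C u" for v
      proof -
        have "v \<in> x u \<longleftrightarrow> sieve_pullback C v (x u) \<in> J (Dom C v)"
          using x[OF u] v maximal_sieve[OF dom_ob] sieve_pullback_member[OF xs]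
          by (auto simp: closed_sieve_def)
        then show ?thesis using *[OF v] v RM[OF u] by (simp add: mem_sieve_pullback sieve_closure_def)
      qed
      then show ?thesis using xs by (auto simp: sieve_def mem_sieve_pullback)
    qed
    then show "\<exists>s\<in>val ?O X. \<forall>u\<in>R. act ?O u s = x u"
      using cl(1) by (auto simp: closed_sieve_psh_def)
  qed
qed

end

text \<open>A closed sieve is determined by its members whose source lies in a topologically generating
  set.\<close>

lemma (in universe) U_small_closed_sieves:
  assumes site: "U_site elts C J" and X: "X \<in> Ob C"
  shows "U_small elts {S. closed_sieve C J X S}"
proof -
  interpret topology C J using site by (simp add: U_site_def)
  have "\<exists>G\<subseteq>Ob C. U_small elts G \<and>
      (\<forall>Y\<in>Ob C. \<exists>S. Dom C ` S \<subseteq> G \<and> covering_family C J Y S (\<lambda>u. u))"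
    using site by (simp add: U_site_def)
  then obtain G where G: "G \<subseteq> Ob C" "U_small elts G"
    and gen: "\<And>Y. Y \<in> Ob C \<Longrightarrow> \<exists>S. Dom C ` S \<subseteq> G \<and> covering_family C J Y S (\<lambda>u. u)"
    by (elim exE conjE) (rule that, blast+)
  let ?H = "\<Union>Z\<in>G. hom C Z X"
  have "U_small elts (hom C Z X)" if "Z \<in> G" for Z
    using site subsetD[OF G(1) that] X by (simp add: U_site_def)
  then have H: "U_small elts (Pow ?H)" by (intro U_small_Pow U_small_UN G)
  have mem: "u \<in> S'" if S: "closed_sieve C J X S" and S': "closed_sieve C J X S'"
    and eq: "S \<inter> ?H = S' \<inter> ?H" and u: "u \<in> S" for S S' u
  proof -
    have Ss: "sieve C X S" "sieve C X S'" using S S' by (auto simp: closed_sieve_def)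
    then have uM: "u \<in> Mor C" "Cod C u = X" using u by (auto simp: sieve_def)
    obtain K where K: "Dom C ` K \<subseteq> G" "covering_family C J (Dom C u) K (\<lambda>u. u)"
      using gen[OF dom_ob[OF uM(1)]] by blast
    have KM: "k \<in> Mor C" "Cod C k = Dom C u" if "k \<in> K" for k
      using K that by (auto simp: covering_family_def)
    have "k \<in> sieve_pullback C u S'" if k: "k \<in> K" for k
    proof -
      have "u \<cdot>\<^bsub>C\<^esub> k \<in> S \<inter> ?H"
        using Ss u KM[OF k] uM K(1) k by (auto simp: sieve_def hom_def)
      then show ?thesis using eq KM[OF k] by (auto simp: sieve_pullback_def)
    qed
    then have "generated_sieve C K (\<lambda>u. u) \<subseteq> sieve_pullback C u S'"
      by (rule generated_sieve_subset[OF sieve_sieve_pullback[OF Ss(2) uM]])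
    moreover have "generated_sieve C K (\<lambda>u. u) \<in> J (Dom C u)"
      using K by (simp add: covering_family_def)
    ultimately have "sieve_pullback C u S' \<in> J (Dom C u)"
      using superset_covering[OF dom_ob[OF uM(1)] _ sieve_sieve_pullback[OF Ss(2) uM]] by simp
    then show ?thesis using S' uM by (simp add: closed_sieve_def)
  qed
  have "inj_on (\<lambda>S. S \<inter> ?H) {S. closed_sieve C J X S}"
  proof (rule inj_onI)
    fix S S' assume "S \<in> {S. closed_sieve C J X S}" "S' \<in> {S. closed_sieve C J X S}"
      and eq: "S \<inter> ?H = S' \<inter> ?H"
    then have cl: "closed_sieve C J X S" "closed_sieve C J X S'" by simp_all
    show "S = S'"
      using mem[OF cl eq] mem[OF cl(2,1) eq[symmetric]] by (intro set_eqI iffI)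
  qed
  then have "{S. closed_sieve C J X S} \<lesssim> Pow ?H"
    unfolding lepoll_def by blast
  moreover obtain x where "Pow ?H \<approx> elts x" using H by (auto simp: U_small_def)
  ultimately show ?thesis using lepoll_trans2 lepoll_elts_U_small by blast
qed

text \<open>Let \<open>S\<close> be the sieve on \<open>T X\<close> generated by the image of a covering sieve of \<open>X\<close>.  The closure of
  \<open>S\<close> and the maximal sieve are two sections over \<open>X\<close> of the restriction along \<open>T\<close> of the sheaf of
  closed sieves that agree locally, and hence agree.  Left exactness of \<open>T\<close> plays no role.\<close>

theorem (in universe) continuous_functor_covering:
  assumes C: "topology C J" and C': "U_site elts C' J'"
    and T: "continuous_functor elts C J C' J' T"
    and X: "X \<in> Ob C" and R: "R \<in> J X"
  shows "generated_sieve C' R (fmor T) \<in> J' (fob T X)"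
proof -
  interpret C: topology C J by fact
  interpret C': topology C' J' using C' by (simp add: U_site_def)
  interpret T: is_functor C C' T using T by (simp add: continuous_functor_def)
  let ?O = "closed_sieve_psh C' J'"
  let ?S = "generated_sieve C' R (fmor T)"
  have "\<exists>e x. bij_betw e (val ?O Y) (elts x)" if "Y \<in> Ob C'" for Y
    using U_small_closed_sieves[OF C' that] by (simp add: closed_sieve_psh_def U_small_def eqpoll_def) blast
  then obtain e where e: "\<And>Y. Y \<in> Ob C' \<Longrightarrow> \<exists>x. bij_betw (e Y) (val ?O Y) (elts x)" by metis
  have inj: "inj_on (e Y) (val ?O Y)" if "Y \<in> Ob C'" for Y
    using e[OF that] by (auto simp: bij_betw_def)
  let ?G = "transport_psh C' e ?O"
  have G: "sheaf C' J' ?G"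
    by (rule sheaf_transport_psh[OF C'.sheaf_closed_sieve_psh inj C'.topology_axioms])
  have "U_set elts (val ?G Y)" if "Y \<in> Ob C'" for Y
    using e[OF that] by (auto simp: transport_psh_def U_set_def bij_betw_def)
  with G have "U_sheaf elts C' J' ?G" by (simp add: U_sheaf_def U_presheaf_def sheaf_def)
  then have TG: "sheaf C J (psh_comp ?G T)" using T by (auto simp: continuous_functor_def U_sheaf_def)
  have Rs: "sieve C X R" by (rule C.covering_sieve[OF X R])
  have TR: "u \<in> Mor C" "fmor T u \<in> Mor C'" "Cod C u = X" "Cod C' (fmor T u) = fob T X"
    "Dom C' (fmor T u) = fob T (Dom C u)" if "u \<in> R" for u
    using Rs that T.fmor_hom[of u "Dom C u" X] by (auto simp: sieve_def hom_def)
  have TX: "fob T X \<in> Ob C'" by (rule T.fob_ob[OF X])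
  have S: "sieve C' (fob T X) ?S" by (rule C'.sieve_generated_sieve) (use TR in auto)
  let ?c = "sieve_closure C' J' (fob T X) ?S"
  let ?m = "{u \<in> Mor C'. Cod C' u = fob T X}"
  note cl = C'.sieve_closure[OF TX S]
  have m: "closed_sieve C' J' (fob T X) ?m" by (auto simp: closed_sieve_def sieve_def)
  have "e (fob T X) ?c = e (fob T X) ?m"
  proof (rule effective_separated[where C = C and F = "psh_comp ?G T" and X = X])
    show "presheaf C (psh_comp ?G T)" "effective C (psh_comp ?G T) X R"
      using TG X R by (auto simp: sheaf_iff_effective)
    show "e (fob T X) ?c \<in> val (psh_comp ?G T) X" "e (fob T X) ?m \<in> val (psh_comp ?G T) X"
      using cl(1) m by (auto simp: psh_comp_def transport_psh_def closed_sieve_psh_def)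
    fix u assume u: "u \<in> R"
    have "fmor T u \<in> ?S" using C'.generated_sieve_member[of u R "fmor T"] u TR by blast
    then have "fmor T u \<in> ?c" "fmor T u \<in> ?m" using cl(2) TR[OF u] by auto
    then have "sieve_pullback C' (fmor T u) ?c = sieve_pullback C' (fmor T u) ?m"
      using C'.sieve_pullback_member[OF conjunct1[OF cl(1)[unfolded closed_sieve_def]]]
        C'.sieve_pullback_member[OF conjunct1[OF m[unfolded closed_sieve_def]]] by simp
    moreover have "act (psh_comp ?G T) u (e (fob T X) K) = e (Dom C' (fmor T u)) (sieve_pullback C' (fmor T u) K)"
      if "closed_sieve C' J' (fob T X) K" for K
      using inj[OF TX] TR[OF u] that by (simp add: psh_comp_def transport_psh_def closed_sieve_psh_def)
    ultimately show "act (psh_comp ?G T) u (e (fob T X) ?c) = act (psh_comp ?G T) u (e (fob T X) ?m)"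
      using cl(1) m by simp
  qed fact
  then have "?c = ?m" using inj[OF TX] cl(1) m by (simp add: inj_on_def closed_sieve_psh_def)
  then have "Ide C' (fob T X) \<in> ?c" using TX by simp
  then have "sieve_pullback C' (Ide C' (fob T X)) ?S \<in> J' (fob T X)"
    using TX by (simp add: sieve_closure_def)
  then show ?thesis using C'.sieve_pullback_Ide[OF TX S] by simp
qed

section \<open>Fibre products and left exact functors\<close>

text \<open>The category \<open>0 \<rightarrow> 2 \<leftarrow> 1\<close>: the morphisms \<open>0\<close>, \<open>1\<close>, \<open>2\<close> are the identities, \<open>3\<close> goes from \<open>0\<close> to \<open>2\<close>
  and \<open>4\<close> from \<open>1\<close> to \<open>2\<close>.  Limits of diagrams of this shape are fibre products.\<close>

definition cospan :: "(nat, nat) cat" where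
  "cospan = \<lparr>Ob = {0, 1, 2}, Mor = {0, 1, 2, 3, 4},
     Dom = \<lambda>h. if h = 3 then 0 else if h = 4 then 1 else h,
     Cod = \<lambda>h. if h = 3 \<or> h = 4 then 2 else h,
     Ide = \<lambda>x. x, Comp = \<lambda>v u. if v = 3 \<or> v = 4 then v else u\<rparr>"

lemma category_cospan: "category cospan"
  by unfold_locales (auto simp: cospan_def hom_def split: if_splits)

text \<open>Left exactness is needed only in the form of a fibre product whose image by \<open>T\<close> still has the
  existence part of the universal property.\<close>

lemma left_exact_fibre_product:
  assumes T: "left_exact C C' T" and lim: "has_finite_limits C"
    and u: "u \<in> hom C X V" and u': "u' \<in> hom C Y V"
  obtains P p p' where "p \<in> hom C P X" "p' \<in> hom C P Y" "u \<cdot>\<^bsub>C\<^esub> p = u' \<cdot>\<^bsub>C\<^esub> p'"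
    "\<forall>Z. \<forall>h\<in>hom C' Z (fob T X). \<forall>h'\<in>hom C' Z (fob T Y).
       fmor T u \<cdot>\<^bsub>C'\<^esub> h = fmor T u' \<cdot>\<^bsub>C'\<^esub> h' \<longrightarrow>
       (\<exists>w\<in>hom C' Z (fob T P). fmor T p \<cdot>\<^bsub>C'\<^esub> w = h \<and> fmor T p' \<cdot>\<^bsub>C'\<^esub> w = h')"
proof -
  interpret T: is_functor C C' T using T by (simp add: left_exact_def)
  define D where "D = \<lparr>fob = \<lambda>x::nat. if x = 0 then X else if x = 1 then Y else V,
    fmor = \<lambda>h::nat. if h = 0 then Ide C X else if h = 1 then Ide C Y else if h = 2 then Ide C V
      else if h = 3 then u else u'\<rparr>"
  have ob: "X \<in> Ob C" "Y \<in> Ob C" "V \<in> Ob C"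
    using u u' T.source.dom_ob T.source.cod_ob by (auto simp: hom_def)
  have D: "is_functor cospan C D"
  proof (intro is_functor.intro is_functor_axioms.intro category_cospan T.source.category_axioms)
    show "fmor D (v \<cdot>\<^bsub>cospan\<^esub> w) = fmor D v \<cdot>\<^bsub>C\<^esub> fmor D w"
      if "w \<in> hom cospan a b" "v \<in> hom cospan b c" for v w a b c
    proof -
      have "Ide C X \<cdot>\<^bsub>C\<^esub> Ide C X = Ide C X" "Ide C Y \<cdot>\<^bsub>C\<^esub> Ide C Y = Ide C Y"
        "Ide C V \<cdot>\<^bsub>C\<^esub> Ide C V = Ide C V" "u \<cdot>\<^bsub>C\<^esub> Ide C X = u" "u' \<cdot>\<^bsub>C\<^esub> Ide C Y = u'"
        "Ide C V \<cdot>\<^bsub>C\<^esub> u = u" "Ide C V \<cdot>\<^bsub>C\<^esub> u' = u'"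
        using u u' ob T.source.comp_ide T.source.ide_comp T.source.ide_hom by blast+
      then show ?thesis
        using that by (auto simp: cospan_def D_def hom_def split: if_splits)
    qed
  qed (use ob u u' in \<open>auto simp: cospan_def D_def hom_def split: if_splits\<close>)
  have fin: "finite (Ob cospan)" "finite (Mor cospan)" by (simp_all add: cospan_def)
  obtain L l where L: "limit_cone cospan C D L l"
    using lim D fin unfolding has_finite_limits_def by blast
  then have c: "cone cospan C D L l" by (simp add: limit_cone_def)
  have l: "l 0 \<in> hom C L X" "l 1 \<in> hom C L Y" "u \<cdot>\<^bsub>C\<^esub> l 0 = l 2" "u' \<cdot>\<^bsub>C\<^esub> l 1 = l 2"
    using c by (simp_all add: cone_def cospan_def D_def)
  have TL: "limit_cone cospan C' (ftr_comp T D) (fob T L) (\<lambda>a. fmor T (l a))"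
    using T D fin L unfolding left_exact_def by blast
  show thesis
  proof (rule that[OF l(1,2)])
    show "u \<cdot>\<^bsub>C\<^esub> l 0 = u' \<cdot>\<^bsub>C\<^esub> l 1" using l by simp
  next
    show "\<forall>Z. \<forall>h\<in>hom C' Z (fob T X). \<forall>h'\<in>hom C' Z (fob T Y).
       fmor T u \<cdot>\<^bsub>C'\<^esub> h = fmor T u' \<cdot>\<^bsub>C'\<^esub> h' \<longrightarrow>
       (\<exists>w\<in>hom C' Z (fob T L). fmor T (l 0) \<cdot>\<^bsub>C'\<^esub> w = h \<and> fmor T (l 1) \<cdot>\<^bsub>C'\<^esub> w = h')"
    proof (intro allI ballI impI)
      fix Z h h' assume h: "h \<in> hom C' Z (fob T X)" and h': "h' \<in> hom C' Z (fob T Y)"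
        and eq: "fmor T u \<cdot>\<^bsub>C'\<^esub> h = fmor T u' \<cdot>\<^bsub>C'\<^esub> h'"
      let ?m = "\<lambda>a::nat. if a = 0 then h else if a = 1 then h' else fmor T u \<cdot>\<^bsub>C'\<^esub> h"
      have k: "fmor T u \<cdot>\<^bsub>C'\<^esub> h \<in> hom C' Z (fob T V)"
        using T.target.comp_hom[OF h] T.fmor_hom[OF u] by blast
      have "Z \<in> Ob C'" using h T.target.dom_ob by (auto simp: hom_def)
      moreover have "Ide C' (fob T X) \<cdot>\<^bsub>C'\<^esub> h = h" "Ide C' (fob T Y) \<cdot>\<^bsub>C'\<^esub> h' = h'"
        "Ide C' (fob T V) \<cdot>\<^bsub>C'\<^esub> (fmor T u \<cdot>\<^bsub>C'\<^esub> h) = fmor T u \<cdot>\<^bsub>C'\<^esub> h"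
        using T.target.ide_comp h h' k by blast+
      ultimately have "cone cospan C' (ftr_comp T D) Z ?m"
        using h h' k eq ob by (simp add: cone_def cospan_def ftr_comp_def D_def T.fmor_ide)
      then have "\<exists>w. w \<in> hom C' Z (fob T L) \<and> (\<forall>a\<in>Ob cospan. fmor T (l a) \<cdot>\<^bsub>C'\<^esub> w = ?m a)"
        using TL unfolding limit_cone_def by blast
      then show "\<exists>w\<in>hom C' Z (fob T L). fmor T (l 0) \<cdot>\<^bsub>C'\<^esub> w = h \<and> fmor T (l 1) \<cdot>\<^bsub>C'\<^esub> w = h'"
        by (auto simp: cospan_def)
    qed
  qed
qed

section \<open>Cartesian morphisms\<close>

lemma fibre_simps [simp]:
  "Ob (fibre E I \<pi> i) = {V \<in> Ob E. fob \<pi> V = i}"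
  "Mor (fibre E I \<pi> i) = {u \<in> Mor E. fmor \<pi> u = Ide I i}"
  "Dom (fibre E I \<pi> i) = Dom E" "Cod (fibre E I \<pi> i) = Cod E"
  "Ide (fibre E I \<pi> i) = Ide E" "Comp (fibre E I \<pi> i) = Comp E"
  by (simp_all add: fibre_def)

context cleaved_normalized_fibred_category
begin

lemma proj_Mor [simp]:
  assumes "u \<in> Mor E"
  shows "fmor \<pi> u \<in> Mor I" "Dom I (fmor \<pi> u) = fob \<pi> (Dom E u)"
    "Cod I (fmor \<pi> u) = fob \<pi> (Cod E u)"
  using fmor_hom[of u "Dom E u" "Cod E u"] assms by (auto simp: hom_def)

lemma proj_comp [simp]:
  assumes "u \<in> Mor E" "v \<in> Mor E" "Cod E v = Dom E u"
  shows "fmor \<pi> (u \<cdot>\<^bsub>E\<^esub> v) = fmor \<pi> u \<cdot>\<^bsub>I\<^esub> fmor \<pi> v"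
  using fmor_comp[of v "Dom E v" "Dom E u" u "Cod E u"] assms by (auto simp: hom_def)

lemma proj_vertical:
  assumes "u \<in> Mor E" "fmor \<pi> u = Ide I i" "i \<in> Ob I"
  shows "fob \<pi> (Dom E u) = i" "fob \<pi> (Cod E u) = i"
  using proj_Mor[OF assms(1)] assms by auto

lemma kappa [simp]:
  assumes "f \<in> Mor I" "V \<in> Ob E" "fob \<pi> V = Cod I f"
  shows "\<kappa> f V \<in> Mor E" "Cod E (\<kappa> f V) = V" "fmor \<pi> (\<kappa> f V) = f"
    "fob \<pi> (Dom E (\<kappa> f V)) = Dom I f" "Dom E (\<kappa> f V) \<in> Ob E"
proof -
  show *: "\<kappa> f V \<in> Mor E" "Cod E (\<kappa> f V) = V" "fmor \<pi> (\<kappa> f V) = f"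
    using cleavage[OF assms] by (auto simp: cartesian_def)
  then show "Dom E (\<kappa> f V) \<in> Ob E" using source.dom_ob by auto
  show "fob \<pi> (Dom E (\<kappa> f V)) = Dom I f" using proj_Mor[OF *(1)] *(3) by auto
qed

lemma cartesian_ex1:
  assumes "cartesian E I \<pi> u" "w \<in> Mor E" "Cod E w = Cod E u" "fmor \<pi> w = fmor \<pi> u"
  shows "\<exists>!v. v \<in> Mor E \<and> fmor \<pi> v = Ide I (fob \<pi> (Dom E u)) \<and> Dom E v = Dom E w \<and>
    Cod E v = Dom E u \<and> u \<cdot>\<^bsub>E\<^esub> v = w"
proof -
  have "\<exists>!v. v \<in> hom (fibre E I \<pi> (fob \<pi> (Dom E u))) (Dom E w) (Dom E u) \<and> u \<cdot>\<^bsub>E\<^esub> v = w"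
    using assms unfolding cartesian_def by blast
  then show ?thesis by (simp add: hom_def conj_assoc)
qed

text \<open>As composites of cartesian morphisms are cartesian, the morphisms of the cleavage have the
  universal property with respect to all morphisms of the base.\<close>

lemma kappa_lift:
  assumes f: "f \<in> Mor I" and V: "V \<in> Ob E" "fob \<pi> V = Cod I f"
    and g: "g \<in> Mor I" "Cod I g = Dom I f"
    and w: "w \<in> Mor E" "Cod E w = V" "fmor \<pi> w = f \<cdot>\<^bsub>I\<^esub> g"
  shows "\<exists>!v. v \<in> Mor E \<and> fmor \<pi> v = g \<and> Dom E v = Dom E w \<and> Cod E v = Dom E (\<kappa> f V) \<and> \<kappa> f V \<cdot>\<^bsub>E\<^esub> v = w"
proof -
  note k = kappa[OF f V]
  let ?W = "Dom E (\<kappa> f V)"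
  have W: "?W \<in> Ob E" "fob \<pi> ?W = Cod I g" using k g by auto
  note k' = kappa[OF g(1) W]
  have wg: "fob \<pi> (Dom E w) = Dom I g"
    using proj_Mor[OF w(1)] w(3) target.comp_Mor[OF f g] by simp
  have cart: "cartesian E I \<pi> (\<kappa> f V \<cdot>\<^bsub>E\<^esub> \<kappa> g ?W)"
    by (rule cartesian_comp) (use cleavage[OF f V] cleavage[OF g(1) W] in auto)
  have "\<exists>!z. z \<in> Mor E \<and> fmor \<pi> z = Ide I (fob \<pi> (Dom E (\<kappa> f V \<cdot>\<^bsub>E\<^esub> \<kappa> g ?W))) \<and> Dom E z = Dom E w \<and>
    Cod E z = Dom E (\<kappa> f V \<cdot>\<^bsub>E\<^esub> \<kappa> g ?W) \<and> (\<kappa> f V \<cdot>\<^bsub>E\<^esub> \<kappa> g ?W) \<cdot>\<^bsub>E\<^esub> z = w"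
    by (rule cartesian_ex1[OF cart w(1)]) (use k k' w in auto)
  moreover have "fob \<pi> (Dom E (\<kappa> f V \<cdot>\<^bsub>E\<^esub> \<kappa> g ?W)) = Dom I g" "Dom E (\<kappa> f V \<cdot>\<^bsub>E\<^esub> \<kappa> g ?W) = Dom E (\<kappa> g ?W)"
    using k k' by auto
  ultimately have ex1: "\<exists>!z. z \<in> Mor E \<and> fmor \<pi> z = Ide I (Dom I g) \<and> Dom E z = Dom E w \<and>
    Cod E z = Dom E (\<kappa> g ?W) \<and> (\<kappa> f V \<cdot>\<^bsub>E\<^esub> \<kappa> g ?W) \<cdot>\<^bsub>E\<^esub> z = w" by simp
  then obtain z where z: "z \<in> Mor E" "fmor \<pi> z = Ide I (Dom I g)" "Dom E z = Dom E w"
    "Cod E z = Dom E (\<kappa> g ?W)" "(\<kappa> f V \<cdot>\<^bsub>E\<^esub> \<kappa> g ?W) \<cdot>\<^bsub>E\<^esub> z = w" by blast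
  show ?thesis
  proof (rule ex1I[of _ "\<kappa> g ?W \<cdot>\<^bsub>E\<^esub> z"])
    show "\<kappa> g ?W \<cdot>\<^bsub>E\<^esub> z \<in> Mor E \<and> fmor \<pi> (\<kappa> g ?W \<cdot>\<^bsub>E\<^esub> z) = g \<and> Dom E (\<kappa> g ?W \<cdot>\<^bsub>E\<^esub> z) = Dom E w \<and>
      Cod E (\<kappa> g ?W \<cdot>\<^bsub>E\<^esub> z) = ?W \<and> \<kappa> f V \<cdot>\<^bsub>E\<^esub> \<kappa> g ?W \<cdot>\<^bsub>E\<^esub> z = w"
      using z k k' g by (simp add: source.comp_assoc_Mor[symmetric])
    fix v assume v: "v \<in> Mor E \<and> fmor \<pi> v = g \<and> Dom E v = Dom E w \<and> Cod E v = ?W \<and> \<kappa> f V \<cdot>\<^bsub>E\<^esub> v = w"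
    then have "\<exists>!z'. z' \<in> Mor E \<and> fmor \<pi> z' = Ide I (fob \<pi> (Dom E (\<kappa> g ?W))) \<and> Dom E z' = Dom E v \<and>
      Cod E z' = Dom E (\<kappa> g ?W) \<and> \<kappa> g ?W \<cdot>\<^bsub>E\<^esub> z' = v"
      by (intro cartesian_ex1) (use k' cleavage[OF g(1) W] in auto)
    then obtain z' where z': "z' \<in> Mor E" "fmor \<pi> z' = Ide I (Dom I g)" "Dom E z' = Dom E v"
      "Cod E z' = Dom E (\<kappa> g ?W)" "\<kappa> g ?W \<cdot>\<^bsub>E\<^esub> z' = v"
      using k' by auto
    then have "(\<kappa> f V \<cdot>\<^bsub>E\<^esub> \<kappa> g ?W) \<cdot>\<^bsub>E\<^esub> z' = w"
      using v k k' by (simp add: source.comp_assoc_Mor)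
    with z' z ex1 v have "z' = z" by auto
    with z' show "v = \<kappa> g ?W \<cdot>\<^bsub>E\<^esub> z" by simp
  qed
qed

lemma kappa_lift_obtain:
  assumes "f \<in> Mor I" "V \<in> Ob E" "fob \<pi> V = Cod I f" "g \<in> Mor I" "Cod I g = Dom I f"
    "w \<in> Mor E" "Cod E w = V" "fmor \<pi> w = f \<cdot>\<^bsub>I\<^esub> g"
  obtains v where "v \<in> Mor E" "fmor \<pi> v = g" "Dom E v = Dom E w" "Cod E v = Dom E (\<kappa> f V)"
    "\<kappa> f V \<cdot>\<^bsub>E\<^esub> v = w"
  using kappa_lift[OF assms] by blast

text \<open>The uniqueness part of this universal property.\<close>

lemma kappa_cancel:
  assumes f: "f \<in> Mor I" and V: "V \<in> Ob E" "fob \<pi> V = Cod I f"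
    and v: "v \<in> Mor E" "Cod E v = Dom E (\<kappa> f V)" and v': "v' \<in> Mor E" "Cod E v' = Dom E (\<kappa> f V)"
    and eq: "fmor \<pi> v = fmor \<pi> v'" "\<kappa> f V \<cdot>\<^bsub>E\<^esub> v = \<kappa> f V \<cdot>\<^bsub>E\<^esub> v'"
  shows "v = v'"
proof -
  note k = kappa[OF f V]
  have g: "fmor \<pi> v \<in> Mor I" "Cod I (fmor \<pi> v) = Dom I f" using v k by auto
  have "Dom E v = Dom E v'"
    using source.comp_Mor(2)[OF k(1) v] source.comp_Mor(2)[OF k(1) v'] eq by simp
  moreover have "\<exists>!z. z \<in> Mor E \<and> fmor \<pi> z = fmor \<pi> v \<and> Dom E z = Dom E (\<kappa> f V \<cdot>\<^bsub>E\<^esub> v) \<and>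
    Cod E z = Dom E (\<kappa> f V) \<and> \<kappa> f V \<cdot>\<^bsub>E\<^esub> z = \<kappa> f V \<cdot>\<^bsub>E\<^esub> v"
    by (rule kappa_lift[OF f V g]) (use v k in auto)
  moreover have "Dom E (\<kappa> f V \<cdot>\<^bsub>E\<^esub> v) = Dom E v" using v k by simp
  ultimately show ?thesis using v v' eq by (metis (no_types, lifting))
qed

lemma inverse_image_fob [simp]: "fob (inverse_image E I \<pi> \<kappa> f) V = Dom E (\<kappa> f V)"
  by (simp add: inverse_image_def)

lemma inverse_image_fmor:
  assumes f: "f \<in> Mor I" and u: "u \<in> Mor E" "fmor \<pi> u = Ide I (Cod I f)"
  shows "fmor (inverse_image E I \<pi> \<kappa> f) u \<in> Mor E"
    "fmor \<pi> (fmor (inverse_image E I \<pi> \<kappa> f) u) = Ide I (Dom I f)"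
    "Dom E (fmor (inverse_image E I \<pi> \<kappa> f) u) = Dom E (\<kappa> f (Dom E u))"
    "Cod E (fmor (inverse_image E I \<pi> \<kappa> f) u) = Dom E (\<kappa> f (Cod E u))"
    "\<kappa> f (Cod E u) \<cdot>\<^bsub>E\<^esub> fmor (inverse_image E I \<pi> \<kappa> f) u = u \<cdot>\<^bsub>E\<^esub> \<kappa> f (Dom E u)"
proof -
  have ob: "Dom E u \<in> Ob E" "Cod E u \<in> Ob E" using u source.dom_ob source.cod_ob by auto
  have pr: "fob \<pi> (Dom E u) = Cod I f" "fob \<pi> (Cod E u) = Cod I f"
    using proj_vertical[OF u target.cod_ob[OF f]] by auto
  note k = kappa[OF f ob(1) pr(1)] kappa[OF f ob(2) pr(2)]
  have c: "cartesian E I \<pi> (\<kappa> f (Cod E u))" using cleavage[OF f ob(2) pr(2)] by simp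
  have "\<exists>!w. w \<in> Mor E \<and> fmor \<pi> w = Ide I (fob \<pi> (Dom E (\<kappa> f (Cod E u)))) \<and>
    Dom E w = Dom E (u \<cdot>\<^bsub>E\<^esub> \<kappa> f (Dom E u)) \<and> Cod E w = Dom E (\<kappa> f (Cod E u)) \<and>
    \<kappa> f (Cod E u) \<cdot>\<^bsub>E\<^esub> w = u \<cdot>\<^bsub>E\<^esub> \<kappa> f (Dom E u)"
    by (rule cartesian_ex1[OF c]) (use u k f target.comp_Ide(2)[OF f] in auto)
  then have "\<exists>!w. w \<in> hom (fibre E I \<pi> (Dom I f)) (Dom E (\<kappa> f (Dom E u))) (Dom E (\<kappa> f (Cod E u))) \<and>
       \<kappa> f (Cod E u) \<cdot>\<^bsub>E\<^esub> w = u \<cdot>\<^bsub>E\<^esub> \<kappa> f (Dom E u)"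
    using k u by (simp add: hom_def conj_assoc)
  from theI'[OF this]
  show "fmor (inverse_image E I \<pi> \<kappa> f) u \<in> Mor E"
    "fmor \<pi> (fmor (inverse_image E I \<pi> \<kappa> f) u) = Ide I (Dom I f)"
    "Dom E (fmor (inverse_image E I \<pi> \<kappa> f) u) = Dom E (\<kappa> f (Dom E u))"
    "Cod E (fmor (inverse_image E I \<pi> \<kappa> f) u) = Dom E (\<kappa> f (Cod E u))"
    "\<kappa> f (Cod E u) \<cdot>\<^bsub>E\<^esub> fmor (inverse_image E I \<pi> \<kappa> f) u = u \<cdot>\<^bsub>E\<^esub> \<kappa> f (Dom E u)"
    by (auto simp: inverse_image_def hom_def)
qed

end

text \<open>The morphism from \<open>(f p)\<^sup>+(V)\<close> to \<open>f\<^sup>+(V)\<close> over \<open>p\<close> through which \<open>\<kappa> (f p) V\<close> factors.\<close>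

definition kappa_comp ::
  "('eo, 'em) cat \<Rightarrow> ('io, 'im) cat \<Rightarrow> ('eo, 'em, 'io, 'im) ftr \<Rightarrow> ('im \<Rightarrow> 'eo \<Rightarrow> 'em) \<Rightarrow>
   'im \<Rightarrow> 'im \<Rightarrow> 'eo \<Rightarrow> 'em" where
  "kappa_comp E I \<pi> \<kappa> f p V = \<kappa> p (Dom E (\<kappa> f V)) \<cdot>\<^bsub>E\<^esub> comp_iso E I \<pi> \<kappa> f p V"

context cleaved_normalized_fibred_category
begin

lemma comp_iso:
  assumes f: "f \<in> Mor I" and p: "p \<in> Mor I" "Cod I p = Dom I f"
    and V: "V \<in> Ob E" "fob \<pi> V = Cod I f"
  shows "comp_iso E I \<pi> \<kappa> f p V \<in> Mor E"
    "fmor \<pi> (comp_iso E I \<pi> \<kappa> f p V) = Ide I (Dom I p)"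
    "Dom E (comp_iso E I \<pi> \<kappa> f p V) = Dom E (\<kappa> (f \<cdot>\<^bsub>I\<^esub> p) V)"
    "Cod E (comp_iso E I \<pi> \<kappa> f p V) = Dom E (\<kappa> p (Dom E (\<kappa> f V)))"
    "\<kappa> f V \<cdot>\<^bsub>E\<^esub> \<kappa> p (Dom E (\<kappa> f V)) \<cdot>\<^bsub>E\<^esub> comp_iso E I \<pi> \<kappa> f p V = \<kappa> (f \<cdot>\<^bsub>I\<^esub> p) V"
proof -
  note k = kappa[OF f V]
  let ?W = "Dom E (\<kappa> f V)"
  have W: "?W \<in> Ob E" "fob \<pi> ?W = Cod I p" using k p by auto
  note k' = kappa[OF p(1) W]
  have fp: "f \<cdot>\<^bsub>I\<^esub> p \<in> Mor I" "fob \<pi> V = Cod I (f \<cdot>\<^bsub>I\<^esub> p)" using f p V by auto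
  note k'' = kappa[OF fp(1) V(1) fp(2)]
  have cart: "cartesian E I \<pi> (\<kappa> f V \<cdot>\<^bsub>E\<^esub> \<kappa> p ?W)"
    by (rule cartesian_comp) (use cleavage[OF f V] cleavage[OF p(1) W] in auto)
  have "\<exists>!w. w \<in> Mor E \<and> fmor \<pi> w = Ide I (fob \<pi> (Dom E (\<kappa> f V \<cdot>\<^bsub>E\<^esub> \<kappa> p ?W))) \<and>
    Dom E w = Dom E (\<kappa> (f \<cdot>\<^bsub>I\<^esub> p) V) \<and> Cod E w = Dom E (\<kappa> f V \<cdot>\<^bsub>E\<^esub> \<kappa> p ?W) \<and>
    (\<kappa> f V \<cdot>\<^bsub>E\<^esub> \<kappa> p ?W) \<cdot>\<^bsub>E\<^esub> w = \<kappa> (f \<cdot>\<^bsub>I\<^esub> p) V"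
    by (rule cartesian_ex1[OF cart]) (use k k' k'' in auto)
  moreover have "fob \<pi> (Dom E (\<kappa> f V \<cdot>\<^bsub>E\<^esub> \<kappa> p ?W)) = Dom I p"
    "Dom E (\<kappa> f V \<cdot>\<^bsub>E\<^esub> \<kappa> p ?W) = Dom E (\<kappa> p ?W)" using k k' by auto
  moreover have "(\<kappa> f V \<cdot>\<^bsub>E\<^esub> \<kappa> p ?W) \<cdot>\<^bsub>E\<^esub> w = \<kappa> f V \<cdot>\<^bsub>E\<^esub> \<kappa> p ?W \<cdot>\<^bsub>E\<^esub> w"
    if "w \<in> Mor E" "Cod E w = Dom E (\<kappa> p ?W)" for w
    using that k k' by (simp add: source.comp_assoc_Mor)
  ultimately have "\<exists>!w. w \<in> hom (fibre E I \<pi> (Dom I p)) (Dom E (\<kappa> (f \<cdot>\<^bsub>I\<^esub> p) V)) (Dom E (\<kappa> p ?W)) \<and>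
       \<kappa> f V \<cdot>\<^bsub>E\<^esub> \<kappa> p ?W \<cdot>\<^bsub>E\<^esub> w = \<kappa> (f \<cdot>\<^bsub>I\<^esub> p) V"
    by (simp add: hom_def conj_assoc cong: conj_cong)
  from theI'[OF this]
  show "comp_iso E I \<pi> \<kappa> f p V \<in> Mor E"
    "fmor \<pi> (comp_iso E I \<pi> \<kappa> f p V) = Ide I (Dom I p)"
    "Dom E (comp_iso E I \<pi> \<kappa> f p V) = Dom E (\<kappa> (f \<cdot>\<^bsub>I\<^esub> p) V)"
    "Cod E (comp_iso E I \<pi> \<kappa> f p V) = Dom E (\<kappa> p (Dom E (\<kappa> f V)))"
    "\<kappa> f V \<cdot>\<^bsub>E\<^esub> \<kappa> p (Dom E (\<kappa> f V)) \<cdot>\<^bsub>E\<^esub> comp_iso E I \<pi> \<kappa> f p V = \<kappa> (f \<cdot>\<^bsub>I\<^esub> p) V"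
    by (simp_all add: comp_iso_def Let_def hom_def)
qed

lemma kappa_comp:
  assumes f: "f \<in> Mor I" and p: "p \<in> Mor I" "Cod I p = Dom I f"
    and V: "V \<in> Ob E" "fob \<pi> V = Cod I f"
  shows "kappa_comp E I \<pi> \<kappa> f p V \<in> Mor E"
    "fmor \<pi> (kappa_comp E I \<pi> \<kappa> f p V) = p"
    "Dom E (kappa_comp E I \<pi> \<kappa> f p V) = Dom E (\<kappa> (f \<cdot>\<^bsub>I\<^esub> p) V)"
    "Cod E (kappa_comp E I \<pi> \<kappa> f p V) = Dom E (\<kappa> f V)"
    "\<kappa> f V \<cdot>\<^bsub>E\<^esub> kappa_comp E I \<pi> \<kappa> f p V = \<kappa> (f \<cdot>\<^bsub>I\<^esub> p) V"
proof -
  note k = kappa[OF f V]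
  have W: "Dom E (\<kappa> f V) \<in> Ob E" "fob \<pi> (Dom E (\<kappa> f V)) = Cod I p" using k p by auto
  show "kappa_comp E I \<pi> \<kappa> f p V \<in> Mor E"
    "fmor \<pi> (kappa_comp E I \<pi> \<kappa> f p V) = p"
    "Dom E (kappa_comp E I \<pi> \<kappa> f p V) = Dom E (\<kappa> (f \<cdot>\<^bsub>I\<^esub> p) V)"
    "Cod E (kappa_comp E I \<pi> \<kappa> f p V) = Dom E (\<kappa> f V)"
    "\<kappa> f V \<cdot>\<^bsub>E\<^esub> kappa_comp E I \<pi> \<kappa> f p V = \<kappa> (f \<cdot>\<^bsub>I\<^esub> p) V"
    unfolding kappa_comp_def
    using kappa[OF p(1) W] comp_iso[OF f p V] p by simp_all
qed

end

section \<open>Cartesian sieves\<close>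

text \<open>The morphisms to \<open>V\<close> whose projection lies in a given sieve of the base.\<close>

definition cartesian_sieve ::
  "('eo, 'em) cat \<Rightarrow> ('eo, 'em, 'io, 'im) ftr \<Rightarrow> 'eo \<Rightarrow> 'im set \<Rightarrow> 'em set" where
  "cartesian_sieve E \<pi> V R = {w \<in> Mor E. Cod E w = V \<and> fmor \<pi> w \<in> R}"

context cleaved_normalized_fibred_category
begin

lemma sieve_cartesian_sieve:
  assumes "sieve I (fob \<pi> V) R"
  shows "sieve E V (cartesian_sieve E \<pi> V R)"
  using assms by (auto simp: sieve_def cartesian_sieve_def)

lemma cartesian_sieve_pullback:
  assumes g: "g \<in> Mor E" "Cod E g = V"
  shows "sieve_pullback E g (cartesian_sieve E \<pi> V R) =
    cartesian_sieve E \<pi> (Dom E g) (sieve_pullback I (fmor \<pi> g) R)"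
  using assms by (auto simp: cartesian_sieve_def sieve_pullback_def)

lemma cartesian_sieve_factor:
  assumes V: "V \<in> Ob E" and f: "\<And>n. n \<in> N \<Longrightarrow> f n \<in> Mor I \<and> Cod I (f n) = fob \<pi> V"
    and w: "w \<in> cartesian_sieve E \<pi> V (generated_sieve I N f)"
  obtains n v where "n \<in> N" "v \<in> Mor E" "Cod E v = Dom E (\<kappa> (f n) V)" "w = \<kappa> (f n) V \<cdot>\<^bsub>E\<^esub> v"
proof -
  have wM: "w \<in> Mor E" "Cod E w = V" using w by (auto simp: cartesian_sieve_def)
  obtain n g where n: "n \<in> N" "fmor \<pi> w = f n \<cdot>\<^bsub>I\<^esub> g" "g \<in> Mor I" "Cod I g = Dom I (f n)"
    using w by (auto simp: cartesian_sieve_def generated_sieve_def)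
  have fn: "f n \<in> Mor I" "fob \<pi> V = Cod I (f n)" using f[OF n(1)] by auto
  obtain v where "v \<in> Mor E" "Cod E v = Dom E (\<kappa> (f n) V)" "\<kappa> (f n) V \<cdot>\<^bsub>E\<^esub> v = w"
    using kappa_lift_obtain[OF fn(1) V fn(2) n(3,4) wM n(2)] by blast
  with n(1) show thesis using that by blast
qed

text \<open>A cartesian family over a covering family \<open>f\<close> generates the sieve of all morphisms whose
  projection lies in the sieve generated by \<open>f\<close>.\<close>

lemma generated_sieve_cartesian:
  assumes V: "V \<in> Ob E" and f: "\<And>n. n \<in> N \<Longrightarrow> f n \<in> Mor I \<and> Cod I (f n) = fob \<pi> V"
    and \<theta>: "\<And>n. n \<in> N \<Longrightarrow> iso_in (fibre E I \<pi> (Dom I (f n))) (W n) (Dom E (\<kappa> (f n) V)) (\<theta> n)"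
    and \<phi>: "\<And>n. n \<in> N \<Longrightarrow> \<phi> n = \<kappa> (f n) V \<cdot>\<^bsub>E\<^esub> \<theta> n"
  shows "generated_sieve E N \<phi> = cartesian_sieve E \<pi> V (generated_sieve I N f)"
    and "\<And>n. n \<in> N \<Longrightarrow> \<phi> n \<in> Mor E \<and> Cod E (\<phi> n) = V"
proof -
  have k: "\<kappa> (f n) V \<in> Mor E" "Cod E (\<kappa> (f n) V) = V" "fmor \<pi> (\<kappa> (f n) V) = f n" if "n \<in> N" for n
    using kappa[of "f n" V] f[OF that] V by auto
  have t: "\<theta> n \<in> Mor E" "Dom E (\<theta> n) = W n" "Cod E (\<theta> n) = Dom E (\<kappa> (f n) V)"
    "fmor \<pi> (\<theta> n) = Ide I (Dom I (f n))" if "n \<in> N" for n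
    using \<theta>[OF that] by (auto simp: iso_in_def hom_def)
  have p: "\<phi> n \<in> Mor E" "Cod E (\<phi> n) = V" "Dom E (\<phi> n) = W n" "fmor \<pi> (\<phi> n) = f n" if "n \<in> N" for n
    using \<phi>[OF that] k[OF that] t[OF that] f[OF that] by auto
  then show "\<phi> n \<in> Mor E \<and> Cod E (\<phi> n) = V" if "n \<in> N" for n using that by blast
  show "generated_sieve E N \<phi> = cartesian_sieve E \<pi> V (generated_sieve I N f)"
  proof (intro subset_antisym subsetI)
    fix w assume "w \<in> generated_sieve E N \<phi>"
    then obtain n v where n: "n \<in> N" "w = \<phi> n \<cdot>\<^bsub>E\<^esub> v" "v \<in> Mor E" "Cod E v = Dom E (\<phi> n)"
      by (auto simp: generated_sieve_def)
    have "Cod I (fmor \<pi> v) = Dom I (f n)" using n p proj_Mor[of "\<phi> n"] by auto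
    then have "f n \<cdot>\<^bsub>I\<^esub> fmor \<pi> v \<in> generated_sieve I N f"
      using n unfolding generated_sieve_def by fastforce
    then show "w \<in> cartesian_sieve E \<pi> V (generated_sieve I N f)"
      using n p[OF n(1)] by (simp add: cartesian_sieve_def)
  next
    fix w assume "w \<in> cartesian_sieve E \<pi> V (generated_sieve I N f)"
    from cartesian_sieve_factor[OF V f this] obtain n v where
      n: "n \<in> N" "v \<in> Mor E" "Cod E v = Dom E (\<kappa> (f n) V)" "w = \<kappa> (f n) V \<cdot>\<^bsub>E\<^esub> v" by blast
    obtain r where r: "r \<in> Mor E" "Dom E r = Dom E (\<kappa> (f n) V)" "Cod E r = W n"
      "\<theta> n \<cdot>\<^bsub>E\<^esub> r = Ide E (Dom E (\<kappa> (f n) V))"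
      using \<theta>[OF n(1)] by (auto simp: iso_in_def hom_def)
    have "\<theta> n \<cdot>\<^bsub>E\<^esub> (r \<cdot>\<^bsub>E\<^esub> v) = v"
      using source.comp_assoc_Mor[of v r "\<theta> n"] source.comp_Ide(2)[OF n(2)] n r t[OF n(1)] by simp
    then have "w = \<phi> n \<cdot>\<^bsub>E\<^esub> (r \<cdot>\<^bsub>E\<^esub> v)"
      using n r k[OF n(1)] t[OF n(1)] \<phi>[OF n(1)] by (simp add: source.comp_assoc_Mor)
    moreover have "r \<cdot>\<^bsub>E\<^esub> v \<in> Mor E" "Cod E (r \<cdot>\<^bsub>E\<^esub> v) = Dom E (\<phi> n)" using n r p by auto
    ultimately show "w \<in> generated_sieve E N \<phi>" using n(1) unfolding generated_sieve_def by blast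
  qed
qed

lemma kappa_mem_cartesian_sieve:
  assumes "V \<in> Ob E" "n \<in> N" "f n \<in> Mor I" "Cod I (f n) = fob \<pi> V"
  shows "\<kappa> (f n) V \<in> cartesian_sieve E \<pi> V (generated_sieve I N f)"
  using assms kappa[of "f n" V] target.generated_sieve_member[of n N f] by (auto simp: cartesian_sieve_def)

end

section \<open>Descent data\<close>

text \<open>A presheaf on the total category, together with a choice of fibre products in the base.\<close>

locale presheaf_on_fibration = cleaved_normalized_fibred_category E I \<pi> \<kappa> + F: presheaf E F
  for E :: "('eo, 'em) cat" and I :: "('io, 'im) cat" and \<pi> :: "('eo, 'em, 'io, 'im) ftr"
    and \<kappa> :: "'im \<Rightarrow> 'eo \<Rightarrow> 'em" and F :: "('eo, 'em, 'v) psh" +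
  fixes pr1 pr2 :: "'im \<Rightarrow> 'im \<Rightarrow> 'im"
  assumes fibre_product: "f \<in> Mor I \<Longrightarrow> g \<in> Mor I \<Longrightarrow> Cod I f = Cod I g \<Longrightarrow>
    is_fibre_product I f g (pr1 f g) (pr2 f g)"
begin

lemma fibre_product_simps [simp]:
  assumes "f \<in> Mor I" "g \<in> Mor I" "Cod I f = Cod I g"
  shows "pr1 f g \<in> Mor I" "pr2 f g \<in> Mor I" "Cod I (pr1 f g) = Dom I f" "Cod I (pr2 f g) = Dom I g"
    "Dom I (pr2 f g) = Dom I (pr1 f g)" "g \<cdot>\<^bsub>I\<^esub> pr2 f g = f \<cdot>\<^bsub>I\<^esub> pr1 f g"
  using fibre_product[OF assms] by (auto simp: is_fibre_product_def)

lemma fibre_product_lift: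
  assumes "f \<in> Mor I" "g \<in> Mor I" "Cod I f = Cod I g"
    and "a \<in> Mor I" "b \<in> Mor I" "Cod I a = Dom I f" "Cod I b = Dom I g" "f \<cdot>\<^bsub>I\<^esub> a = g \<cdot>\<^bsub>I\<^esub> b"
  obtains h where "h \<in> Mor I" "Cod I h = Dom I (pr1 f g)" "pr1 f g \<cdot>\<^bsub>I\<^esub> h = a" "pr2 f g \<cdot>\<^bsub>I\<^esub> h = b"
proof -
  have "Dom I a = Dom I b"
    using target.comp_Mor(2)[of f a] target.comp_Mor(2)[of g b] assms by simp
  then have ab: "a \<in> hom I (Dom I a) (Dom I f)" "b \<in> hom I (Dom I a) (Dom I g)"
    using assms by (auto simp: hom_def)
  have "\<forall>T. \<forall>a \<in> hom I T (Dom I f). \<forall>b \<in> hom I T (Dom I g). f \<cdot>\<^bsub>I\<^esub> a = g \<cdot>\<^bsub>I\<^esub> b \<longrightarrow>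
        (\<exists>!u. u \<in> hom I T (Dom I (pr1 f g)) \<and> pr1 f g \<cdot>\<^bsub>I\<^esub> u = a \<and> pr2 f g \<cdot>\<^bsub>I\<^esub> u = b)"
    using fibre_product[OF assms(1-3)] unfolding is_fibre_product_def by (elim conjE)
  from ex1_implies_ex[OF this[rule_format, OF ab assms(8)]] obtain h
    where "h \<in> hom I (Dom I a) (Dom I (pr1 f g))" "pr1 f g \<cdot>\<^bsub>I\<^esub> h = a" "pr2 f g \<cdot>\<^bsub>I\<^esub> h = b"
    by blast
  then show thesis using that[of h] by (auto simp: hom_def)
qed

text \<open>The equalizer of the two parallel arrows at \<open>V\<close>: families of sections over the inverse images
  of \<open>V\<close> that agree over the fibre products.\<close>

definition descent_data :: "'n set \<Rightarrow> ('n \<Rightarrow> 'im) \<Rightarrow> 'eo \<Rightarrow> ('n \<Rightarrow> 'v) set" where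
  "descent_data N f V = {t \<in> \<Pi>\<^sub>E n\<in>N. val F (Dom E (\<kappa> (f n) V)). \<forall>m\<in>N. \<forall>n\<in>N.
     act F (kappa_comp E I \<pi> \<kappa> (f m) (pr1 (f m) (f n)) V) (t m) =
     act F (kappa_comp E I \<pi> \<kappa> (f n) (pr2 (f m) (f n)) V) (t n)}"

text \<open>If two members \<open>\<kappa> (f m) V\<close> and \<open>\<kappa> (f n) V\<close> have the same composite with \<open>v\<close> and \<open>v'\<close>, then this
  composite factors through the inverse image of \<open>V\<close> over the fibre product of \<open>f m\<close> and \<open>f n\<close>.\<close>

lemma descent_data_glue:
  assumes V: "V \<in> Ob E" and f: "\<And>n. n \<in> N \<Longrightarrow> f n \<in> Mor I \<and> Cod I (f n) = fob \<pi> V"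
    and t: "t \<in> descent_data N f V"
    and m: "m \<in> N" "v \<in> Mor E" "Cod E v = Dom E (\<kappa> (f m) V)"
    and n: "n \<in> N" "v' \<in> Mor E" "Cod E v' = Dom E (\<kappa> (f n) V)"
    and eq: "\<kappa> (f m) V \<cdot>\<^bsub>E\<^esub> v = \<kappa> (f n) V \<cdot>\<^bsub>E\<^esub> v'"
  shows "act F v (t m) = act F v' (t n)"
proof -
  let ?p = "pr1 (f m) (f n)" and ?q = "pr2 (f m) (f n)"
  have fm: "f m \<in> Mor I" "fob \<pi> V = Cod I (f m)" and fn: "f n \<in> Mor I" "fob \<pi> V = Cod I (f n)"
    using f m n by auto
  have c: "Cod I (f m) = Cod I (f n)" using fm fn by simp
  note fp = fibre_product_simps[OF fm(1) fn(1) c]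
  note km = kappa[OF fm(1) V fm(2)] and kn = kappa[OF fn(1) V fn(2)]
  have pv: "fmor \<pi> v \<in> Mor I" "Cod I (fmor \<pi> v) = Dom I (f m)" using m km by auto
  have pv': "fmor \<pi> v' \<in> Mor I" "Cod I (fmor \<pi> v') = Dom I (f n)" using n kn by auto
  have w: "\<kappa> (f m) V \<cdot>\<^bsub>E\<^esub> v \<in> Mor E" "Cod E (\<kappa> (f m) V \<cdot>\<^bsub>E\<^esub> v) = V"
    "fmor \<pi> (\<kappa> (f m) V \<cdot>\<^bsub>E\<^esub> v) = f m \<cdot>\<^bsub>I\<^esub> fmor \<pi> v" using m km by auto
  have "f m \<cdot>\<^bsub>I\<^esub> fmor \<pi> v = f n \<cdot>\<^bsub>I\<^esub> fmor \<pi> v'"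
    using w(3) eq n kn by simp
  from fibre_product_lift[OF fm(1) fn(1) c pv(1) pv'(1) pv(2) pv'(2) this]
  obtain h where h: "h \<in> Mor I" "Cod I h = Dom I ?p" "?p \<cdot>\<^bsub>I\<^esub> h = fmor \<pi> v" "?q \<cdot>\<^bsub>I\<^esub> h = fmor \<pi> v'"
    by blast
  have ff: "f m \<cdot>\<^bsub>I\<^esub> ?p \<in> Mor I" "fob \<pi> V = Cod I (f m \<cdot>\<^bsub>I\<^esub> ?p)" "Cod I h = Dom I (f m \<cdot>\<^bsub>I\<^esub> ?p)"
    using fm fp h by simp_all
  have "fmor \<pi> (\<kappa> (f m) V \<cdot>\<^bsub>E\<^esub> v) = (f m \<cdot>\<^bsub>I\<^esub> ?p) \<cdot>\<^bsub>I\<^esub> h"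
    using w(3) h fm fp by (simp add: target.comp_assoc_Mor)
  from kappa_lift_obtain[OF ff(1) V ff(2) h(1) ff(3) w(1,2) this]
  obtain z where z: "z \<in> Mor E" "fmor \<pi> z = h" "Cod E z = Dom E (\<kappa> (f m \<cdot>\<^bsub>I\<^esub> ?p) V)"
    "\<kappa> (f m \<cdot>\<^bsub>I\<^esub> ?p) V \<cdot>\<^bsub>E\<^esub> z = \<kappa> (f m) V \<cdot>\<^bsub>E\<^esub> v" by blast
  let ?k = "kappa_comp E I \<pi> \<kappa> (f m) ?p V" and ?l = "kappa_comp E I \<pi> \<kappa> (f n) ?q V"
  note k = kappa_comp[OF fm(1) fp(1,3) V fm(2)] and l = kappa_comp[OF fn(1) fp(2,4) V fn(2)]
  have lD: "Dom E ?l = Dom E (\<kappa> (f m \<cdot>\<^bsub>I\<^esub> ?p) V)" "\<kappa> (f n) V \<cdot>\<^bsub>E\<^esub> ?l = \<kappa> (f m \<cdot>\<^bsub>I\<^esub> ?p) V"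
    using l fp(6) by simp_all
  have "?k \<cdot>\<^bsub>E\<^esub> z = v"
  proof (rule kappa_cancel[OF fm(1) V fm(2)])
    show "?k \<cdot>\<^bsub>E\<^esub> z \<in> Mor E" "Cod E (?k \<cdot>\<^bsub>E\<^esub> z) = Dom E (\<kappa> (f m) V)" "fmor \<pi> (?k \<cdot>\<^bsub>E\<^esub> z) = fmor \<pi> v"
      using k z h by simp_all
    show "\<kappa> (f m) V \<cdot>\<^bsub>E\<^esub> ?k \<cdot>\<^bsub>E\<^esub> z = \<kappa> (f m) V \<cdot>\<^bsub>E\<^esub> v"
      using k z km by (simp flip: source.comp_assoc_Mor)
  qed fact+
  moreover have "?l \<cdot>\<^bsub>E\<^esub> z = v'"
  proof (rule kappa_cancel[OF fn(1) V fn(2)])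
    show "?l \<cdot>\<^bsub>E\<^esub> z \<in> Mor E" "Cod E (?l \<cdot>\<^bsub>E\<^esub> z) = Dom E (\<kappa> (f n) V)" "fmor \<pi> (?l \<cdot>\<^bsub>E\<^esub> z) = fmor \<pi> v'"
      using l lD z h by simp_all
    show "\<kappa> (f n) V \<cdot>\<^bsub>E\<^esub> ?l \<cdot>\<^bsub>E\<^esub> z = \<kappa> (f n) V \<cdot>\<^bsub>E\<^esub> v'"
      using l(1,4) lD z kn eq by (simp flip: source.comp_assoc_Mor)
  qed fact+
  moreover have tm: "t m \<in> val F (Cod E ?k)" "t n \<in> val F (Cod E ?l)" "act F ?k (t m) = act F ?l (t n)"
    using t m(1) n(1) k l unfolding descent_data_def by (auto simp: PiE_def Pi_def)
  ultimately show ?thesis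
    using F.act_comp_Mor[OF k(1) z(1) _ tm(1)] F.act_comp_Mor[OF l(1) z(1) _ tm(2)] z(3) k(3) lD(1) by simp
qed

text \<open>The converse passage, from matching families to descent data.\<close>

lemma restrict_kappa_descent_data:
  assumes V: "V \<in> Ob E" and f: "\<And>n. n \<in> N \<Longrightarrow> f n \<in> Mor I \<and> Cod I (f n) = fob \<pi> V"
    and x: "matching_family E F (cartesian_sieve E \<pi> V (generated_sieve I N f)) x"
  shows "(\<lambda>n\<in>N. x (\<kappa> (f n) V)) \<in> descent_data N f V"
  unfolding descent_data_def
proof (intro CollectI conjI ballI)
  let ?R = "cartesian_sieve E \<pi> V (generated_sieve I N f)"
  have mem: "\<kappa> (f n) V \<in> ?R" if "n \<in> N" for n
    using kappa_mem_cartesian_sieve[OF V that] f[OF that] by blast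
  have xv: "x u \<in> val F (Dom E u)" if "u \<in> ?R" for u
    using x that by (simp add: matching_family_def)
  have xc: "x (u \<cdot>\<^bsub>E\<^esub> v) = act F v (x u)" if "u \<in> ?R" "v \<in> Mor E" "Cod E v = Dom E u" for u v
    using x that by (simp add: matching_family_def)
  show "(\<lambda>n\<in>N. x (\<kappa> (f n) V)) \<in> (\<Pi>\<^sub>E n\<in>N. val F (Dom E (\<kappa> (f n) V)))"
    using mem xv by auto
  fix m n assume m: "m \<in> N" and n: "n \<in> N"
  let ?p = "pr1 (f m) (f n)" and ?q = "pr2 (f m) (f n)"
  have fm: "f m \<in> Mor I" "fob \<pi> V = Cod I (f m)" and fn: "f n \<in> Mor I" "fob \<pi> V = Cod I (f n)"
    using f m n by auto
  have c: "Cod I (f m) = Cod I (f n)" using fm fn by simp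
  note fp = fibre_product_simps[OF fm(1) fn(1) c]
  note k = kappa_comp[OF fm(1) fp(1,3) V fm(2)] and l = kappa_comp[OF fn(1) fp(2,4) V fn(2)]
  show "act F (kappa_comp E I \<pi> \<kappa> (f m) ?p V) ((\<lambda>n\<in>N. x (\<kappa> (f n) V)) m) =
     act F (kappa_comp E I \<pi> \<kappa> (f n) ?q V) ((\<lambda>n\<in>N. x (\<kappa> (f n) V)) n)"
    using xc[OF mem[OF m] k(1,4)] xc[OF mem[OF n] l(1,4)] k(5) l(5) fp(6) m n by simp
qed

text \<open>Matching families on a cartesian sieve are the same as descent data, so that effectiveness is
  the exactness, at \<open>V\<close>, of the sequence attached to a family that generates the sieve.\<close>

theorem effective_cartesian_sieve_iff:
  assumes V: "V \<in> Ob E" and f: "\<And>n. n \<in> N \<Longrightarrow> f n \<in> Mor I \<and> Cod I (f n) = fob \<pi> V"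
  shows "effective E F V (cartesian_sieve E \<pi> V (generated_sieve I N f)) \<longleftrightarrow>
    bij_betw (\<lambda>s. \<lambda>n\<in>N. act F (\<kappa> (f n) V) s) (val F V) (descent_data N f V)"
    (is "effective E F V ?R \<longleftrightarrow> bij_betw ?a _ _")
proof -
  have k: "\<kappa> (f n) V \<in> Mor E" "Cod E (\<kappa> (f n) V) = V" "\<kappa> (f n) V \<in> ?R" if "n \<in> N" for n
    using kappa[of "f n" V] f[OF that] V kappa_mem_cartesian_sieve[OF V that] by auto
  have sv: "sieve E V ?R"
    by (rule sieve_cartesian_sieve, rule target.sieve_generated_sieve) (use f in auto)
  have RM: "u \<in> Mor E" "Cod E u = V" if "u \<in> ?R" for u using that by (auto simp: cartesian_sieve_def)
  have ext: "act F u s = x u"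
    if x: "matching_family E F ?R x" and s: "s \<in> val F V" "\<And>n. n \<in> N \<Longrightarrow> act F (\<kappa> (f n) V) s = x (\<kappa> (f n) V)"
      and u: "u \<in> ?R" for x s u
  proof -
    obtain n v where n: "n \<in> N" "v \<in> Mor E" "Cod E v = Dom E (\<kappa> (f n) V)" "u = \<kappa> (f n) V \<cdot>\<^bsub>E\<^esub> v"
      using cartesian_sieve_factor[OF V f u] by blast
    then have "act F u s = act F v (x (\<kappa> (f n) V))"
      using s k[OF n(1)] by (simp add: F.act_comp_Mor)
    also have "\<dots> = x u" using x n k[OF n(1)] by (simp add: matching_family_def)
    finally show ?thesis .
  qed
  have match: "matching_family E F ?R (\<lambda>u. act F u s)" if "s \<in> val F V" for s
    using sv that F.act_val F.act_comp_Mor by (auto simp: matching_family_def sieve_def)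
  show ?thesis
  proof
    assume eff: "effective E F V ?R"
    show "bij_betw ?a (val F V) (descent_data N f V)"
      unfolding bij_betw_def
    proof (intro conjI inj_onI subset_antisym subsetI)
      fix s s' assume s: "s \<in> val F V" "s' \<in> val F V" and eq: "?a s = ?a s'"
      have "act F (\<kappa> (f n) V) s = act F (\<kappa> (f n) V) s'" if "n \<in> N" for n
        using fun_cong[OF eq, of n] that by simp
      then have "act F u s = act F u s'" if "u \<in> ?R" for u
        using ext[OF match[OF s(2)] s(1)] that by blast
      then show "s = s'" using effective_separated[OF F.presheaf_axioms sv eff s] by blast
    next
      fix t assume "t \<in> ?a ` val F V"
      then show "t \<in> descent_data N f V"
        using restrict_kappa_descent_data[OF V f match] by auto
    next
      fix t assume t: "t \<in> descent_data N f V"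
      have tv: "t n \<in> val F (Dom E (\<kappa> (f n) V))" if "n \<in> N" for n
        using t that by (auto simp: descent_data_def)
      \<comment> \<open>The matching family attached to \<open>t\<close>: \<open>d u\<close> is a chosen factorization of \<open>u\<close> through one of the
        generators, and the value does not depend on it.\<close>
      define d where "d u = (SOME nv. fst nv \<in> N \<and> snd nv \<in> Mor E \<and>
        Cod E (snd nv) = Dom E (\<kappa> (f (fst nv)) V) \<and> u = \<kappa> (f (fst nv)) V \<cdot>\<^bsub>E\<^esub> snd nv)" for u
      define x where "x u = act F (snd (d u)) (t (fst (d u)))" for u
      have xk: "x (\<kappa> (f n) V \<cdot>\<^bsub>E\<^esub> v) = act F v (t n)"
        if n: "n \<in> N" "v \<in> Mor E" "Cod E v = Dom E (\<kappa> (f n) V)" for n v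
      proof -
        let ?u = "\<kappa> (f n) V \<cdot>\<^bsub>E\<^esub> v"
        have "fst (d ?u) \<in> N \<and> snd (d ?u) \<in> Mor E \<and>
          Cod E (snd (d ?u)) = Dom E (\<kappa> (f (fst (d ?u))) V) \<and> ?u = \<kappa> (f (fst (d ?u))) V \<cdot>\<^bsub>E\<^esub> snd (d ?u)"
          unfolding d_def by (rule someI[of _ "(n, v)"]) (use n in simp)
        then show ?thesis
          unfolding x_def using descent_data_glue[OF V f t, of "fst (d ?u)" "snd (d ?u)" n v] n by metis
      qed
      have x: "matching_family E F ?R x"
        unfolding matching_family_def
      proof (intro ballI conjI impI)
        fix u assume u: "u \<in> ?R"
        obtain n v where n: "n \<in> N" "v \<in> Mor E" "Cod E v = Dom E (\<kappa> (f n) V)" "u = \<kappa> (f n) V \<cdot>\<^bsub>E\<^esub> v"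
          using cartesian_sieve_factor[OF V f u] by blast
        show "x u \<in> val F (Dom E u)"
          using xk[OF n(1-3)] n k[OF n(1)] tv[OF n(1)] F.act_val[of v "t n"] by simp
        fix w assume w: "w \<in> Mor E" "Cod E w = Dom E u"
        then have "u \<cdot>\<^bsub>E\<^esub> w = \<kappa> (f n) V \<cdot>\<^bsub>E\<^esub> (v \<cdot>\<^bsub>E\<^esub> w)" "Cod E w = Dom E v"
          using n k[OF n(1)] by (auto simp: source.comp_assoc_Mor)
        then show "x (u \<cdot>\<^bsub>E\<^esub> w) = act F w (x u)"
          using xk[of n v] xk[of n "v \<cdot>\<^bsub>E\<^esub> w"] n w tv[OF n(1)] by (simp add: F.act_comp_Mor)
      qed
      obtain s where s: "s \<in> val F V" "\<And>u. u \<in> ?R \<Longrightarrow> act F u s = x u"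
        using effective_obtain[OF eff x] by blast
      have "x (\<kappa> (f n) V) = t n" if n: "n \<in> N" for n
      proof -
        have D: "Dom E (\<kappa> (f n) V) \<in> Ob E" using k[OF n] source.dom_ob by blast
        then have "x (\<kappa> (f n) V \<cdot>\<^bsub>E\<^esub> Ide E (Dom E (\<kappa> (f n) V))) = t n"
          using xk[OF n, of "Ide E (Dom E (\<kappa> (f n) V))"] F.act_ide[OF D tv[OF n]] by simp
        then show ?thesis using k[OF n] by simp
      qed
      then have "t = ?a s"
        using s k t by (auto simp: descent_data_def fun_eq_iff PiE_def extensional_def)
      then show "t \<in> ?a ` val F V" using s by blast
    qed
  next
    assume bij: "bij_betw ?a (val F V) (descent_data N f V)"
    show "effective E F V ?R"
    proof (rule effectiveI)
      show "s = s'" if s: "s \<in> val F V" "s' \<in> val F V" and eq: "\<And>u. u \<in> ?R \<Longrightarrow> act F u s = act F u s'" for s s'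
      proof -
        have "?a s = ?a s'" using eq k by (intro restrict_ext) blast
        then show ?thesis using bij s by (auto simp: bij_betw_def inj_on_def)
      qed
      fix x assume x: "matching_family E F ?R x"
      have "(\<lambda>n\<in>N. x (\<kappa> (f n) V)) \<in> ?a ` val F V"
        using restrict_kappa_descent_data[OF V f x] bij by (simp add: bij_betw_def)
      then obtain s where s: "s \<in> val F V" and eq: "(\<lambda>n\<in>N. x (\<kappa> (f n) V)) = ?a s" by blast
      have "act F (\<kappa> (f n) V) s = x (\<kappa> (f n) V)" if "n \<in> N" for n
        using fun_cong[OF eq, of n] that by simp
      then show "\<exists>s\<in>val F V. \<forall>u\<in>?R. act F u s = x u" using ext[OF x s] s by blast
    qed
  qed
qed

end

section \<open>The sequence attached to a covering family\<close>

lemma restrict_eq_iff: "restrict g A = restrict h A \<longleftrightarrow> (\<forall>x\<in>A. g x = h x)"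
  by (metis restrict_apply' restrict_ext)

context presheaf_on_fibration
begin

lemma val_fibre_psh [simp]:
  "V \<in> Ob E \<Longrightarrow> fob \<pi> V = i \<Longrightarrow> val (fibre_psh I E \<pi> F i) V = val F V"
  by (simp add: fibre_psh_def)

lemma act_fibre_psh [simp]:
  "u \<in> Mor E \<Longrightarrow> fmor \<pi> u = Ide I i \<Longrightarrow> act (fibre_psh I E \<pi> F i) u = act F u"
  by (simp add: fibre_psh_def)

lemma val_direct_image:
  assumes "f \<in> Mor I" "V \<in> Ob E" "fob \<pi> V = Cod I f"
  shows "val (direct_image I E \<pi> \<kappa> f (fibre_psh I E \<pi> F (Dom I f))) V = val F (Dom E (\<kappa> f V))"
  using kappa[OF assms] by (simp add: direct_image_def psh_comp_def)

lemma act_direct_image: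
  assumes "f \<in> Mor I" "u \<in> Mor E" "fmor \<pi> u = Ide I (Cod I f)"
  shows "act (direct_image I E \<pi> \<kappa> f (fibre_psh I E \<pi> F (Dom I f))) u =
    act F (fmor (inverse_image E I \<pi> \<kappa> f) u)"
  using inverse_image_fmor[OF assms] by (simp add: direct_image_def psh_comp_def)

lemma transition_natural:
  assumes f: "f \<in> Mor I" and u: "u \<in> Mor E" "fmor \<pi> u = Ide I (Cod I f)"
    and s: "s \<in> val F (Cod E u)"
  shows "act F (\<kappa> f (Dom E u)) (act F u s) =
    act F (fmor (inverse_image E I \<pi> \<kappa> f) u) (act F (\<kappa> f (Cod E u)) s)"
proof -
  note pr = proj_vertical[OF u target.cod_ob[OF f]]
  note k = kappa[OF f source.dom_ob[OF u(1)] pr(1)] kappa[OF f source.cod_ob[OF u(1)] pr(2)]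
  note w = inverse_image_fmor[OF f u]
  have "act F (\<kappa> f (Dom E u)) (act F u s) = act F (u \<cdot>\<^bsub>E\<^esub> \<kappa> f (Dom E u)) s"
    using F.act_comp_Mor[OF u(1) k(1) _ s] k by simp
  also have "\<dots> = act F (fmor (inverse_image E I \<pi> \<kappa> f) u) (act F (\<kappa> f (Cod E u)) s)"
    using F.act_comp_Mor[OF k(6) w(1) w(4), of s] k s w(5) by simp
  finally show ?thesis .
qed

lemma direct_image_transition_eq:
  assumes f: "f \<in> Mor I" and p: "p \<in> Mor I" "Cod I p = Dom I f"
    and V: "V \<in> Ob E" "fob \<pi> V = Cod I f" and s: "s \<in> val F (Dom E (\<kappa> f V))"
  shows "direct_image_transition I E \<pi> \<kappa> F f p V s = act F (kappa_comp E I \<pi> \<kappa> f p V) s"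
proof -
  note k = kappa[OF f V]
  have W: "Dom E (\<kappa> f V) \<in> Ob E" "fob \<pi> (Dom E (\<kappa> f V)) = Cod I p" using k p by auto
  show ?thesis
    unfolding direct_image_transition_def transition_def kappa_comp_def inverse_image_fob
    using F.act_comp_Mor[of "\<kappa> p (Dom E (\<kappa> f V))" "comp_iso E I \<pi> \<kappa> f p V" s]
      kappa[OF p(1) W] comp_iso[OF f p V] s by simp
qed

lemma direct_image_transition_val:
  assumes f: "f \<in> Mor I" and p: "p \<in> Mor I" "Cod I p = Dom I f"
    and V: "V \<in> Ob E" "fob \<pi> V = Cod I f" and s: "s \<in> val F (Dom E (\<kappa> f V))"
  shows "direct_image_transition I E \<pi> \<kappa> F f p V s \<in> val F (Dom E (\<kappa> (f \<cdot>\<^bsub>I\<^esub> p) V))"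
  using F.act_val[of "kappa_comp E I \<pi> \<kappa> f p V" s] kappa_comp[OF f p V] s
    direct_image_transition_eq[OF assms] by simp

lemma direct_image_transition_natural:
  assumes f: "f \<in> Mor I" and p: "p \<in> Mor I" "Cod I p = Dom I f"
    and u: "u \<in> Mor E" "fmor \<pi> u = Ide I (Cod I f)" and s: "s \<in> val F (Dom E (\<kappa> f (Cod E u)))"
  shows "direct_image_transition I E \<pi> \<kappa> F f p (Dom E u) (act F (fmor (inverse_image E I \<pi> \<kappa> f) u) s) =
    act F (fmor (inverse_image E I \<pi> \<kappa> (f \<cdot>\<^bsub>I\<^esub> p)) u) (direct_image_transition I E \<pi> \<kappa> F f p (Cod E u) s)"
proof -
  note pr = proj_vertical[OF u target.cod_ob[OF f]]
  note d = source.dom_ob[OF u(1)] and c = source.cod_ob[OF u(1)]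
  note kd = kappa[OF f d pr(1)] and kc = kappa[OF f c pr(2)]
  have fp: "f \<cdot>\<^bsub>I\<^esub> p \<in> Mor I" "Cod I (f \<cdot>\<^bsub>I\<^esub> p) = Cod I f" "Dom I (f \<cdot>\<^bsub>I\<^esub> p) = Dom I p" using f p by auto
  have u': "fmor \<pi> u = Ide I (Cod I (f \<cdot>\<^bsub>I\<^esub> p))" using u fp by simp
  note w = inverse_image_fmor[OF f u] and w' = inverse_image_fmor[OF fp(1) u(1) u']
  note l = kappa_comp[OF f p d pr(1)] and m = kappa_comp[OF f p c pr(2)]
  let ?w = "fmor (inverse_image E I \<pi> \<kappa> f) u" and ?w' = "fmor (inverse_image E I \<pi> \<kappa> (f \<cdot>\<^bsub>I\<^esub> p)) u"
  let ?l = "kappa_comp E I \<pi> \<kappa> f p (Dom E u)" and ?m = "kappa_comp E I \<pi> \<kappa> f p (Cod E u)"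
  have "?w \<cdot>\<^bsub>E\<^esub> ?l = ?m \<cdot>\<^bsub>E\<^esub> ?w'"
  proof (rule kappa_cancel[OF f c pr(2)])
    show "?w \<cdot>\<^bsub>E\<^esub> ?l \<in> Mor E" "Cod E (?w \<cdot>\<^bsub>E\<^esub> ?l) = Dom E (\<kappa> f (Cod E u))"
      "?m \<cdot>\<^bsub>E\<^esub> ?w' \<in> Mor E" "Cod E (?m \<cdot>\<^bsub>E\<^esub> ?w') = Dom E (\<kappa> f (Cod E u))"
      using w w' l m by simp_all
    show "fmor \<pi> (?w \<cdot>\<^bsub>E\<^esub> ?l) = fmor \<pi> (?m \<cdot>\<^bsub>E\<^esub> ?w')"
      using w(1-4) w'(1-4) l m fp p target.comp_Ide[OF p(1)] by simp
    have "\<kappa> f (Cod E u) \<cdot>\<^bsub>E\<^esub> ?w \<cdot>\<^bsub>E\<^esub> ?l = (u \<cdot>\<^bsub>E\<^esub> \<kappa> f (Dom E u)) \<cdot>\<^bsub>E\<^esub> ?l"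
      using source.comp_assoc_Mor[OF l(1) w(1) kc(1)] w l kc by simp
    also have "\<dots> = u \<cdot>\<^bsub>E\<^esub> \<kappa> (f \<cdot>\<^bsub>I\<^esub> p) (Dom E u)"
      using source.comp_assoc_Mor[OF l(1) kd(1) u(1)] l kd by simp
    also have "\<dots> = (\<kappa> f (Cod E u) \<cdot>\<^bsub>E\<^esub> ?m) \<cdot>\<^bsub>E\<^esub> ?w'" using w'(5) m(5) by simp
    also have "\<dots> = \<kappa> f (Cod E u) \<cdot>\<^bsub>E\<^esub> ?m \<cdot>\<^bsub>E\<^esub> ?w'"
      using source.comp_assoc_Mor[OF w'(1) m(1) kc(1)] w' m by simp
    finally show "\<kappa> f (Cod E u) \<cdot>\<^bsub>E\<^esub> ?w \<cdot>\<^bsub>E\<^esub> ?l = \<kappa> f (Cod E u) \<cdot>\<^bsub>E\<^esub> ?m \<cdot>\<^bsub>E\<^esub> ?w'" .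
  qed
  moreover have "act F ?w s \<in> val F (Dom E (\<kappa> f (Dom E u)))"
    using F.act_val[OF w(1)] w s by simp
  ultimately show ?thesis
    using direct_image_transition_eq[OF f p d pr(1)] direct_image_transition_eq[OF f p c pr(2) s]
      F.act_comp_Mor[OF w(1) l(1), of s] F.act_comp_Mor[OF m(1) w'(1), of s] w w' l m s by simp
qed

text \<open>The three arrows of the sequence are always morphisms of presheaves, so that its exactness can
  be read off objectwise.\<close>

theorem covering_sequence_exact_iff:
  assumes i: "i \<in> Ob I" and f: "\<And>n. n \<in> N \<Longrightarrow> f n \<in> Mor I \<and> Cod I (f n) = i"
  shows "covering_sequence_exact I E \<pi> \<kappa> pr1 pr2 F i N f \<longleftrightarrow>
    (\<forall>V\<in>Ob E. fob \<pi> V = i \<longrightarrow>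
       bij_betw (\<lambda>s. \<lambda>n\<in>N. act F (\<kappa> (f n) V) s) (val F V) (descent_data N f V))"
proof -
  define p where "p = (\<lambda>m n. pr1 (f m) (f n))"
  define q where "q = (\<lambda>m n. pr2 (f m) (f n))"
  define ff where "ff = (\<lambda>m n. f m \<cdot>\<^bsub>I\<^esub> p m n)"
  define A where "A = fibre_psh I E \<pi> F i"
  define B where "B = prod_psh N (\<lambda>n. direct_image I E \<pi> \<kappa> (f n) (fibre_psh I E \<pi> F (Dom I (f n))))"
  define D where "D = prod_psh (N \<times> N)
    (\<lambda>(m, n). direct_image I E \<pi> \<kappa> (ff m n) (fibre_psh I E \<pi> F (Dom I (ff m n))))"
  define a where "a = (\<lambda>V s. \<lambda>n\<in>N. transition \<kappa> F (f n) V s)"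
  define b where "b = (\<lambda>V t. \<lambda>(m, n)\<in>N \<times> N. direct_image_transition I E \<pi> \<kappa> F (f m) (p m n) V (t m))"
  define c where "c = (\<lambda>V t. \<lambda>(m, n)\<in>N \<times> N. direct_image_transition I E \<pi> \<kappa> F (f n) (q m n) V (t n))"
  have seq: "covering_sequence_exact I E \<pi> \<kappa> pr1 pr2 F i N f \<longleftrightarrow> exact_sequence (fibre E I \<pi> i) A B D a b c"
    by (simp add: covering_sequence_exact_def p_def q_def ff_def A_def B_def D_def a_def b_def c_def Let_def)
  have fp: "f m \<in> Mor I" "Cod I (f m) = i" "p m n \<in> Mor I" "q m n \<in> Mor I" "Cod I (p m n) = Dom I (f m)"
    "Cod I (q m n) = Dom I (f n)" "f m \<cdot>\<^bsub>I\<^esub> p m n = ff m n" "f n \<cdot>\<^bsub>I\<^esub> q m n = ff m n"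
    "ff m n \<in> Mor I" "Cod I (ff m n) = i"
    if "m \<in> N" "n \<in> N" for m n
    using f[OF that(1)] f[OF that(2)] by (auto simp: p_def q_def ff_def)
  have vB: "val B V = (\<Pi>\<^sub>E n\<in>N. val F (Dom E (\<kappa> (f n) V)))" if "V \<in> Ob E" "fob \<pi> V = i" for V
    unfolding B_def prod_psh_def using f that by (auto simp: val_direct_image intro!: PiE_cong)
  have tv: "t n \<in> val F (Dom E (\<kappa> (f n) V))" if "t \<in> val B V" "V \<in> Ob E" "fob \<pi> V = i" "n \<in> N" for t V n
    using that vB[OF that(2,3)] by (auto simp: PiE_def)
  have vD: "val D V = (\<Pi>\<^sub>E mn\<in>N \<times> N. val F (Dom E (\<kappa> (ff (fst mn) (snd mn)) V)))"
    if "V \<in> Ob E" "fob \<pi> V = i" for V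
    unfolding D_def prod_psh_def using fp that by (auto simp: val_direct_image intro!: PiE_cong)
  have aB: "act B u t = (\<lambda>n\<in>N. act F (fmor (inverse_image E I \<pi> \<kappa> (f n)) u) (t n))"
    if "u \<in> Mor E" "fmor \<pi> u = Ide I i" for u t
    unfolding B_def prod_psh_def using f that by (auto simp: act_direct_image intro!: restrict_ext)
  have aD: "act D u t = (\<lambda>mn\<in>N \<times> N. act F (fmor (inverse_image E I \<pi> \<kappa> (ff (fst mn) (snd mn))) u) (t mn))"
    if "u \<in> Mor E" "fmor \<pi> u = Ide I i" for u t
    unfolding D_def prod_psh_def using fp that by (auto simp: act_direct_image intro!: restrict_ext)
  have kn: "\<kappa> (f n) V \<in> Mor E" "Cod E (\<kappa> (f n) V) = V" if "V \<in> Ob E" "fob \<pi> V = i" "n \<in> N" for V n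
    using kappa[of "f n" V] f[OF that(3)] that by auto
  have ob: "Dom E u \<in> Ob E" "Cod E u \<in> Ob E" "fob \<pi> (Dom E u) = i" "fob \<pi> (Cod E u) = i"
    if "u \<in> Mor E" "fmor \<pi> u = Ide I i" for u
    using source.dom_ob source.cod_ob proj_vertical[OF that i] that by auto
  have morph_a: "psh_morphism (fibre E I \<pi> i) A B a"
    unfolding psh_morphism_def
  proof (intro conjI ballI)
    show "a V \<in> val A V \<rightarrow> val B V" if "V \<in> Ob (fibre E I \<pi> i)" for V
    proof -
      have "act F (\<kappa> (f n) V) s \<in> val F (Dom E (\<kappa> (f n) V))" if "n \<in> N" "s \<in> val F V" for n s
        using F.act_val[of "\<kappa> (f n) V" s] kn[of V n] that \<open>V \<in> Ob (fibre E I \<pi> i)\<close> by simp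
      with that show ?thesis by (auto simp: a_def A_def vB transition_def)
    qed
    show "a (Dom (fibre E I \<pi> i) u) (act A u s) = act B u (a (Cod (fibre E I \<pi> i) u) s)"
      if "u \<in> Mor (fibre E I \<pi> i)" "s \<in> val A (Cod (fibre E I \<pi> i) u)" for u s
    proof -
      have u: "u \<in> Mor E" "fmor \<pi> u = Ide I i" using that by auto
      have s: "s \<in> val F (Cod E u)" using that ob[OF u] by (simp add: A_def)
      have "act F (\<kappa> (f n) (Dom E u)) (act F u s) =
          act F (fmor (inverse_image E I \<pi> \<kappa> (f n)) u) (act F (\<kappa> (f n) (Cod E u)) s)" if "n \<in> N" for n
        using transition_natural[of "f n" u s] f[OF that] u s by simp
      then show ?thesis
        using u by (auto simp: a_def A_def aB transition_def intro!: restrict_ext)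
    qed
  qed
  have morph_b: "psh_morphism (fibre E I \<pi> i) B D b"
    unfolding psh_morphism_def
  proof (intro conjI ballI)
    show "b V \<in> val B V \<rightarrow> val D V" if "V \<in> Ob (fibre E I \<pi> i)" for V
    proof
      fix t assume t: "t \<in> val B V"
      have "direct_image_transition I E \<pi> \<kappa> F (f m) (p m n) V (t m) \<in> val F (Dom E (\<kappa> (ff m n) V))"
        if mn: "m \<in> N" "n \<in> N" for m n
        using direct_image_transition_val[of "f m" "p m n" V "t m"] fp[OF mn] tv[OF t] mn
          \<open>V \<in> Ob (fibre E I \<pi> i)\<close> by simp
      then show "b V t \<in> val D V" using that by (auto simp: b_def vD)
    qed
    show "b (Dom (fibre E I \<pi> i) u) (act B u t) = act D u (b (Cod (fibre E I \<pi> i) u) t)"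
      if "u \<in> Mor (fibre E I \<pi> i)" "t \<in> val B (Cod (fibre E I \<pi> i) u)" for u t
    proof -
      have u: "u \<in> Mor E" "fmor \<pi> u = Ide I i" using that by auto
      have "direct_image_transition I E \<pi> \<kappa> F (f m) (p m n) (Dom E u)
            (act F (fmor (inverse_image E I \<pi> \<kappa> (f m)) u) (t m)) =
          act F (fmor (inverse_image E I \<pi> \<kappa> (ff m n)) u)
            (direct_image_transition I E \<pi> \<kappa> F (f m) (p m n) (Cod E u) (t m))"
        if mn: "m \<in> N" "n \<in> N" for m n
        using direct_image_transition_natural[of "f m" "p m n" u "t m"] fp[OF mn] u
          tv[of t "Cod E u"] that(2) ob[OF u] mn \<open>t \<in> val B (Cod (fibre E I \<pi> i) u)\<close> by simp
      then show ?thesis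
        using u by (auto simp: b_def aB aD intro!: restrict_ext)
    qed
  qed
  have morph_c: "psh_morphism (fibre E I \<pi> i) B D c"
    unfolding psh_morphism_def
  proof (intro conjI ballI)
    show "c V \<in> val B V \<rightarrow> val D V" if "V \<in> Ob (fibre E I \<pi> i)" for V
    proof
      fix t assume t: "t \<in> val B V"
      have "direct_image_transition I E \<pi> \<kappa> F (f n) (q m n) V (t n) \<in> val F (Dom E (\<kappa> (ff m n) V))"
        if mn: "m \<in> N" "n \<in> N" for m n
        using direct_image_transition_val[of "f n" "q m n" V "t n"] fp[OF mn] fp[OF mn(2,1)] tv[OF t] mn
          \<open>V \<in> Ob (fibre E I \<pi> i)\<close> by simp
      then show "c V t \<in> val D V" using that by (auto simp: c_def vD)
    qed
    show "c (Dom (fibre E I \<pi> i) u) (act B u t) = act D u (c (Cod (fibre E I \<pi> i) u) t)"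
      if "u \<in> Mor (fibre E I \<pi> i)" "t \<in> val B (Cod (fibre E I \<pi> i) u)" for u t
    proof -
      have u: "u \<in> Mor E" "fmor \<pi> u = Ide I i" using that by auto
      have "direct_image_transition I E \<pi> \<kappa> F (f n) (q m n) (Dom E u)
            (act F (fmor (inverse_image E I \<pi> \<kappa> (f n)) u) (t n)) =
          act F (fmor (inverse_image E I \<pi> \<kappa> (ff m n)) u)
            (direct_image_transition I E \<pi> \<kappa> F (f n) (q m n) (Cod E u) (t n))"
        if mn: "m \<in> N" "n \<in> N" for m n
        using direct_image_transition_natural[of "f n" "q m n" u "t n"] fp[OF mn] fp[OF mn(2,1)] u
          tv[of t "Cod E u"] that(2) ob[OF u] mn \<open>t \<in> val B (Cod (fibre E I \<pi> i) u)\<close> by simp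
      then show ?thesis
        using u by (auto simp: c_def aB aD intro!: restrict_ext)
    qed
  qed
  have eqz: "{t \<in> val B V. b V t = c V t} = descent_data N f V" if V: "V \<in> Ob E" "fob \<pi> V = i" for V
  proof -
    have "b V t = c V t \<longleftrightarrow> (\<forall>m\<in>N. \<forall>n\<in>N.
       act F (kappa_comp E I \<pi> \<kappa> (f m) (pr1 (f m) (f n)) V) (t m) =
       act F (kappa_comp E I \<pi> \<kappa> (f n) (pr2 (f m) (f n)) V) (t n))"
      if t: "t \<in> (\<Pi>\<^sub>E n\<in>N. val F (Dom E (\<kappa> (f n) V)))" for t
    proof -
      have "direct_image_transition I E \<pi> \<kappa> F (f m) (p m n) V (t m) =
          act F (kappa_comp E I \<pi> \<kappa> (f m) (pr1 (f m) (f n)) V) (t m)"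
        "direct_image_transition I E \<pi> \<kappa> F (f n) (q m n) V (t n) =
          act F (kappa_comp E I \<pi> \<kappa> (f n) (pr2 (f m) (f n)) V) (t n)"
        if mn: "m \<in> N" "n \<in> N" for m n
        using direct_image_transition_eq[of "f m" "p m n" V "t m"]
          direct_image_transition_eq[of "f n" "q m n" V "t n"] fp[OF mn] fp[OF mn(2,1)] PiE_mem[OF t mn(1)] PiE_mem[OF t mn(2)] V
        by (simp_all add: p_def q_def)
      then show ?thesis
        by (auto simp: b_def c_def restrict_eq_iff)
    qed
    then show ?thesis using V by (auto simp: vB descent_data_def)
  qed
  have "a V = (\<lambda>s. \<lambda>n\<in>N. act F (\<kappa> (f n) V) s)" for V by (simp add: a_def transition_def)
  with morph_a morph_b morph_c eqz show ?thesis
    unfolding seq by (auto simp: exact_sequence_def A_def cong: conj_cong)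
qed

end

section \<open>Sheaf condition for vertical and cartesian sieves\<close>

text \<open>A presheaf on a fibred site.  The sieve of \<open>E\<close> generated by a covering sieve \<open>R\<close> of a fibre
  category, called vertical below, is written \<open>generated_sieve E R (\<lambda>u. u)\<close>.\<close>

locale presheaf_on_fibred_site =
  fibred_site elts I JI E \<pi> \<kappa> JE + presheaf_on_fibration E I \<pi> \<kappa> F pr1 pr2
  for elts :: "'u \<Rightarrow> 'u set"
    and I :: "('io, 'im) cat" and JI :: "'io \<Rightarrow> 'im set set"
    and E :: "('eo, 'em) cat" and \<pi> :: "('eo, 'em, 'io, 'im) ftr"
    and \<kappa> :: "'im \<Rightarrow> 'eo \<Rightarrow> 'em" and JE :: "'io \<Rightarrow> 'eo \<Rightarrow> 'em set set"
    and F :: "('eo, 'em, 'v) psh" and pr1 pr2 :: "'im \<Rightarrow> 'im \<Rightarrow> 'im"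
begin

sublocale base: topology I JI
  using base_site by (simp add: U_site_def)

lemma fibre_topology: "i \<in> Ob I \<Longrightarrow> topology (fibre E I \<pi> i) (JE i)"
  using fibre_site by (simp add: U_site_def)

lemma vertical_member:
  assumes V: "V \<in> Ob E" "fob \<pi> V = i" and R: "R \<in> JE i V" and u: "u \<in> R"
  shows "u \<in> Mor E" "Cod E u = V" "fmor \<pi> u = Ide I i" "Dom E u \<in> Ob E" "fob \<pi> (Dom E u) = i"
proof -
  have i: "i \<in> Ob I" using fob_ob V by auto
  interpret fib: topology "fibre E I \<pi> i" "JE i" by (rule fibre_topology[OF i])
  show *: "u \<in> Mor E" "Cod E u = V" "fmor \<pi> u = Ide I i"
    using fib.covering_sieve[of V R] V R u by (auto simp: sieve_def)
  then show "Dom E u \<in> Ob E" "fob \<pi> (Dom E u) = i"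
    using source.dom_ob proj_vertical[OF *(1,3) i] by auto
qed

lemma sieve_vertical:
  assumes "V \<in> Ob E" "fob \<pi> V = i" "R \<in> JE i V"
  shows "sieve E V (generated_sieve E R (\<lambda>u. u))"
  by (rule source.sieve_generated_sieve) (use vertical_member[OF assms] in auto)

text \<open>Base change of a vertical covering sieve along \<open>g\<close>: factor \<open>g\<close> through the inverse image by
  its projection, and use that the inverse image functor preserves covering sieves.\<close>

lemma vertical_base_change:
  assumes V: "V \<in> Ob E" "fob \<pi> V = i" and R: "R \<in> JE i V" and g: "g \<in> Mor E" "Cod E g = V"
  obtains R' where "R' \<in> JE (fob \<pi> (Dom E g)) (Dom E g)"
    "generated_sieve E R' (\<lambda>u. u) \<subseteq> sieve_pullback E g (generated_sieve E R (\<lambda>u. u))"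
proof -
  let ?f = "fmor \<pi> g" and ?j = "fob \<pi> (Dom E g)"
  let ?T = "inverse_image E I \<pi> \<kappa> ?f"
  have f: "?f \<in> Mor I" "Cod I ?f = i" "Dom I ?f = ?j" "fob \<pi> V = Cod I ?f" using g V by auto
  have j: "?j \<in> Ob I" and i: "i \<in> Ob I" using fob_ob source.dom_ob g V by auto
  interpret fj: topology "fibre E I \<pi> ?j" "JE ?j" by (rule fibre_topology[OF j])
  note k = kappa[OF f(1) V(1) f(4)]
  have "?f = ?f \<cdot>\<^bsub>I\<^esub> Ide I ?j" using target.comp_Ide(1)[OF f(1)] f(3) by simp
  then obtain h where h: "h \<in> Mor E" "fmor \<pi> h = Ide I ?j" "Dom E h = Dom E g"
    "Cod E h = Dom E (\<kappa> ?f V)" "\<kappa> ?f V \<cdot>\<^bsub>E\<^esub> h = g"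
    using kappa_lift_obtain[OF f(1) V(1) f(4) _ _ g, of "Ide I ?j"] j f(3) by auto
  have T: "continuous_functor elts (fibre E I \<pi> i) (JE i) (fibre E I \<pi> ?j) (JE ?j) ?T"
    using inverse_image_continuous[OF f(1)] f by simp
  let ?S = "generated_sieve (fibre E I \<pi> ?j) R (fmor ?T)"
  have S: "?S \<in> JE ?j (Dom E (\<kappa> ?f V))"
    using continuous_functor_covering[OF fibre_topology[OF i] fibre_site[OF j] T _ R] V by simp
  let ?R' = "sieve_pullback (fibre E I \<pi> ?j) h ?S"
  have R': "?R' \<in> JE ?j (Dom E g)"
    using fj.base_change[of "Dom E (\<kappa> ?f V)" ?S h] S h k f(3) by simp
  have "r \<in> sieve_pullback E g (generated_sieve E R (\<lambda>u. u))" if r: "r \<in> ?R'" for r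
  proof -
    have rM: "r \<in> Mor E" "Cod E r = Dom E h" "h \<cdot>\<^bsub>E\<^esub> r \<in> ?S"
      using r by (auto simp: mem_sieve_pullback)
    then obtain u z where u: "u \<in> R" "h \<cdot>\<^bsub>E\<^esub> r = fmor ?T u \<cdot>\<^bsub>E\<^esub> z" "z \<in> Mor E"
      "Cod E z = Dom E (fmor ?T u)" by (auto simp: generated_sieve_def)
    note uM = vertical_member[OF V R u(1)]
    have uv: "fmor \<pi> u = Ide I (Cod I ?f)" using uM f by simp
    note t = inverse_image_fmor[OF f(1) uM(1) uv]
    have ku: "\<kappa> ?f (Dom E u) \<in> Mor E" "Cod E (\<kappa> ?f (Dom E u)) = Dom E u"
      using kappa[OF f(1) uM(4)] uM f by simp_all
    have "g \<cdot>\<^bsub>E\<^esub> r = \<kappa> ?f V \<cdot>\<^bsub>E\<^esub> (fmor ?T u \<cdot>\<^bsub>E\<^esub> z)"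
      using source.comp_assoc_Mor[OF rM(1) h(1) k(1) rM(2)] h u k by simp
    also have "\<dots> = (u \<cdot>\<^bsub>E\<^esub> \<kappa> ?f (Dom E u)) \<cdot>\<^bsub>E\<^esub> z"
      using source.comp_assoc_Mor[OF u(3) t(1) k(1)] u t k uM by simp
    also have "\<dots> = u \<cdot>\<^bsub>E\<^esub> (\<kappa> ?f (Dom E u) \<cdot>\<^bsub>E\<^esub> z)"
      using source.comp_assoc_Mor[OF u(3) ku(1) uM(1)] u t ku by simp
    finally have "g \<cdot>\<^bsub>E\<^esub> r = u \<cdot>\<^bsub>E\<^esub> (\<kappa> ?f (Dom E u) \<cdot>\<^bsub>E\<^esub> z)" .
    moreover have "\<kappa> ?f (Dom E u) \<cdot>\<^bsub>E\<^esub> z \<in> Mor E" "Cod E (\<kappa> ?f (Dom E u) \<cdot>\<^bsub>E\<^esub> z) = Dom E u"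
      using u t ku by simp_all
    ultimately have "g \<cdot>\<^bsub>E\<^esub> r \<in> generated_sieve E R (\<lambda>u. u)"
      using u(1) unfolding generated_sieve_def by blast
    then show ?thesis using rM h by (simp add: mem_sieve_pullback)
  qed
  then have "generated_sieve E ?R' (\<lambda>u. u) \<subseteq> sieve_pullback E g (generated_sieve E R (\<lambda>u. u))"
    by (rule source.generated_sieve_subset[OF source.sieve_sieve_pullback[OF sieve_vertical[OF V R] g]])
  then show thesis by (rule that[OF R'])
qed

text \<open>A matching family on the vertical sieve is determined by its restriction to \<open>R\<close>.\<close>

lemma effective_vertical:
  assumes sh: "sheaf (fibre E I \<pi> i) (JE i) (fibre_psh I E \<pi> F i)"
    and V: "V \<in> Ob E" "fob \<pi> V = i" and R: "R \<in> JE i V"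
  shows "effective E F V (generated_sieve E R (\<lambda>u. u))"
proof (rule effectiveI)
  let ?G = "fibre_psh I E \<pi> F i" and ?S = "generated_sieve E R (\<lambda>u. u)"
  note RM = vertical_member[OF V R]
  have i: "i \<in> Ob I" using fob_ob V by auto
  interpret fib: topology "fibre E I \<pi> i" "JE i" by (rule fibre_topology[OF i])
  have eff: "effective (fibre E I \<pi> i) ?G V R"
    using sh V R by (auto simp: sheaf_iff_effective)
  have psh: "presheaf (fibre E I \<pi> i) ?G" using sh by (simp add: sheaf_def)
  have RS: "u \<in> ?S" if "u \<in> R" for u
    using source.generated_sieve_member[of u R "\<lambda>u. u"] RM[OF that] that by simp
  have Rs: "sieve (fibre E I \<pi> i) V R" by (rule fib.covering_sieve) (use V R in auto)
  show "s = s'" if "s \<in> val F V" "s' \<in> val F V" "\<And>u. u \<in> ?S \<Longrightarrow> act F u s = act F u s'" for s s'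
    by (rule effective_separated[OF psh Rs eff]) (use that RS RM V in auto)
  fix x assume x: "matching_family E F ?S x"
  then have "matching_family (fibre E I \<pi> i) ?G R x"
    using RS RM by (auto simp: matching_family_def)
  from effective_obtain[OF eff this] obtain s
    where s: "s \<in> val F V" "\<And>u. u \<in> R \<Longrightarrow> act F u s = x u" using V RM by auto
  have "act F w s = x w" if w: "w \<in> ?S" for w
  proof -
    obtain u v where u: "u \<in> R" "w = u \<cdot>\<^bsub>E\<^esub> v" "v \<in> Mor E" "Cod E v = Dom E u"
      using w by (auto simp: generated_sieve_def)
    then have "act F w s = act F v (x u)"
      using F.act_comp_Mor[of u v s] RM[OF u(1)] s by simp
    also have "\<dots> = x w" using x u RS[OF u(1)] by (simp add: matching_family_def)
    finally show ?thesis .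
  qed
  with s show "\<exists>s\<in>val F V. \<forall>u\<in>?S. act F u s = x u" by blast
qed

text \<open>Every pullback of a vertical sieve contains a vertical sieve, and so is effective.\<close>

lemma vertical_mem_sheaf_topology:
  assumes sh: "\<And>i. i \<in> Ob I \<Longrightarrow> sheaf (fibre E I \<pi> i) (JE i) (fibre_psh I E \<pi> F i)"
    and V: "V \<in> Ob E" "fob \<pi> V = i" and R: "R \<in> JE i V"
  shows "generated_sieve E R (\<lambda>u. u) \<in> sheaf_topology E F V"
  unfolding sheaf_topology_def
proof (intro CollectI conjI ballI impI)
  let ?S = "generated_sieve E R (\<lambda>u. u)"
  show S: "sieve E V ?S" by (rule sieve_vertical[OF V R])
  fix g assume g: "g \<in> Mor E" "Cod E g = V"
  have D: "Dom E u \<in> Ob E" "fob \<pi> (Dom E u) \<in> Ob I" if "u \<in> Mor E" for u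
    using source.dom_ob fob_ob that by auto
  obtain R' where R': "R' \<in> JE (fob \<pi> (Dom E g)) (Dom E g)"
    "generated_sieve E R' (\<lambda>u. u) \<subseteq> sieve_pullback E g ?S"
    using vertical_base_change[OF V R g] by blast
  show "effective E F (Dom E g) (sieve_pullback E g ?S)"
  proof (rule F.effective_superset[OF sieve_vertical[OF D(1)[OF g(1)] refl R'(1)] _ source.sieve_sieve_pullback[OF S g] R'(2)])
    show "effective E F (Dom E g) (generated_sieve E R' (\<lambda>u. u))"
      by (rule effective_vertical[OF sh[OF D(2)[OF g(1)]] D(1)[OF g(1)] refl R'(1)])
    fix u assume "u \<in> sieve_pullback E g ?S"
    then have u: "u \<in> Mor E" "Cod E u = Dom E g" by (auto simp: mem_sieve_pullback)
    obtain R'' where R'': "R'' \<in> JE (fob \<pi> (Dom E u)) (Dom E u)"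
      "generated_sieve E R'' (\<lambda>u. u) \<subseteq> sieve_pullback E u (generated_sieve E R' (\<lambda>u. u))"
      using vertical_base_change[OF D(1)[OF g(1)] refl R'(1) u] by blast
    show "\<exists>L. sieve E (Dom E u) L \<and> effective E F (Dom E u) L \<and>
      L \<subseteq> sieve_pullback E u (generated_sieve E R' (\<lambda>u. u))"
      using R'' sieve_vertical[OF D(1)[OF u(1)] refl R''(1)]
        effective_vertical[OF sh[OF D(2)[OF u(1)]] D(1)[OF u(1)] refl R''(1)] by blast
  qed
qed

text \<open>The assumption on \<open>'n\<close> allows every covering sieve of the base to be written as a family indexed
  by a subset of \<open>'n\<close>.\<close>

lemma effective_cartesian:
  assumes index: "Mor I \<lesssim> (UNIV :: 'n set)"
    and ex: "\<forall>i (N :: 'n set) f. covering_family I JI i N f \<longrightarrow>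
      covering_sequence_exact I E \<pi> \<kappa> pr1 pr2 F i N f"
    and V: "V \<in> Ob E" and R: "R \<in> JI (fob \<pi> V)"
  shows "effective E F V (cartesian_sieve E \<pi> V R)"
proof -
  obtain e :: "'im \<Rightarrow> 'n" where e: "inj_on e (Mor I)" using index by (auto simp: lepoll_def)
  let ?N = "e ` R" and ?f = "inv_into (Mor I) e"
  have i: "fob \<pi> V \<in> Ob I" by (rule fob_ob[OF V])
  have Rs: "sieve I (fob \<pi> V) R" by (rule base.covering_sieve[OF i R])
  have fe: "?f (e u) = u" if "u \<in> R" for u using Rs that e by (auto simp: sieve_def)
  have f: "?f n \<in> Mor I \<and> Cod I (?f n) = fob \<pi> V" if "n \<in> ?N" for n
    using that fe Rs by (auto simp: sieve_def)
  have "generated_sieve I ?N ?f = generated_sieve I R (\<lambda>u. u)"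
    by (rule generated_sieve_section) (rule fe)
  then have gen: "generated_sieve I ?N ?f = R" using target.generated_sieve_self[OF Rs] by simp
  then have "covering_family I JI (fob \<pi> V) ?N ?f" using i f R by (auto simp: covering_family_def)
  from ex[rule_format, OF this] have "bij_betw (\<lambda>s. \<lambda>n\<in>?N. act F (\<kappa> (?f n) V) s) (val F V) (descent_data ?N ?f V)"
    using covering_sequence_exact_iff[OF i, of ?N ?f] f V by blast
  then show ?thesis using effective_cartesian_sieve_iff[OF V, of ?N ?f] f gen by simp
qed

lemma cartesian_mem_sheaf_topology:
  assumes index: "Mor I \<lesssim> (UNIV :: 'n set)"
    and ex: "\<forall>i (N :: 'n set) f. covering_family I JI i N f \<longrightarrow>
      covering_sequence_exact I E \<pi> \<kappa> pr1 pr2 F i N f"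
    and V: "V \<in> Ob E" and R: "R \<in> JI (fob \<pi> V)"
  shows "cartesian_sieve E \<pi> V R \<in> sheaf_topology E F V"
  unfolding sheaf_topology_def
proof (intro CollectI conjI ballI impI)
  show "sieve E V (cartesian_sieve E \<pi> V R)"
    by (rule sieve_cartesian_sieve, rule base.covering_sieve[OF fob_ob[OF V] R])
  fix g assume g: "g \<in> Mor E" "Cod E g = V"
  have "sieve_pullback I (fmor \<pi> g) R \<in> JI (fob \<pi> (Dom E g))"
    using base.base_change[OF fob_ob[OF V] R, of "fmor \<pi> g"] g by simp
  then show "effective E F (Dom E g) (sieve_pullback E g (cartesian_sieve E \<pi> V R))"
    unfolding cartesian_sieve_pullback[OF g]
    by (rule effective_cartesian[OF index ex source.dom_ob[OF g(1)]])
qed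

section \<open>The generating families of the co-evanescent topology\<close>

lemma vertical_family_covering:
  assumes sh: "\<And>i. i \<in> Ob I \<Longrightarrow> sheaf (fibre E I \<pi> i) (JE i) (fibre_psh I E \<pi> F i)"
    and fam: "(V, N, \<phi>) \<in> vertical_families I E \<pi> JE"
  shows "covering_family E (sheaf_topology E F) V N \<phi>"
proof -
  obtain i where i: "i \<in> Ob I" and c: "covering_family (fibre E I \<pi> i) (JE i) V N \<phi>"
    using fam by (auto simp: vertical_families_def)
  interpret fib: topology "fibre E I \<pi> i" "JE i" by (rule fibre_topology[OF i])
  let ?R = "generated_sieve (fibre E I \<pi> i) N \<phi>"
  have p: "\<phi> n \<in> Mor E" "Cod E (\<phi> n) = V" "\<phi> n \<in> ?R" if "n \<in> N" for n
    using c fib.generated_sieve_member[of _ N \<phi>] that by (auto simp: covering_family_def)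
  have V: "V \<in> Ob E" "fob \<pi> V = i" and R: "?R \<in> JE i V" using c by (auto simp: covering_family_def)
  have "generated_sieve E N \<phi> = generated_sieve E ?R (\<lambda>u. u)"
  proof (intro subset_antisym source.generated_sieve_subset)
    show "sieve E V (generated_sieve E ?R (\<lambda>u. u))" by (rule sieve_vertical[OF V R])
    show "\<phi> n \<in> generated_sieve E ?R (\<lambda>u. u)" if "n \<in> N" for n
      using source.generated_sieve_member[of "\<phi> n" ?R "\<lambda>u. u"] p[OF that] by simp
    show "sieve E V (generated_sieve E N \<phi>)" by (rule source.sieve_generated_sieve) (use p in auto)
    show "u \<in> generated_sieve E N \<phi>" if "u \<in> ?R" for u
      using that by (auto simp: generated_sieve_def)
  qed
  then show ?thesis
    using vertical_mem_sheaf_topology[OF sh V R] p V by (auto simp: covering_family_def)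
qed

lemma cartesian_family_covering:
  assumes index: "Mor I \<lesssim> (UNIV :: 'n set)"
    and ex: "\<forall>i (N :: 'n set) f. covering_family I JI i N f \<longrightarrow>
      covering_sequence_exact I E \<pi> \<kappa> pr1 pr2 F i N f"
    and fam: "(V, N, \<phi>) \<in> cartesian_families I JI E \<pi> \<kappa>"
  shows "covering_family E (sheaf_topology E F) V N \<phi>"
proof -
  obtain f W \<theta> where V: "V \<in> Ob E" and c: "covering_family I JI (fob \<pi> V) N f"
    and t: "\<And>n. n \<in> N \<Longrightarrow> iso_in (fibre E I \<pi> (Dom I (f n))) (W n) (Dom E (\<kappa> (f n) V)) (\<theta> n)"
    and p: "\<And>n. n \<in> N \<Longrightarrow> \<phi> n = \<kappa> (f n) V \<cdot>\<^bsub>E\<^esub> \<theta> n"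
    using fam by (auto simp: cartesian_families_def)
  have f: "f n \<in> Mor I \<and> Cod I (f n) = fob \<pi> V" if "n \<in> N" for n
    using c that by (auto simp: covering_family_def)
  have R: "generated_sieve I N f \<in> JI (fob \<pi> V)" using c by (simp add: covering_family_def)
  note gen = generated_sieve_cartesian[where N = N and f = f and W = W and \<theta> = \<theta> and \<phi> = \<phi>, OF V f t p]
  show ?thesis
    using cartesian_mem_sheaf_topology[OF index ex V R] gen V by (simp add: covering_family_def)
qed

lemma vertical_mem_coevanescent:
  assumes V: "V \<in> Ob E" "fob \<pi> V = i" and R: "R \<in> JE i V"
  shows "generated_sieve E R (\<lambda>u. u) \<in> coevanescent_topology I JI E \<pi> \<kappa> JE V"
proof -
  have i: "i \<in> Ob I" using fob_ob V by auto
  interpret fib: topology "fibre E I \<pi> i" "JE i" by (rule fibre_topology[OF i])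
  have Rs: "sieve (fibre E I \<pi> i) V R" by (rule fib.covering_sieve) (use V R in auto)
  have "covering_family (fibre E I \<pi> i) (JE i) V R (\<lambda>u. u)"
    using fib.generated_sieve_self[OF Rs] V R vertical_member[OF V R] by (auto simp: covering_family_def)
  then have fam: "(V, R, \<lambda>u. u) \<in> vertical_families I E \<pi> JE"
    using i by (auto simp: vertical_families_def)
  show ?thesis
    unfolding coevanescent_topology_def generated_topology_def
  proof (intro CollectI allI impI, elim conjE)
    fix J assume "\<forall>(Y, N, \<phi>) \<in> vertical_families I E \<pi> JE \<union> cartesian_families I JI E \<pi> \<kappa>.
      covering_family E J Y N (\<phi> :: 'em \<Rightarrow> 'em)"
    then have "covering_family E J V R (\<lambda>u. u)" using fam by fast
    then show "generated_sieve E R (\<lambda>u. u) \<in> J V" by (simp add: covering_family_def)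
  qed
qed

text \<open>The members of a covering sieve of the base are recovered from the indices
  \<open>\<kappa> f V\<close> by \<open>\<pi>\<close>, so the family can be indexed by a set of morphisms of \<open>E\<close>.\<close>

lemma cartesian_mem_coevanescent:
  assumes V: "V \<in> Ob E" and R: "R \<in> JI (fob \<pi> V)"
  shows "cartesian_sieve E \<pi> V R \<in> coevanescent_topology I JI E \<pi> \<kappa> JE V"
proof -
  have i: "fob \<pi> V \<in> Ob I" by (rule fob_ob[OF V])
  have Rs: "sieve I (fob \<pi> V) R" by (rule base.covering_sieve[OF i R])
  let ?N = "(\<lambda>f. \<kappa> f V) ` R"
  have k: "\<kappa> f V \<in> Mor E" "fmor \<pi> (\<kappa> f V) = f" "fob \<pi> (Dom E (\<kappa> f V)) = Dom I f" "Dom E (\<kappa> f V) \<in> Ob E"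
    if "f \<in> R" for f
    using kappa[of f V] that Rs V by (auto simp: sieve_def)
  have f: "fmor \<pi> n \<in> Mor I \<and> Cod I (fmor \<pi> n) = fob \<pi> V" if "n \<in> ?N" for n
    using that k Rs by (auto simp: sieve_def)
  have "generated_sieve I ?N (fmor \<pi>) = generated_sieve I R (\<lambda>u. u)"
    by (rule generated_sieve_section) (rule k)
  then have gen: "generated_sieve I ?N (fmor \<pi>) = R" using target.generated_sieve_self[OF Rs] by simp
  have cov: "covering_family I JI (fob \<pi> V) ?N (fmor \<pi>)"
    using i f R gen by (auto simp: covering_family_def)
  have t: "iso_in (fibre E I \<pi> (Dom I (fmor \<pi> n))) (Dom E n) (Dom E (\<kappa> (fmor \<pi> n) V)) (Ide E (Dom E n))"
    if nN: "n \<in> ?N" for n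
  proof -
    obtain f where n: "f \<in> R" "n = \<kappa> f V" using nN by blast
    have "fmor \<pi> (Ide E (Dom E n)) = Ide I (Dom I f)" using fmor_ide k[OF n(1)] n by simp
    moreover have "Ide E (Dom E n) \<cdot>\<^bsub>E\<^esub> Ide E (Dom E n) = Ide E (Dom E n)"
      using source.comp_Ide(1)[of "Ide E (Dom E n)"] k[OF n(1)] n by simp
    ultimately show ?thesis
      unfolding iso_in_def using k[OF n(1)] n
      by (intro conjI bexI[of _ "Ide E (Dom E n)"]) (simp_all add: hom_def)
  qed
  have p: "n = \<kappa> (fmor \<pi> n) V \<cdot>\<^bsub>E\<^esub> Ide E (Dom E n)" if "n \<in> ?N" for n
    using that k source.comp_Ide(1) by auto
  have fam: "(V, ?N, \<lambda>u. u) \<in> cartesian_families I JI E \<pi> \<kappa>"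
    unfolding cartesian_families_def
  proof (intro CollectI case_prodI conjI V)
    show "\<exists>f W \<theta>. covering_family I JI (fob \<pi> V) ?N f \<and>
        (\<forall>n\<in>?N. iso_in (fibre E I \<pi> (Dom I (f n))) (W n) (Dom E (\<kappa> (f n) V)) (\<theta> n) \<and>
                n = \<kappa> (f n) V \<cdot>\<^bsub>E\<^esub> \<theta> n)"
      by (rule exI[of _ "fmor \<pi>"], rule exI[of _ "Dom E"], rule exI[of _ "\<lambda>n. Ide E (Dom E n)"])
        (intro conjI ballI cov t p)
  qed
  have eq: "generated_sieve E ?N (\<lambda>u. u) = cartesian_sieve E \<pi> V R"
    using generated_sieve_cartesian(1)[where N = ?N and f = "fmor \<pi>" and W = "Dom E"
      and \<theta> = "\<lambda>n. Ide E (Dom E n)" and \<phi> = "\<lambda>n. n", OF V f t p] gen by simp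
  show ?thesis
    unfolding coevanescent_topology_def generated_topology_def
  proof (intro CollectI allI impI, elim conjE)
    fix J assume "\<forall>(Y, N, \<phi>) \<in> vertical_families I E \<pi> JE \<union> cartesian_families I JI E \<pi> \<kappa>.
      covering_family E J Y N (\<phi> :: 'em \<Rightarrow> 'em)"
    then have "covering_family E J V ?N (\<lambda>u. u)" using fam by fast
    then show "cartesian_sieve E \<pi> V R \<in> J V" by (simp add: covering_family_def eq)
  qed
qed

section \<open>Restriction to the fibres\<close>

text \<open>A fibre product in a fibre category is a fibre product in \<open>E\<close>, because the inverse image
  functors are left exact; only the existence of factorizations is needed.\<close>

lemma fibre_product_factor:
  assumes u: "u \<in> Mor E" "fmor \<pi> u = Ide I i" and u': "u' \<in> Mor E" "fmor \<pi> u' = Ide I i"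
    and i: "i \<in> Ob I" and cod: "Cod E u = Cod E u'"
    and v: "v \<in> Mor E" "Cod E v = Dom E u" and v': "v' \<in> Mor E" "Cod E v' = Dom E u'"
    and eq: "u \<cdot>\<^bsub>E\<^esub> v = u' \<cdot>\<^bsub>E\<^esub> v'"
  obtains p p' z where "p \<in> Mor E" "fmor \<pi> p = Ide I i" "Cod E p = Dom E u"
    "p' \<in> Mor E" "fmor \<pi> p' = Ide I i" "Cod E p' = Dom E u'" "Dom E p = Dom E p'"
    "u \<cdot>\<^bsub>E\<^esub> p = u' \<cdot>\<^bsub>E\<^esub> p'" "z \<in> Mor E" "Cod E z = Dom E p" "v = p \<cdot>\<^bsub>E\<^esub> z" "v' = p' \<cdot>\<^bsub>E\<^esub> z"
proof -
  let ?f = "fmor \<pi> v" and ?j = "fob \<pi> (Dom E v)"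
  let ?T = "inverse_image E I \<pi> \<kappa> ?f"
  have obu: "Dom E u \<in> Ob E" "Cod E u \<in> Ob E" "Dom E u' \<in> Ob E"
    using source.dom_ob source.cod_ob u u' by auto
  have pru: "fob \<pi> (Dom E u) = i" "fob \<pi> (Cod E u) = i" "fob \<pi> (Dom E u') = i"
    using proj_vertical[OF u i] proj_vertical[OF u' i] by auto
  have f: "?f \<in> Mor I" "Cod I ?f = i" "Dom I ?f = ?j" using v pru by auto
  have j: "?j \<in> Ob I" using fob_ob source.dom_ob v by auto
  have f': "fmor \<pi> v' \<in> Mor I" "Cod I (fmor \<pi> v') = i" using v' pru by auto
  have "?f = fmor \<pi> (u \<cdot>\<^bsub>E\<^esub> v)" using u v target.comp_Ide(2)[OF f(1)] f(2) by simp
  also have "\<dots> = fmor \<pi> v'" unfolding eq using u' v' target.comp_Ide(2)[OF f'(1)] f'(2) by simp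
  finally have ff': "fmor \<pi> v' = ?f" by simp
  have Dv: "Dom E v' = Dom E v"
    using source.comp_Mor(2)[OF u(1) v] source.comp_Mor(2)[OF u'(1) v'] eq by simp
  have cu: "fob \<pi> (Dom E u) = Cod I ?f" "fob \<pi> (Cod E u) = Cod I ?f" "fob \<pi> (Dom E u') = Cod I ?f"
    using pru f by auto
  note kA = kappa[OF f(1) obu(1) cu(1)] and kV = kappa[OF f(1) obu(2) cu(2)] and kB = kappa[OF f(1) obu(3) cu(3)]
  have fi: "?f = ?f \<cdot>\<^bsub>I\<^esub> Ide I ?j" using target.comp_Ide(1)[OF f(1)] f(3) by simp
  have ij: "Ide I ?j \<in> Mor I" "Cod I (Ide I ?j) = Dom I ?f" using j f by auto
  obtain h where h: "h \<in> Mor E" "fmor \<pi> h = Ide I ?j" "Dom E h = Dom E v"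
    "Cod E h = Dom E (\<kappa> ?f (Dom E u))" "\<kappa> ?f (Dom E u) \<cdot>\<^bsub>E\<^esub> h = v"
    using kappa_lift_obtain[OF f(1) obu(1) cu(1) ij v fi] by blast
  obtain h' where h': "h' \<in> Mor E" "fmor \<pi> h' = Ide I ?j" "Dom E h' = Dom E v'"
    "Cod E h' = Dom E (\<kappa> ?f (Dom E u'))" "\<kappa> ?f (Dom E u') \<cdot>\<^bsub>E\<^esub> h' = v'"
    using kappa_lift_obtain[OF f(1) obu(3) cu(3) ij v' trans[OF ff' fi]] by blast
  have uc: "fmor \<pi> u = Ide I (Cod I ?f)" "fmor \<pi> u' = Ide I (Cod I ?f)" using u u' f by auto
  note w = inverse_image_fmor[OF f(1) u(1) uc(1)] and w' = inverse_image_fmor[OF f(1) u'(1) uc(2)]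
  have Teq: "fmor ?T u \<cdot>\<^bsub>E\<^esub> h = fmor ?T u' \<cdot>\<^bsub>E\<^esub> h'"
  proof (rule kappa_cancel[OF f(1) obu(2) cu(2)])
    show "fmor ?T u \<cdot>\<^bsub>E\<^esub> h \<in> Mor E" "Cod E (fmor ?T u \<cdot>\<^bsub>E\<^esub> h) = Dom E (\<kappa> ?f (Cod E u))"
      "fmor ?T u' \<cdot>\<^bsub>E\<^esub> h' \<in> Mor E" "Cod E (fmor ?T u' \<cdot>\<^bsub>E\<^esub> h') = Dom E (\<kappa> ?f (Cod E u))"
      using w w' h h' cod by simp_all
    show "fmor \<pi> (fmor ?T u \<cdot>\<^bsub>E\<^esub> h) = fmor \<pi> (fmor ?T u' \<cdot>\<^bsub>E\<^esub> h')"
      using w(1-4) w'(1-4) h h' by simp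
    have "\<kappa> ?f (Cod E u) \<cdot>\<^bsub>E\<^esub> fmor ?T u \<cdot>\<^bsub>E\<^esub> h = (u \<cdot>\<^bsub>E\<^esub> \<kappa> ?f (Dom E u)) \<cdot>\<^bsub>E\<^esub> h"
      using source.comp_assoc_Mor[OF h(1) w(1) kV(1)] w h kV by simp
    also have "\<dots> = u \<cdot>\<^bsub>E\<^esub> v"
      using source.comp_assoc_Mor[OF h(1) kA(1) u(1)] h kA by simp
    also have "\<dots> = (u' \<cdot>\<^bsub>E\<^esub> \<kappa> ?f (Dom E u')) \<cdot>\<^bsub>E\<^esub> h'"
      using source.comp_assoc_Mor[OF h'(1) kB(1) u'(1)] h' kB eq by simp
    also have "\<dots> = \<kappa> ?f (Cod E u) \<cdot>\<^bsub>E\<^esub> fmor ?T u' \<cdot>\<^bsub>E\<^esub> h'"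
      using source.comp_assoc_Mor[OF h'(1) w'(1) kV(1)] w' h' kV cod by simp
    finally show "\<kappa> ?f (Cod E u) \<cdot>\<^bsub>E\<^esub> fmor ?T u \<cdot>\<^bsub>E\<^esub> h = \<kappa> ?f (Cod E u) \<cdot>\<^bsub>E\<^esub> fmor ?T u' \<cdot>\<^bsub>E\<^esub> h'" .
  qed
  have lex: "left_exact (fibre E I \<pi> i) (fibre E I \<pi> ?j) ?T"
    using inverse_image_left_exact[OF f(1)] f by simp
  have homs: "u \<in> hom (fibre E I \<pi> i) (Dom E u) (Cod E u)" "u' \<in> hom (fibre E I \<pi> i) (Dom E u') (Cod E u)"
    using u u' cod by (auto simp: hom_def)
  obtain P p p' where p: "p \<in> hom (fibre E I \<pi> i) P (Dom E u)" "p' \<in> hom (fibre E I \<pi> i) P (Dom E u')"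
    "u \<cdot>\<^bsub>E\<^esub> p = u' \<cdot>\<^bsub>E\<^esub> p'"
    and lift: "\<forall>Z. \<forall>h\<in>hom (fibre E I \<pi> ?j) Z (fob ?T (Dom E u)).
      \<forall>h'\<in>hom (fibre E I \<pi> ?j) Z (fob ?T (Dom E u')).
      fmor ?T u \<cdot>\<^bsub>E\<^esub> h = fmor ?T u' \<cdot>\<^bsub>E\<^esub> h' \<longrightarrow>
      (\<exists>w\<in>hom (fibre E I \<pi> ?j) Z (fob ?T P). fmor ?T p \<cdot>\<^bsub>E\<^esub> w = h \<and> fmor ?T p' \<cdot>\<^bsub>E\<^esub> w = h')"
    by (rule left_exact_fibre_product[OF lex fibre_limits[OF i] homs, unfolded fibre_simps]) (rule that)
  have "h \<in> hom (fibre E I \<pi> ?j) (Dom E v) (fob ?T (Dom E u))"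
    "h' \<in> hom (fibre E I \<pi> ?j) (Dom E v) (fob ?T (Dom E u'))"
    using h h' Dv by (auto simp: hom_def)
  from lift[rule_format, OF this Teq] obtain y where y: "y \<in> Mor E" "Cod E y = Dom E (\<kappa> ?f P)"
    "fmor ?T p \<cdot>\<^bsub>E\<^esub> y = h" "fmor ?T p' \<cdot>\<^bsub>E\<^esub> y = h'"
    by (auto simp: hom_def)
  have pM: "p \<in> Mor E" "fmor \<pi> p = Ide I i" "Dom E p = P" "Cod E p = Dom E u"
    "p' \<in> Mor E" "fmor \<pi> p' = Ide I i" "Dom E p' = P" "Cod E p' = Dom E u'"
    using p by (auto simp: hom_def)
  have P: "P \<in> Ob E" "fob \<pi> P = Cod I ?f"
    using pM source.dom_ob[OF pM(1)] proj_vertical[OF pM(1,2) i] f by auto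
  note kP = kappa[OF f(1) P]
  have pc: "fmor \<pi> p = Ide I (Cod I ?f)" "fmor \<pi> p' = Ide I (Cod I ?f)" using pM f by auto
  note t = inverse_image_fmor[OF f(1) pM(1) pc(1)] and t' = inverse_image_fmor[OF f(1) pM(5) pc(2)]
  have "p \<cdot>\<^bsub>E\<^esub> (\<kappa> ?f P \<cdot>\<^bsub>E\<^esub> y) = (\<kappa> ?f (Dom E u) \<cdot>\<^bsub>E\<^esub> fmor ?T p) \<cdot>\<^bsub>E\<^esub> y"
    using source.comp_assoc_Mor[OF y(1) kP(1) pM(1)] t pM kP y by simp
  also have "\<dots> = v"
    using source.comp_assoc_Mor[OF y(1) t(1) kA(1)] t pM kA y h by simp
  finally have 1: "v = p \<cdot>\<^bsub>E\<^esub> (\<kappa> ?f P \<cdot>\<^bsub>E\<^esub> y)" by simp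
  have "p' \<cdot>\<^bsub>E\<^esub> (\<kappa> ?f P \<cdot>\<^bsub>E\<^esub> y) = (\<kappa> ?f (Dom E u') \<cdot>\<^bsub>E\<^esub> fmor ?T p') \<cdot>\<^bsub>E\<^esub> y"
    using source.comp_assoc_Mor[OF y(1) kP(1) pM(5)] t' pM kP y by simp
  also have "\<dots> = v'"
    using source.comp_assoc_Mor[OF y(1) t'(1) kB(1)] t' pM kB y h' by simp
  finally have 2: "v' = p' \<cdot>\<^bsub>E\<^esub> (\<kappa> ?f P \<cdot>\<^bsub>E\<^esub> y)" by simp
  show thesis
    by (rule that[OF pM(1,2,4,5,6,8) _ p(3) _ _ 1 2]) (use pM kP y in auto)
qed

lemma presheaf_fibre_psh:
  assumes i: "i \<in> Ob I"
  shows "presheaf (fibre E I \<pi> i) (fibre_psh I E \<pi> F i)"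
proof -
  interpret fib: topology "fibre E I \<pi> i" "JE i" by (rule fibre_topology[OF i])
  show ?thesis
  proof
    show "act (fibre_psh I E \<pi> F i) u s \<in> val (fibre_psh I E \<pi> F i) (Dom (fibre E I \<pi> i) u)"
      if "u \<in> Mor (fibre E I \<pi> i)" "s \<in> val (fibre_psh I E \<pi> F i) (Cod (fibre E I \<pi> i) u)" for u s
      using that proj_vertical[of u i] i source.dom_ob source.cod_ob F.act_val by simp
    show "act (fibre_psh I E \<pi> F i) (Ide (fibre E I \<pi> i) X) s = s"
      if "X \<in> Ob (fibre E I \<pi> i)" "s \<in> val (fibre_psh I E \<pi> F i) X" for X s
      using that fmor_ide F.act_ide by simp
    show "act (fibre_psh I E \<pi> F i) (v \<cdot>\<^bsub>fibre E I \<pi> i\<^esub> u) s =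
        act (fibre_psh I E \<pi> F i) u (act (fibre_psh I E \<pi> F i) v s)"
      if u: "u \<in> hom (fibre E I \<pi> i) X Y" and v: "v \<in> hom (fibre E I \<pi> i) Y Z"
        and s: "s \<in> val (fibre_psh I E \<pi> F i) Z" for u v X Y Z s
    proof -
      have uM: "u \<in> Mor E" "fmor \<pi> u = Ide I i" "Cod E u = Y" and vM: "v \<in> Mor E" "fmor \<pi> v = Ide I i" "Dom E v = Y" "Cod E v = Z"
        using u v by (auto simp: hom_def)
      have "fmor \<pi> (v \<cdot>\<^bsub>E\<^esub> u) = Ide I i"
        using fib.comp_hom[OF u v] by (auto simp: hom_def)
      moreover have "s \<in> val F Z" using s source.cod_ob[OF vM(1)] proj_vertical[OF vM(1,2) i] vM by simp
      ultimately show ?thesis using uM vM F.act_comp_Mor[of v u s] by simp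
    qed
  qed
qed

text \<open>Conversely, a matching family on \<open>R\<close> extends to the vertical sieve, by the factorization through
  fibre products.\<close>

lemma effective_fibre:
  assumes V: "V \<in> Ob E" "fob \<pi> V = i" and R: "R \<in> JE i V"
    and eff: "effective E F V (generated_sieve E R (\<lambda>u. u))"
  shows "effective (fibre E I \<pi> i) (fibre_psh I E \<pi> F i) V R"
proof (rule effectiveI)
  let ?G = "fibre_psh I E \<pi> F i" and ?S = "generated_sieve E R (\<lambda>u. u)"
  note RM = vertical_member[OF V R]
  have i: "i \<in> Ob I" using fob_ob V by auto
  have RS: "u \<in> ?S" if "u \<in> R" for u
    using source.generated_sieve_member[of u R "\<lambda>u. u"] RM[OF that] that by simp
  have vG: "val ?G V = val F V" using V by simp
  have aG: "act ?G u = act F u" if "u \<in> R" for u using RM[OF that] by simp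
  show "s = s'" if "s \<in> val ?G V" "s' \<in> val ?G V" "\<And>u. u \<in> R \<Longrightarrow> act ?G u s = act ?G u s'" for s s'
  proof (rule effective_separated[OF F.presheaf_axioms sieve_vertical[OF V R] eff])
    show ss: "s \<in> val F V" "s' \<in> val F V" using that vG by auto
    fix w assume "w \<in> ?S"
    then obtain u v where u: "u \<in> R" "w = u \<cdot>\<^bsub>E\<^esub> v" "v \<in> Mor E" "Cod E v = Dom E u"
      by (auto simp: generated_sieve_def)
    then show "act F w s = act F w s'"
      using that(3)[OF u(1)] aG[OF u(1)] RM[OF u(1)] ss F.act_comp_Mor[of u v] by simp
  qed
  fix x assume x: "matching_family (fibre E I \<pi> i) ?G R x"
  have xv: "x u \<in> val F (Dom E u)" if "u \<in> R" for u
    using x that RM[OF that] by (auto simp: matching_family_def)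
  have xc: "x (u \<cdot>\<^bsub>E\<^esub> v) = act F v (x u)"
    if "u \<in> R" "v \<in> Mor E" "fmor \<pi> v = Ide I i" "Cod E v = Dom E u" for u v
    using x that by (simp add: matching_family_def)
  have well: "act F v (x u) = act F v' (x u')"
    if u: "u \<in> R" "v \<in> Mor E" "Cod E v = Dom E u" and u': "u' \<in> R" "v' \<in> Mor E" "Cod E v' = Dom E u'"
      and eq: "u \<cdot>\<^bsub>E\<^esub> v = u' \<cdot>\<^bsub>E\<^esub> v'" for u v u' v'
  proof -
    note m = RM[OF u(1)] and m' = RM[OF u'(1)]
    have cod: "Cod E u = Cod E u'" using m m' by simp
    obtain p p' z where p: "p \<in> Mor E" "fmor \<pi> p = Ide I i" "Cod E p = Dom E u"
      "p' \<in> Mor E" "fmor \<pi> p' = Ide I i" "Cod E p' = Dom E u'" "Dom E p = Dom E p'"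
      "u \<cdot>\<^bsub>E\<^esub> p = u' \<cdot>\<^bsub>E\<^esub> p'" "z \<in> Mor E" "Cod E z = Dom E p" "v = p \<cdot>\<^bsub>E\<^esub> z" "v' = p' \<cdot>\<^bsub>E\<^esub> z"
      by (rule fibre_product_factor[OF m(1,3) m'(1,3) i cod u(2,3) u'(2,3) eq])
    have "act F v (x u) = act F z (x (u \<cdot>\<^bsub>E\<^esub> p))"
      using F.act_comp_Mor[of p z "x u"] p xv[OF u(1)] xc[OF u(1) p(1,2,3)] by simp
    also have "\<dots> = act F v' (x u')"
      using F.act_comp_Mor[of p' z "x u'"] p xv[OF u'(1)] xc[OF u'(1) p(4,5,6)] by simp
    finally show ?thesis .
  qed
  \<comment> \<open>The extension of \<open>x\<close>: \<open>d w\<close> is a chosen factorization of \<open>w\<close> through a member of \<open>R\<close>, and by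
    \<open>well\<close> the value does not depend on it.\<close>
  define d where "d w = (SOME uv. fst uv \<in> R \<and> snd uv \<in> Mor E \<and> Cod E (snd uv) = Dom E (fst uv) \<and>
    w = fst uv \<cdot>\<^bsub>E\<^esub> snd uv)" for w
  define y where "y w = act F (snd (d w)) (x (fst (d w)))" for w
  have yx: "y (u \<cdot>\<^bsub>E\<^esub> v) = act F v (x u)" if u: "u \<in> R" "v \<in> Mor E" "Cod E v = Dom E u" for u v
  proof -
    let ?w = "u \<cdot>\<^bsub>E\<^esub> v"
    have "fst (d ?w) \<in> R \<and> snd (d ?w) \<in> Mor E \<and> Cod E (snd (d ?w)) = Dom E (fst (d ?w)) \<and>
      ?w = fst (d ?w) \<cdot>\<^bsub>E\<^esub> snd (d ?w)"
      unfolding d_def by (rule someI[of _ "(u, v)"]) (use u in simp)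
    then show ?thesis unfolding y_def using well[of "fst (d ?w)" "snd (d ?w)" u v] u by metis
  qed
  have "matching_family E F ?S y"
    unfolding matching_family_def
  proof (intro ballI conjI impI)
    fix w assume "w \<in> ?S"
    then obtain u v where u: "u \<in> R" "w = u \<cdot>\<^bsub>E\<^esub> v" "v \<in> Mor E" "Cod E v = Dom E u"
      by (auto simp: generated_sieve_def)
    note m = RM[OF u(1)]
    show "y w \<in> val F (Dom E w)"
      using yx[OF u(1,3,4)] F.act_val[of v "x u"] xv[OF u(1)] u m by simp
    fix t assume t: "t \<in> Mor E" "Cod E t = Dom E w"
    then have "w \<cdot>\<^bsub>E\<^esub> t = u \<cdot>\<^bsub>E\<^esub> (v \<cdot>\<^bsub>E\<^esub> t)" "Cod E t = Dom E v"
      using u m by (auto simp: source.comp_assoc_Mor)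
    then show "y (w \<cdot>\<^bsub>E\<^esub> t) = act F t (y w)"
      using yx[of u v] yx[of u "v \<cdot>\<^bsub>E\<^esub> t"] u t F.act_comp_Mor[of v t "x u"] xv[OF u(1)] by simp
  qed
  from effective_obtain[OF eff this] obtain s
    where s: "s \<in> val F V" "\<And>w. w \<in> ?S \<Longrightarrow> act F w s = y w" by blast
  have "act ?G u s = x u" if u: "u \<in> R" for u
  proof -
    note m = RM[OF u]
    have "y (u \<cdot>\<^bsub>E\<^esub> Ide E (Dom E u)) = x u"
      using yx[OF u, of "Ide E (Dom E u)"] F.act_ide[OF m(4) xv[OF u]] m(4) by simp
    then show ?thesis using s(2)[OF RS[OF u]] m aG[OF u] by simp
  qed
  with s show "\<exists>s\<in>val ?G V. \<forall>u\<in>R. act ?G u s = x u" using vG by auto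
qed

section \<open>Sheaves for the co-evanescent topology\<close>

theorem sheaf_coevanescent_iff:
  assumes index: "Mor I \<lesssim> (UNIV :: 'n set)"
  shows "sheaf E (coevanescent_topology I JI E \<pi> \<kappa> JE) F \<longleftrightarrow>
    (\<forall>i\<in>Ob I. sheaf (fibre E I \<pi> i) (JE i) (fibre_psh I E \<pi> F i)) \<and>
    (\<forall>i (N :: 'n set) f. covering_family I JI i N f \<longrightarrow>
       covering_sequence_exact I E \<pi> \<kappa> pr1 pr2 F i N f)" (is "?L \<longleftrightarrow> ?fib \<and> ?ex")
proof (intro iffI conjI ballI allI impI)
  assume ?L
  then have eff: "effective E F V R" if "V \<in> Ob E" "R \<in> coevanescent_topology I JI E \<pi> \<kappa> JE V" for V R
    using that by (simp add: sheaf_iff_effective)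
  show "sheaf (fibre E I \<pi> i) (JE i) (fibre_psh I E \<pi> F i)" if i: "i \<in> Ob I" for i
    unfolding sheaf_iff_effective
  proof (intro conjI ballI presheaf_fibre_psh[OF i])
    fix V R assume "V \<in> Ob (fibre E I \<pi> i)" and R: "R \<in> JE i V"
    then have V: "V \<in> Ob E" "fob \<pi> V = i" by auto
    show "effective (fibre E I \<pi> i) (fibre_psh I E \<pi> F i) V R"
      by (rule effective_fibre[OF V R eff[OF V(1) vertical_mem_coevanescent[OF V R]]])
  qed
  fix i and N :: "'n set" and f assume c: "covering_family I JI i N f"
  then have i: "i \<in> Ob I" and f: "\<And>n. n \<in> N \<Longrightarrow> f n \<in> Mor I \<and> Cod I (f n) = i"
    and R: "generated_sieve I N f \<in> JI i" by (auto simp: covering_family_def)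
  have "\<forall>V\<in>Ob E. fob \<pi> V = i \<longrightarrow>
    bij_betw (\<lambda>s. \<lambda>n\<in>N. act F (\<kappa> (f n) V) s) (val F V) (descent_data N f V)"
  proof (intro ballI impI)
    fix V assume V: "V \<in> Ob E" "fob \<pi> V = i"
    have "effective E F V (cartesian_sieve E \<pi> V (generated_sieve I N f))"
      by (rule eff[OF V(1)], rule cartesian_mem_coevanescent[OF V(1)]) (use R V in simp)
    then show "bij_betw (\<lambda>s. \<lambda>n\<in>N. act F (\<kappa> (f n) V) s) (val F V) (descent_data N f V)"
      using effective_cartesian_sieve_iff[of V N f] V f by simp
  qed
  then show "covering_sequence_exact I E \<pi> \<kappa> pr1 pr2 F i N f"
    using covering_sequence_exact_iff[OF i, of N f] f by blast
next
  assume "?fib \<and> ?ex"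
  then have fib: "\<And>i. i \<in> Ob I \<Longrightarrow> sheaf (fibre E I \<pi> i) (JE i) (fibre_psh I E \<pi> F i)"
    and ex: ?ex by blast+
  show ?L
    unfolding coevanescent_topology_def
  proof (rule F.sheaf_generated_topologyI)
    fix V and N :: "'em set" and \<phi>
    assume "(V, N, \<phi>) \<in> vertical_families I E \<pi> JE \<union> cartesian_families I JI E \<pi> \<kappa>"
    then show "covering_family E (sheaf_topology E F) V N \<phi>"
      using vertical_family_covering[OF fib] cartesian_family_covering[OF index ex] by blast
  qed
qed

end

theorem proposition5p10:
  fixes elts :: "'u \<Rightarrow> 'u set"
    and I :: "('io, 'im) cat" and JI :: "'io \<Rightarrow> 'im set set"
    and E :: "('eo, 'em) cat" and \<pi> :: "('eo, 'em, 'io, 'im) ftr"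
    and \<kappa> :: "'im \<Rightarrow> 'eo \<Rightarrow> 'em" and JE :: "'io \<Rightarrow> 'eo \<Rightarrow> 'em set set"
    and pr1 pr2 :: "'im \<Rightarrow> 'im \<Rightarrow> 'im"
    and F :: "('eo, 'em, 'u) psh"
  assumes "fibred_site elts I JI E \<pi> \<kappa> JE"
    and "\<And>f g. f \<in> Mor I \<Longrightarrow> g \<in> Mor I \<Longrightarrow> Cod I f = Cod I g \<Longrightarrow>
           is_fibre_product I f g (pr1 f g) (pr2 f g)"
    and index_type: "Mor I \<lesssim> (UNIV :: 'n set)"
    and "U_presheaf elts E F"
  shows "U_sheaf elts E (coevanescent_topology I JI E \<pi> \<kappa> JE) F \<longleftrightarrow>
    (\<forall>i\<in>Ob I. U_sheaf elts (fibre E I \<pi> i) (JE i) (fibre_psh I E \<pi> F i)) \<and>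
    (\<forall>i (N :: 'n set) f. covering_family I JI i N f \<longrightarrow>
       covering_sequence_exact I E \<pi> \<kappa> pr1 pr2 F i N f)"
proof -
  interpret fibred_site elts I JI E \<pi> \<kappa> JE by fact
  interpret F: presheaf E F using assms(4) by (simp add: U_presheaf_def)
  interpret presheaf_on_fibred_site elts I JI E \<pi> \<kappa> JE F pr1 pr2
    by unfold_locales (rule assms(2))
  have "U_presheaf elts (fibre E I \<pi> i) (fibre_psh I E \<pi> F i)" if "i \<in> Ob I" for i
    using presheaf_fibre_psh[OF that] assms(4) by (simp add: U_presheaf_def)
  then show ?thesis
    using sheaf_coevanescent_iff[OF index_type] assms(4) by (simp add: U_sheaf_def)
qed

end
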